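(* Let $\lambda\in\mathbb{R}$. There is $A_0=A_0(\lambda)$ such that for every $A\geq A_0$ the following holds for all sufficiently large $n$ and all integers $d$ with $3\leq d\leq n-1$: with $p=\frac{1+\lambda n^{-1/3}}{d-1}$, $$\mathbb{P}\left[L_1(G_{n,d,p})\notin [A^{-1}n^{2/3},\,A n^{2/3}]\right]\leq 20A^{-1/2}.$$
   Context: $\mathcal{G}_{n,d}$ is the set of simple vertex-labelled $d$-regular graphs on $n$ vertices, and $G_{n,d}$ is chosen uniformly at random from $\mathcal{G}_{n,d}$. $G_{n,d,p}$ is obtained from $G_{n,d}$ by retaining each edge independently with probability $p$. $L_1(G)$ denotes the number of vertices of the largest connected component of $G$. *)

theory Defs
  imports "HOL-Probability.Probability" "HOL-Library.Ramsey"
begin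

text \<open>A simple graph on the labelled vertex set \<open>V\<close> is identified with its edge set,
  a subset of \<open>[V]\<^bsup>2\<^esup>\<close> (the two-element subsets of \<open>V\<close>).\<close>

definition vertices :: "nat \<Rightarrow> nat set" where
  "vertices n = {1..n}"

definition degree :: "'a set set \<Rightarrow> 'a \<Rightarrow> nat" where
  "degree E v = card {e \<in> E. v \<in> e}"

definition regular_graphs :: "nat \<Rightarrow> nat \<Rightarrow> nat set set set" where
  "regular_graphs n d = {E. E \<subseteq> nsets (vertices n) 2 \<and> (\<forall>v \<in> vertices n. degree E v = d)}"

definition adjacency :: "'a set set \<Rightarrow> ('a \<times> 'a) set" where
  "adjacency E = {(u, v). {u, v} \<in> E}"

definition component :: "'a set \<Rightarrow> 'a set set \<Rightarrow> 'a \<Rightarrow> 'a set" where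
  "component V E v = {w \<in> V. (v, w) \<in> (adjacency E)\<^sup>*}"

definition components :: "'a set \<Rightarrow> 'a set set \<Rightarrow> 'a set set" where
  "components V E = component V E ` V"

definition L1 :: "'a set \<Rightarrow> 'a set set \<Rightarrow> nat" where
  "L1 V E = Max (card ` components V E)"

text \<open>The law of \<open>G\<^sub>n\<^sub>,\<^sub>d\<close>. It is only meaningful if \<^term>\<open>regular_graphs n d\<close> is nonempty;
  for \<open>d < n\<close> this holds exactly when \<open>n * d\<close> is even.\<close>

definition random_regular_graph :: "nat \<Rightarrow> nat \<Rightarrow> nat set set pmf" where
  "random_regular_graph n d = pmf_of_set (regular_graphs n d)"

text \<open>Each edge \<open>e \<in> E\<close> gets an independent Bernoulli coin, and is retained if the coin shows
  \<^term>\<open>True\<close>. The library's \<^const>\<open>bernoulli_pmf\<close> truncates its parameter to the unit interval.\<close>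

definition percolate :: "real \<Rightarrow> 'a set set \<Rightarrow> 'a set set pmf" where
  "percolate p E = map_pmf (\<lambda>keep. {e \<in> E. keep e}) (Pi_pmf E False (\<lambda>_. bernoulli_pmf p))"

definition percolated_regular_graph :: "nat \<Rightarrow> nat \<Rightarrow> real \<Rightarrow> nat set set pmf" where
  "percolated_regular_graph n d p = bind_pmf (random_regular_graph n d) (percolate p)"

end

theory Submission imports Defs "HOL-Real_Asymp.Real_Asymp"
begin

text \<open>Upper tail: in any \<open>d\<close>-regular graph the component of a vertex is dominated by a branching
  process, so an explicit subsolution \<open>\<phi> \<le> s (1 - p + p \<phi>)\<^bsup>d - 1\<^esup>\<close> with
  \<open>1 - \<phi> = O(n\<^bsup>-1/3\<^esup>)\<close> and \<open>s = exp (- n\<^bsup>-2/3\<^esup>)\<close> bounds the probability of a component of size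
  \<open>n\<^bsup>2/3\<^esup>\<close> by \<open>O(n\<^bsup>-1/3\<^esup>)\<close>; Markov's inequality for the number of vertices in large components
  gives \<open>O(1/A)\<close>.

  Lower tail: explore the percolated graph vertex by vertex. The number of active vertices is at
  least a random walk with independent increments \<open>Bin(d - 1, p) - 1\<close>, not depending on the graph,
  minus a loss caused by edges that lead back to already discovered vertices. A switching argument
  shows that, given the history, each unrevealed pair is an edge with probability \<open>O(d/n)\<close>, so the
  expected loss after \<open>m\<close> vertices is \<open>O(m\<^sup>2/n)\<close>. Split the first \<open>m = O(A\<^bsup>-3/4\<^esup> n\<^bsup>2/3\<^esup>)\<close> vertices into about
  \<open>A\<^bsup>1/4\<^esup>\<close> blocks of length of order \<open>L = n\<^bsup>2/3\<^esup>/A\<close>. With probability bounded below the walk rises by \<open>5 \<surd>L\<close>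
  within a block and then does not fall by \<open>4 \<surd>L\<close> during the next \<open>L\<close> steps; if the total loss is
  at most \<open>\<surd>L\<close>, one such block forces a component with at least \<open>L\<close> vertices.\<close>


section \<open>Expectations over finitely supported distributions\<close>

text \<open>For \<open>d\<close> up to \<open>n - 1\<close> no configuration model is at hand, and
  after conditioning on a history the unseen edges have no explicit law. The coins are therefore
  kept apart from the graph: every step consumes a row of coins whose law is the same for all
  graphs. The block estimates then hold for each fixed graph, and only the loss is averaged over
  graphs, with the coins held fixed. Switching cannot bound edges that lead back to processed
  vertices, since these are already revealed. They are charged earlier, when their outer end
  \<open>w\<close> is discovered from \<open>u\<close>: the pair \<open>{u, w}\<close> is then still
  unrevealed. The condition \<open>3 <= d\<close> enters as \<open>2 <= d - 1\<close>. It keeps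
  \<open>p\<close> below 11/20, so that a positive second-order term survives both in the
  subsolution and in the exponential moments of the walk. With \<open>s = sqrt A\<close> the three
  errors are \<open>exp (- c * sqrt s)\<close>, from having no good block, and two terms of order
  \<open>1 / s\<^sup>2\<close>, from the loss and from the upper tail. For large \<open>A\<close>
  each is at most \<open>1 / s\<close>.\<close>

abbreviation expec :: "'a pmf \<Rightarrow> ('a \<Rightarrow> real) \<Rightarrow> real" where
  "expec \<equiv> measure_pmf.expectation"

lemma expec_bind:
  assumes "finite (set_pmf p)" "\<And>x. x \<in> set_pmf p \<Longrightarrow> finite (set_pmf (f x))"
  shows "expec (bind_pmf p f) h = expec p (\<lambda>x. expec (f x) h)"
proof -
  have "expec (bind_pmf p f) h = (\<Sum>a\<in>set_pmf p. pmf p a * expec (f a) h)"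
    using assms by (subst pmf_expectation_bind[OF assms(1) _ order_refl]) simp_all
  also have "\<dots> = expec p (\<lambda>x. expec (f x) h)"
    using assms(1) by (subst integral_measure_pmf_real[OF assms(1)]) (simp_all add: mult.commute)
  finally show ?thesis .
qed

lemma expec_mono:
  assumes "finite (set_pmf p)" "\<And>x. x \<in> set_pmf p \<Longrightarrow> f x \<le> g x"
  shows "expec p f \<le> expec p g"
  using assms by (intro integral_mono_AE integrable_measure_pmf_finite) (auto simp: AE_measure_pmf_iff)

lemma expec_cong:
  assumes "\<And>x. x \<in> set_pmf p \<Longrightarrow> f x = g x"
  shows "expec p f = expec p g"
  using assms by (intro integral_cong_AE) (auto simp: AE_measure_pmf_iff)

lemma expec_add:
  assumes "finite (set_pmf p)"
  shows "expec p (\<lambda>x. f x + g x) = expec p f + expec p g"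
  using assms by (intro Bochner_Integration.integral_add integrable_measure_pmf_finite)

lemma expec_diff:
  assumes "finite (set_pmf p)"
  shows "expec p (\<lambda>x. f x - g x) = expec p f - expec p g"
  using assms by (intro Bochner_Integration.integral_diff integrable_measure_pmf_finite)

lemma expec_sum:
  assumes "finite (set_pmf p)"
  shows "expec p (\<lambda>x. \<Sum>i\<in>I. f i x) = (\<Sum>i\<in>I. expec p (f i))"
  using assms by (intro Bochner_Integration.integral_sum integrable_measure_pmf_finite)

lemma prob_eq_expec: "measure_pmf.prob p A = expec p (indicator A)"
  by simp

lemma prob_bind:
  assumes "finite (set_pmf p)" "\<And>x. x \<in> set_pmf p \<Longrightarrow> finite (set_pmf (f x))"
  shows "measure_pmf.prob (bind_pmf p f) A = expec p (\<lambda>x. measure_pmf.prob (f x) A)"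
  unfolding prob_eq_expec by (rule expec_bind[OF assms])

lemma prob_le_expec:
  assumes "finite (set_pmf p)" "\<And>x. x \<in> set_pmf p \<Longrightarrow> 0 \<le> f x"
    and "\<And>x. x \<in> set_pmf p \<Longrightarrow> x \<in> A \<Longrightarrow> 1 \<le> f x"
  shows "measure_pmf.prob p A \<le> expec p f"
  unfolding prob_eq_expec by (rule expec_mono) (use assms in \<open>auto simp: indicator_def\<close>)

lemma prob_mono_set_pmf:
  assumes "\<And>x. x \<in> set_pmf p \<Longrightarrow> x \<in> A \<Longrightarrow> x \<in> B"
  shows "measure_pmf.prob p A \<le> measure_pmf.prob p B"
proof -
  have "measure_pmf.prob p A = measure_pmf.prob p (A \<inter> set_pmf p)"
    by (simp add: measure_Int_set_pmf)
  also have "\<dots> \<le> measure_pmf.prob p B"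
    using assms by (intro measure_pmf.finite_measure_mono) auto
  finally show ?thesis .
qed

section \<open>Bernoulli percolation\<close>

lemma finite_set_Pi_bool: "finite A \<Longrightarrow> finite (set_pmf (Pi_pmf A False (\<lambda>_. p)))"
  by (rule finite_subset[OF set_Pi_pmf_subset']) auto

lemma finite_set_percolate: "finite E \<Longrightarrow> finite (set_pmf (percolate p E))"
  unfolding percolate_def by (simp add: finite_set_Pi_bool)

lemma set_percolate: "finite E \<Longrightarrow> set_pmf (percolate p E) \<subseteq> Pow E"
  unfolding percolate_def by auto

lemma percolate_empty [simp]: "percolate p {} = return_pmf {}"
  by (simp add: percolate_def)

lemma percolate_union:
  assumes "finite A" "finite B" "A \<inter> B = {}"
  shows "percolate p (A \<union> B) =
    bind_pmf (percolate p A) (\<lambda>X. bind_pmf (percolate p B) (\<lambda>Y. return_pmf (X \<union> Y)))"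
proof -
  have eq: "{e. (e \<in> A \<longrightarrow> f e) \<and> (e \<notin> A \<longrightarrow> e \<in> B \<and> g e)} = {e \<in> A. f e} \<union> {e \<in> B. g e}"
    for f g :: "'a set \<Rightarrow> bool" using assms(3) by auto
  show ?thesis
    unfolding percolate_def
    by (subst Pi_pmf_union[OF assms])
       (simp add: map_pmf_def pair_pmf_def bind_assoc_pmf bind_return_pmf case_prod_unfold eq)
qed

lemma expec_bernoulli:
  assumes "0 \<le> p" "p \<le> 1"
  shows "expec (bernoulli_pmf p) f = p * f True + (1 - p) * f False"
  using assms by (simp add: integral_measure_pmf_real[where A=UNIV] UNIV_bool)

lemma expec_percolate_power:
  assumes "finite E" "0 \<le> p" "p \<le> 1" "0 \<le> (x::real)"
  shows "expec (percolate p E) (\<lambda>D. x ^ card D) = (1 - p + p * x) ^ card E"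
proof -
  have "expec (percolate p E) (\<lambda>D. x ^ card D)
      = expec (Pi_pmf E False (\<lambda>_. bernoulli_pmf p)) (\<lambda>f. x ^ card {e \<in> E. f e})"
    by (simp add: percolate_def)
  also have "\<dots> = expec (Pi_pmf E False (\<lambda>_. bernoulli_pmf p)) (\<lambda>f. \<Prod>e\<in>E. if f e then x else 1)"
    using assms(1) by (intro expec_cong) (simp add: prod.If_cases Int_def)
  also have "\<dots> = (\<Prod>e\<in>E. expec (bernoulli_pmf p) (\<lambda>b. if b then x else 1))"
    using assms by (intro expectation_prod_Pi_pmf integrable_measure_pmf_finite) auto
  also have "\<dots> = (1 - p + p * x) ^ card E"
    using assms by (simp add: expec_bernoulli algebra_simps)
  finally show ?thesis .
qed

section \<open>Switching\<close>

definition nbrs :: "'a set set \<Rightarrow> 'a \<Rightarrow> 'a set" where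
  "nbrs E u = {w. {u, w} \<in> E}"

text \<open>These are exactly the edges revealed once the vertices of \<open>P\<close> are
  processed; for fixed coins, conditioning on a history amounts to fixing this set.\<close>

definition inc :: "'a set set \<Rightarrow> 'a set \<Rightarrow> 'a set set" where
  "inc E P = {e \<in> E. e \<inter> P \<noteq> {}}"

lemma nbrs_sym: "w \<in> nbrs E u \<longleftrightarrow> u \<in> nbrs E w"
  by (simp add: nbrs_def insert_commute)

lemma finite_nbrs: "finite E \<Longrightarrow> finite (nbrs E u)"
  unfolding nbrs_def by (rule finite_subset[of _ "\<Union>(E \<inter> {e. finite e})"]) auto

lemma not_self_nbrs: "E \<subseteq> nsets V 2 \<Longrightarrow> u \<notin> nbrs E u"
  by (auto simp: nbrs_def nsets_def)

lemma nbrs_subset: "E \<subseteq> nsets V 2 \<Longrightarrow> nbrs E u \<subseteq> V"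
  by (auto simp: nbrs_def nsets_def)

lemma star_eq_image_nbrs:
  assumes "E \<subseteq> nsets V 2"
  shows "{e \<in> E. u \<in> e} = (\<lambda>w. {u, w}) ` nbrs E u"
proof -
  have "e \<in> (\<lambda>w. {u, w}) ` nbrs E u" if "e \<in> E" "u \<in> e" for e
  proof -
    from assms that obtain x y where "e = {x, y}" by (meson nsets2_E subsetD)
    with that show ?thesis by (auto simp: nbrs_def insert_commute)
  qed
  then show ?thesis by (auto simp: nbrs_def)
qed

lemma degree_eq_card_nbrs:
  assumes "E \<subseteq> nsets V 2"
  shows "degree E u = card (nbrs E u)"
  unfolding degree_def star_eq_image_nbrs[OF assms]
  by (intro card_image) (auto simp: inj_on_def doubleton_eq_iff)

lemma finite_regular_graphs: "finite (regular_graphs n d)"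
  unfolding regular_graphs_def vertices_def
  by (rule finite_subset[of _ "Pow (nsets {1..n} 2)"]) (auto intro: finite_imp_finite_nsets)

lemma card_nbrs_regular:
  assumes "E \<in> regular_graphs n d" "u \<in> vertices n"
  shows "card (nbrs E u) = d"
  using assms degree_eq_card_nbrs[of E "vertices n" u] by (auto simp: regular_graphs_def)

lemma finite_regular_graph: "E \<in> regular_graphs n d \<Longrightarrow> finite E"
  unfolding regular_graphs_def vertices_def
  by (auto intro: finite_subset[OF _ finite_imp_finite_nsets])

definition switch :: "'a \<Rightarrow> 'a \<Rightarrow> 'a \<Rightarrow> 'a \<Rightarrow> 'a set set \<Rightarrow> 'a set set" where
  "switch x y a b E = (E - {{x, y}, {a, b}}) \<union> {{x, a}, {y, b}}"

definition switchable :: "'a \<Rightarrow> 'a \<Rightarrow> 'a \<Rightarrow> 'a \<Rightarrow> 'a set set \<Rightarrow> bool" where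
  "switchable x y a b E \<longleftrightarrow> {x, y} \<in> E \<and> {a, b} \<in> E \<and> a \<notin> {x, y} \<and> b \<notin> {x, y} \<and>
     {x, a} \<notin> E \<and> {y, b} \<notin> E \<and> x \<noteq> y \<and> a \<noteq> b"

text \<open>The reverse move is a switching of the same form with \<open>y\<close> and
  \<open>a\<close> exchanged, so \<open>(a, b)\<close> and the switched graph together determine the
  original graph.\<close>

lemma switch_inverse:
  assumes "switchable x y a b E"
  shows "switch x a y b (switch x y a b E) = E"
  using assms unfolding switch_def switchable_def by (auto simp: doubleton_eq_iff insert_commute)

lemma card_exchange:
  assumes "finite S" "x \<in> S" "y \<notin> S - {x}"
  shows "card (insert y (S - {x})) = card S"
  using assms by (metis card.remove card_insert_disjoint finite_Diff)

lemma degree_switch_end: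
  assumes "switchable x y a b E" "finite E"
  shows "degree (switch x y a b E) x = degree E x"
proof -
  let ?S = "{e \<in> E. x \<in> e}"
  have 1: "{e \<in> switch x y a b E. x \<in> e} = insert {x, a} (?S - {{x, y}})"
    using assms(1) by (auto simp: switch_def switchable_def)
  show ?thesis
    unfolding degree_def 1
    by (rule card_exchange) (use assms in \<open>auto simp: switchable_def\<close>)
qed

lemma switch_sym: "switch y x b a E = switch x y a b E" "switch a b x y E = switch x y a b E"
  by (auto simp: switch_def insert_commute)

lemma switchable_sym:
  assumes "switchable x y a b E"
  shows "switchable y x b a E" "switchable a b x y E"
  using assms by (auto simp: switchable_def insert_commute)

text \<open>Relabelling symmetries bring each of the four ends into first position, so only the
  degree of \<open>x\<close> needs a computation.\<close>

lemma degree_switch: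
  assumes "switchable x y a b E" "finite E"
  shows "degree (switch x y a b E) v = degree E v"
proof -
  note sw = assms(1) switchable_sym[OF assms(1)] switchable_sym[OF switchable_sym(1)[OF assms(1)]]
  show ?thesis
  proof (cases "v \<in> {x, y, a, b}")
    case True
    then show ?thesis
      using degree_switch_end[OF sw(1) assms(2)] degree_switch_end[OF sw(2) assms(2)]
        degree_switch_end[OF sw(3) assms(2)] degree_switch_end[OF sw(5) assms(2)]
      by (auto simp: switch_sym)
  next
    case False
    then have "{e \<in> switch x y a b E. v \<in> e} = {e \<in> E. v \<in> e}" by (auto simp: switch_def)
    then show ?thesis by (simp add: degree_def)
  qed
qed

lemma switch_regular:
  assumes "E \<in> regular_graphs n d" "switchable x y a b E"
  shows "switch x y a b E \<in> regular_graphs n d"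
proof -
  have sub: "E \<subseteq> nsets (vertices n) 2" using assms(1) by (simp add: regular_graphs_def)
  have "{x, y} \<in> nsets (vertices n) 2" "{a, b} \<in> nsets (vertices n) 2"
    using sub assms(2) by (auto simp: switchable_def)
  then have "switch x y a b E \<subseteq> nsets (vertices n) 2"
    using sub assms(2) by (auto simp: switch_def switchable_def)
  moreover have "degree (switch x y a b E) v = degree E v" for v
    by (rule degree_switch[OF assms(2) finite_regular_graph[OF assms(1)]])
  ultimately show ?thesis using assms(1) by (simp add: regular_graphs_def)
qed

lemma inc_switch:
  assumes "switchable x y a b E" "P \<inter> {x, y, a, b} = {}"
  shows "inc (switch x y a b E) P = inc E P"
  using assms by (auto simp: inc_def switch_def)

text \<open>Among the \<open>n * d\<close> oriented edges \<open>(a, b)\<close>, a bad one has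
  \<open>a\<close> in \<open>P\<close>, equal to \<open>x\<close> or adjacent to \<open>x\<close>,
  or else \<open>b\<close> in the same position with respect to \<open>y\<close>. Each kind has at
  most \<open>(card P + d + 1) * d\<close> members, which the size hypotheses bound by a quarter of
  the total.\<close>

lemma card_switch_partners:
  assumes E: "E \<in> regular_graphs n d" and P: "P \<subseteq> vertices n" and xy: "{x, y} \<in> E"
    and xP: "x \<notin> P" "y \<notin> P"
    and small: "8 * card P \<le> n" "8 * (d + 1) \<le> n"
  shows "n * d \<le> 2 * card {(a, b). switchable x y a b E \<and> a \<notin> P \<and> b \<notin> P}"
proof -
  let ?V = "vertices n"
  have sub: "E \<subseteq> nsets ?V 2" using E by (simp add: regular_graphs_def)
  have fV: "finite ?V" and cV: "card ?V = n" by (auto simp: vertices_def)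
  have fE: "finite E" using E by (rule finite_regular_graph)
  have "{x, y} \<in> nsets ?V 2" using xy sub by blast
  then have xyV: "x \<in> ?V" "y \<in> ?V" "x \<noteq> y" by simp_all
  have dN: "card (nbrs E v) = d" if "v \<in> ?V" for v using card_nbrs_regular[OF E that] .
  let ?T = "{(a, b). switchable x y a b E \<and> a \<notin> P \<and> b \<notin> P}"
  let ?D = "SIGMA a : ?V. nbrs E a"
  let ?Ba = "SIGMA a : P \<union> (insert x (nbrs E x)). nbrs E a"
  let ?Bb = "SIGMA b : P \<union> (insert y (nbrs E y)). nbrs E b"
  have NV: "nbrs E v \<subseteq> ?V" for v by (rule nbrs_subset[OF sub])
  have fN: "finite (nbrs E v)" for v using fE by (rule finite_nbrs)
  have fP: "finite P" using P fV finite_subset by blast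
  have cS: "card (Sigma W (nbrs E)) = card W * d" if "W \<subseteq> ?V" for W
  proof -
    have "card (Sigma W (nbrs E)) = (\<Sum>a\<in>W. card (nbrs E a))"
      using that fV fN by (intro card_SigmaI) (auto intro: finite_subset)
    also have "\<dots> = (\<Sum>a\<in>W. d)" using dN that by (intro sum.cong) auto
    finally show ?thesis by simp
  qed
  have cB: "card (Sigma (P \<union> insert z (nbrs E z)) (nbrs E)) \<le> (card P + d + 1) * d"
    if "z \<in> ?V" for z
  proof -
    have "card (P \<union> insert z (nbrs E z)) \<le> card P + card (insert z (nbrs E z))"
      by (rule card_Un_le)
    also have "\<dots> \<le> card P + d + 1" using dN[OF that] fN[of z] by (simp add: card_insert_if)
    finally have "card (P \<union> insert z (nbrs E z)) \<le> card P + d + 1" .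
    moreover have "P \<union> insert z (nbrs E z) \<subseteq> ?V" using that NV P by blast
    ultimately show ?thesis by (metis cS mult_le_mono1)
  qed
  have "?D \<subseteq> ?T \<union> (?Ba \<union> prod.swap ` ?Bb)"
  proof
    fix z assume "z \<in> ?D"
    then obtain a b where z: "z = (a, b)" "a \<in> ?V" "b \<in> nbrs E a" by auto
    show "z \<in> ?T \<union> (?Ba \<union> prod.swap ` ?Bb)"
    proof (cases "z \<in> ?Ba \<or> (b, a) \<in> ?Bb")
      case True
      then show ?thesis using z by force
    next
      case False
      have ab: "{a, b} \<in> E" using z by (simp add: nbrs_def)
      then have "{a, b} \<in> nsets ?V 2" using sub by blast
      then have "a \<noteq> b" by simp
      have "a \<in> nbrs E b" using z nbrs_sym by metis
      then have "a \<notin> P" "a \<noteq> x" "a \<notin> nbrs E x" "b \<notin> P" "b \<noteq> y" "b \<notin> nbrs E y"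
        using False z by auto
      moreover have "y \<in> nbrs E x" "x \<in> nbrs E y" using xy by (auto simp: nbrs_def insert_commute)
      ultimately have "a \<noteq> y" "b \<noteq> x" by auto
      then have "switchable x y a b E"
        using ab \<open>a \<noteq> b\<close> \<open>a \<noteq> x\<close> \<open>b \<noteq> y\<close> \<open>a \<notin> nbrs E x\<close> \<open>b \<notin> nbrs E y\<close> xy xyV
        by (auto simp: switchable_def nbrs_def)
      then show ?thesis using z \<open>a \<notin> P\<close> \<open>b \<notin> P\<close> by auto
    qed
  qed
  moreover have fT: "finite ?T"
  proof (rule finite_subset)
    have "a \<in> ?V \<and> b \<in> ?V" if "{a, b} \<in> E" for a b
      using sub that by (auto dest!: subsetD split: if_splits)
    then show "?T \<subseteq> ?V \<times> ?V" by (auto simp: switchable_def)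
  qed (use fV in simp)
  moreover have fB: "finite ?Ba" "finite ?Bb" using fP fN by auto
  ultimately have "card ?D \<le> card (?T \<union> (?Ba \<union> prod.swap ` ?Bb))"
    by (intro card_mono) auto
  also have "\<dots> \<le> card ?T + (card ?Ba + card (prod.swap ` ?Bb))"
    by (meson card_Un_le le_trans add_left_mono)
  also have "card (prod.swap ` ?Bb) \<le> card ?Bb" using fB by (intro card_image_le) auto
  also have "card ?D = n * d" using cS[of ?V] cV by simp
  finally have "n * d \<le> card ?T + 2 * ((card P + d + 1) * d)"
    using cB[OF xyV(1)] cB[OF xyV(2)] by linarith
  moreover have "4 * ((card P + d + 1) * d) \<le> n * d"
  proof -
    have "4 * (card P + d + 1) \<le> n" using small by simp
    then have "4 * (card P + d + 1) * d \<le> n * d" by (rule mult_le_mono1)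
    then show ?thesis by (simp only: mult.assoc)
  qed
  ultimately show ?thesis by linarith
qed

text \<open>Double counting of switchings. A graph with the edge admits at least
  \<open>n * d / 2\<close> of them away from \<open>P\<close>. In a switched graph \<open>a\<close>
  is adjacent to \<open>x\<close> and \<open>b\<close> to \<open>y\<close>, so it arises at most
  \<open>d * d\<close> times. This gives the factor 2 when \<open>d\<close> is small against
  \<open>n\<close>; the factor 16 covers the opposite case, where \<open>n <= 16 * d\<close> makes
  the bound trivial.\<close>

lemma card_regular_graphs_edge:
  assumes P: "P \<subseteq> vertices n" and xy: "x \<notin> P" "y \<notin> P" and small: "8 * card P \<le> n" and n: "16 \<le> n"
    and V: "x \<in> vertices n" "y \<in> vertices n"
  shows "n * card {E \<in> regular_graphs n d. inc E P = F \<and> {x, y} \<in> E}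
    \<le> 16 * d * card {E \<in> regular_graphs n d. inc E P = F}"
    (is "n * card ?K1 \<le> 16 * d * card ?K")
proof -
  have fK: "finite ?K" using finite_regular_graphs[of n d] by simp
  have sub: "?K1 \<subseteq> ?K" by auto
  show ?thesis
  proof (cases "8 * (d + 1) \<le> n")
    case False
    then have "n \<le> 16 * d" using n by simp
    then show ?thesis using card_mono[OF fK sub] by (intro mult_mono) auto
  next
    case small2: True
    let ?T = "\<lambda>E. {(a, b). switchable x y a b E \<and> a \<notin> P \<and> b \<notin> P}"
    let ?R = "SIGMA E : ?K. nbrs E x \<times> nbrs E y"
    let ?f = "\<lambda>(E, a, b). (switch x y a b E, a, b)"
    have fT: "finite (?T E)" if "E \<in> ?K1" for E
    proof (rule finite_subset)
      have "E \<subseteq> nsets (vertices n) 2" using that by (simp add: regular_graphs_def)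
      then have "a \<in> vertices n \<and> b \<in> vertices n" if "{a, b} \<in> E" for a b
        using that by (auto dest!: subsetD split: if_splits)
      then show "?T E \<subseteq> vertices n \<times> vertices n" by (auto simp: switchable_def)
    qed (simp add: vertices_def)
    have fR: "finite ?R" using fK by (auto intro!: finite_nbrs dest: finite_regular_graph)
    have "inj_on ?f (Sigma ?K1 ?T)"
    proof (rule inj_onI)
      fix s t assume s: "s \<in> Sigma ?K1 ?T" and t: "t \<in> Sigma ?K1 ?T" and eq: "?f s = ?f t"
      obtain E a b where s': "s = (E, a, b)" by (cases s) auto
      obtain E' a' b' where t': "t = (E', a', b')" by (cases t) auto
      have eqs: "a' = a" "b' = b" "switch x y a b E = switch x y a b E'" using eq s' t' by auto
      have "switchable x y a b E" "switchable x y a b E'" using s t s' t' eqs by auto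
      then have "E = E'" using eqs(3) switch_inverse by metis
      then show "s = t" using s' t' eqs by simp
    qed
    moreover have "?f ` Sigma ?K1 ?T \<subseteq> ?R"
    proof
      fix t assume "t \<in> ?f ` Sigma ?K1 ?T"
      then obtain E a b where t: "t = (switch x y a b E, a, b)" and E: "E \<in> regular_graphs n d" "{x, y} \<in> E" "switchable x y a b E" "a \<notin> P" "b \<notin> P"
        and F: "inc E P = F"
        by auto
      have "inc (switch x y a b E) P = inc E P" using E xy by (intro inc_switch) auto
      moreover have "a \<in> nbrs (switch x y a b E) x" "b \<in> nbrs (switch x y a b E) y"
        by (auto simp: nbrs_def switch_def)
      ultimately show "t \<in> ?R"
        using switch_regular[OF E(1,3)] t F by auto
    qed
    ultimately have "card (Sigma ?K1 ?T) \<le> card ?R"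
      using fR by (rule card_inj_on_le)
    also have "card ?R = (\<Sum>E\<in>?K. card (nbrs E x \<times> nbrs E y))"
      using fK by (intro card_SigmaI) (auto intro!: finite_nbrs dest: finite_regular_graph)
    also have "\<dots> = (\<Sum>E\<in>?K. d * d)"
      using V by (intro sum.cong) (auto simp: card_cartesian_product card_nbrs_regular)
    finally have *: "card (Sigma ?K1 ?T) \<le> card ?K * (d * d)" by simp
    have "card ?K1 * (n * d) = (\<Sum>E\<in>?K1. n * d)" by simp
    also have "\<dots> \<le> (\<Sum>E\<in>?K1. 2 * card (?T E))"
      using P xy small small2 by (intro sum_mono card_switch_partners) auto
    also have "\<dots> = 2 * card (Sigma ?K1 ?T)"
      using fT finite_subset[OF sub fK] by (subst card_SigmaI) (auto simp: sum_distrib_left)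
    finally have "card ?K1 * (n * d) \<le> 2 * (card ?K * (d * d))" using * by linarith
    then have "d * (n * card ?K1) \<le> d * (2 * d * card ?K)" by (simp add: algebra_simps)
    then have **: "n * card ?K1 \<le> 2 * d * card ?K \<or> d = 0" by auto
    show ?thesis
    proof (cases "d = 0")
      case True
      have "?K1 = {}"
      proof -
        { fix E assume "E \<in> regular_graphs n d" "{x, y} \<in> E"
          then have "card (nbrs E x) = 0" "finite (nbrs E x)"
            using card_nbrs_regular V(1) True finite_nbrs[OF finite_regular_graph] by blast+
          moreover have "y \<in> nbrs E x" using \<open>{x, y} \<in> E\<close> by (simp add: nbrs_def)
          ultimately have False by simp }
        then show ?thesis by blast
      qed
      then show ?thesis by (simp only: card.empty mult_0_right le0)
    next
      case False
      then show ?thesis using ** mult_right_mono[of "2 * d" "16 * d" "card ?K"] by linarith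
    qed
  qed
qed

section \<open>Large components are rare\<close>

definition reach :: "'a set set \<Rightarrow> 'a set \<Rightarrow> 'a set" where
  "reach E A = (adjacency E)\<^sup>* `` A"

lemma reach_empty [simp]: "reach E {} = {}"
  by (simp add: reach_def)

lemma reach_closed_subset:
  assumes "A \<subseteq> B" "\<And>x y. x \<in> B \<Longrightarrow> {x, y} \<in> E \<Longrightarrow> y \<in> B"
  shows "reach E A \<subseteq> B"
proof -
  have "(a, b) \<in> (adjacency E)\<^sup>* \<Longrightarrow> a \<in> B \<Longrightarrow> b \<in> B" for a b
    by (induction rule: rtrancl_induct) (use assms(2) in \<open>auto simp: adjacency_def\<close>)
  then show ?thesis using assms(1) by (auto simp: reach_def)
qed

lemma subset_reach: "A \<subseteq> reach E A"
  by (auto simp: reach_def)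

lemma reach_edge: "x \<in> reach E A \<Longrightarrow> {x, y} \<in> E \<Longrightarrow> y \<in> reach E A"
  unfolding reach_def adjacency_def by (auto intro: rtrancl_into_rtrancl)

lemma reach_subset_Un: "reach E A \<subseteq> A \<union> \<Union>E"
  by (rule reach_closed_subset) auto

text \<open>The vertex \<open>u\<close> accounts for one reached vertex and hands its role as a seed
  to its open neighbours; everything else is reached through edges that avoid
  \<open>u\<close>.\<close>

lemma reach_step:
  assumes "\<And>e. e \<in> X \<Longrightarrow> u \<in> e" "\<And>e. e \<in> Y \<Longrightarrow> u \<notin> e"
  shows "reach (X \<union> Y) A \<subseteq> insert u (reach Y ((A - {u}) \<union> nbrs X u))"
proof (rule reach_closed_subset)
  show "A \<subseteq> insert u (reach Y ((A - {u}) \<union> nbrs X u))"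
    using subset_reach[of "(A - {u}) \<union> nbrs X u" Y] by auto
next
  fix x y assume x: "x \<in> insert u (reach Y (A - {u} \<union> nbrs X u))" and xy: "{x, y} \<in> X \<union> Y"
  show "y \<in> insert u (reach Y (A - {u} \<union> nbrs X u))"
  proof (cases "y = u")
    case yu: False
    show ?thesis
    proof (cases "{x, y} \<in> Y \<and> x \<noteq> u")
      case True
      then show ?thesis using x reach_edge[of x Y _ y] by auto
    next
      case False
      show ?thesis
      proof -
        have "{x, y} \<in> X" "x = u" using False xy yu assms by auto
        then have "y \<in> nbrs X u" by (simp add: nbrs_def)
        then show ?thesis using subset_reach[of "A - {u} \<union> nbrs X u" Y] by blast
      qed
    qed
  qed simp
qed

lemma card_nbrs_le:
  assumes "finite X"
  shows "card (nbrs X u) \<le> card X"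
  by (rule card_inj_on_le[where f="\<lambda>w. {u, w}"])
    (use assms in \<open>auto simp: nbrs_def inj_on_def doubleton_eq_iff\<close>)

text \<open>One step of the comparison with a branching process: condition on the star of
  \<open>u\<close>, which is independent of the other edges. Neighbours that are already seeds only
  shrink the new seed set, and \<open>\<phi> <= 1\<close> makes this work in the right
  direction.\<close>

lemma percolate_reach_step:
  fixes s \<phi> p :: real
  assumes E: "finite E" "\<And>e. e \<in> E \<Longrightarrow> finite e" and A: "finite A" "u \<in> A" and s: "0 \<le> s" "s \<le> 1"
    and phi: "0 \<le> \<phi>" "\<phi> \<le> 1" and p: "0 \<le> p" "p \<le> 1"
    and IH: "\<And>X. X \<subseteq> {e \<in> E. u \<in> e} \<Longrightarrow> \<phi> ^ card ((A - {u}) \<union> nbrs X u) \<le>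
      expec (percolate p {e \<in> E. u \<notin> e}) (\<lambda>Y. s ^ card (reach Y ((A - {u}) \<union> nbrs X u)))"
  shows "s * \<phi> ^ (card A - 1) * (1 - p + p * \<phi>) ^ degree E u
    \<le> expec (percolate p E) (\<lambda>Y. s ^ card (reach Y A))"
proof -
  let ?E1 = "{e \<in> E. u \<in> e}" and ?E2 = "{e \<in> E. u \<notin> e}"
  let ?A = "\<lambda>X. (A - {u}) \<union> nbrs X u"
  have fin: "finite ?E1" "finite ?E2" using E by auto
  have X: "X \<subseteq> ?E1" "finite X" if "X \<in> set_pmf (percolate p ?E1)" for X
    using that set_percolate[OF fin(1)] fin(1) finite_subset by blast+
  have "s * \<phi> ^ (card A - 1) * (1 - p + p * \<phi>) ^ degree E u
      = expec (percolate p ?E1) (\<lambda>X. s * \<phi> ^ (card A - 1) * \<phi> ^ card X)"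
    using expec_percolate_power[OF fin(1) p phi(1)] by (simp add: degree_def)
  also have "\<dots> \<le> expec (percolate p ?E1) (\<lambda>X. s * \<phi> ^ card (?A X))"
  proof (rule expec_mono)
    fix X assume "X \<in> set_pmf (percolate p ?E1)"
    then have "card (?A X) \<le> card A - 1 + card X"
      using card_Un_le[of "A - {u}" "nbrs X u"] card_nbrs_le[OF X(2), of X u] A by simp
    then have "\<phi> ^ (card A - 1 + card X) \<le> \<phi> ^ card (?A X)"
      using phi by (intro power_decreasing)
    then show "s * \<phi> ^ (card A - 1) * \<phi> ^ card X \<le> s * \<phi> ^ card (?A X)"
      using s by (simp add: power_add mult.assoc mult_left_mono)
  qed (use fin in \<open>simp add: finite_set_percolate\<close>)
  also have "\<dots> \<le> expec (percolate p ?E1) (\<lambda>X. expec (percolate p ?E2) (\<lambda>Y. s ^ card (reach (X \<union> Y) A)))"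
  proof (rule expec_mono)
    fix X assume X': "X \<in> set_pmf (percolate p ?E1)"
    have "s * \<phi> ^ card (?A X) \<le> s * expec (percolate p ?E2) (\<lambda>Y. s ^ card (reach Y (?A X)))"
      using IH[OF X(1)[OF X']] s by (intro mult_left_mono)
    also have "\<dots> = expec (percolate p ?E2) (\<lambda>Y. s * s ^ card (reach Y (?A X)))" by simp
    also have "\<dots> \<le> expec (percolate p ?E2) (\<lambda>Y. s ^ card (reach (X \<union> Y) A))"
    proof (rule expec_mono)
      fix Y assume "Y \<in> set_pmf (percolate p ?E2)"
      then have Y: "Y \<subseteq> ?E2" using set_percolate[OF fin(2)] by blast
      have "finite (\<Union>Y)" using Y E finite_subset[OF Y] by auto
      then have f: "finite (reach Y (?A X))"
        using finite_subset[OF reach_subset_Un[of Y "?A X"]] A finite_nbrs[OF X(2)[OF X'], of u] by auto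
      have "card (reach (X \<union> Y) A) \<le> card (insert u (reach Y (?A X)))"
        using X(1)[OF X'] f Y by (intro card_mono reach_step) auto
      also have "\<dots> \<le> Suc (card (reach Y (?A X)))" by (simp add: card_insert_if f)
      finally have "s ^ Suc (card (reach Y (?A X))) \<le> s ^ card (reach (X \<union> Y) A)"
        using s by (intro power_decreasing)
      then show "s * s ^ card (reach Y (?A X)) \<le> s ^ card (reach (X \<union> Y) A)" by simp
    qed (use fin in \<open>simp add: finite_set_percolate\<close>)
    finally show "s * \<phi> ^ card (?A X) \<le> expec (percolate p ?E2) (\<lambda>Y. s ^ card (reach (X \<union> Y) A))" .
  qed (use fin in \<open>simp add: finite_set_percolate\<close>)
  also have "\<dots> = expec (percolate p (?E1 \<union> ?E2)) (\<lambda>Y. s ^ card (reach Y A))"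
    using fin by (subst percolate_union) (auto simp: expec_bind finite_set_percolate)
  also have "?E1 \<union> ?E2 = E" by auto
  finally show ?thesis .
qed

lemma degree_removed_neighbour:
  assumes "finite E" "{u, w} \<in> E"
  shows "degree {e \<in> E. u \<notin> e} w < degree E w"
  unfolding degree_def
proof (rule psubset_card_mono)
  have "{u, w} \<in> {e \<in> E. w \<in> e}" "{u, w} \<notin> {e \<in> {e \<in> E. u \<notin> e}. w \<in> e}"
    using assms by simp_all
  moreover have "{e \<in> {e \<in> E. u \<notin> e}. w \<in> e} \<subseteq> {e \<in> E. w \<in> e}" by auto
  ultimately show "{e \<in> {e \<in> E. u \<notin> e}. w \<in> e} \<subset> {e \<in> E. w \<in> e}"
    by (metis psubsetI)
qed (use assms in simp)

text \<open>The number \<open>\<phi>\<close> is a subsolution of the fixed-point equation for the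
  generating function of the total progeny, and the induction carries it over to the finite graph. A
  discovered vertex has lost the edge to its discoverer, hence the degree bound \<open>N\<close> for
  seeds against \<open>Suc N\<close> elsewhere.\<close>

lemma percolate_reach_pgf:
  fixes s \<phi> p :: real
  assumes s: "0 \<le> s" "s \<le> 1" and phi: "0 \<le> \<phi>" "\<phi> \<le> 1" and p: "0 \<le> p" "p \<le> 1"
    and sub: "\<phi> \<le> s * (1 - p + p * \<phi>) ^ N"
    and "finite E" "E \<subseteq> nsets UNIV 2" "finite A"
    and "\<And>u. degree E u \<le> Suc N" "\<And>u. u \<in> A \<Longrightarrow> degree E u \<le> N"
  shows "\<phi> ^ card A \<le> expec (percolate p E) (\<lambda>Y. s ^ card (reach Y A))"
  using assms(8-)
\<comment> \<open>Every new seed is paid for by a removed edge, and \<open>u\<close> leaves the seed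
  set, so the measure drops.\<close>
proof (induction "2 * card E + card A" arbitrary: E A rule: less_induct)
  case less
  show ?case
  proof (cases "A = {}")
    case True
    then show ?thesis by simp
  next
    case False
    then obtain u where u: "u \<in> A" by auto
    let ?E1 = "{e \<in> E. u \<in> e}" and ?E2 = "{e \<in> E. u \<notin> e}"
    let ?A = "\<lambda>X. (A - {u}) \<union> nbrs X u"
    have fin: "finite ?E1" "finite ?E2" using less.prems(1) by auto
    have cE: "card E = card ?E1 + card ?E2"
    proof -
      have "E = ?E1 \<union> ?E2" by auto
      then have "card E = card (?E1 \<union> ?E2)" by simp
      also have "\<dots> = card ?E1 + card ?E2" using fin by (intro card_Un_disjoint) auto
      finally show ?thesis .
    qed
    have q: "0 \<le> 1 - p + p * \<phi>" "1 - p + p * \<phi> \<le> 1"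
      using p phi by (auto simp: mult_left_le)
    have "\<phi> ^ card A = \<phi> * \<phi> ^ (card A - 1)"
      using u less.prems(3) by (cases "card A") auto
    also have "\<dots> \<le> (s * (1 - p + p * \<phi>) ^ N) * \<phi> ^ (card A - 1)"
      using sub phi by (intro mult_right_mono) auto
    also have "\<dots> \<le> (s * (1 - p + p * \<phi>) ^ degree E u) * \<phi> ^ (card A - 1)"
      using less.prems(5)[OF u] q s phi by (intro mult_right_mono mult_left_mono power_decreasing) auto
    also have "\<dots> = s * \<phi> ^ (card A - 1) * (1 - p + p * \<phi>) ^ degree E u" by simp
    also have "\<dots> \<le> expec (percolate p E) (\<lambda>Y. s ^ card (reach Y A))"
    proof (rule percolate_reach_step)
      show "finite e" if "e \<in> E" for e using that less.prems(2) by (auto simp: nsets_def)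
      fix X assume X: "X \<subseteq> ?E1"
      then have fX: "finite X" using fin finite_subset by blast
      have dle: "degree ?E2 w \<le> degree E w" for w
        unfolding degree_def using less.prems(1) by (intro card_mono) auto
      show "\<phi> ^ card (?A X) \<le> expec (percolate p ?E2) (\<lambda>Y. s ^ card (reach Y (?A X)))"
      proof (rule less.hyps)
        have "card (?A X) \<le> card (A - {u}) + card X"
          using card_Un_le[of "A - {u}" "nbrs X u"] card_nbrs_le[OF fX, of u] by linarith
        moreover have "card X \<le> card ?E1" using X fin by (intro card_mono)
        moreover have "card (A - {u}) < card A" using u less.prems(3) by (rule card_Diff1_less[rotated])
        ultimately show "2 * card ?E2 + card (?A X) < 2 * card E + card A" using cE by linarith
        show "finite (?A X)" using less.prems(3) finite_nbrs[OF fX] by simp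
        show "degree ?E2 w \<le> Suc N" for w using dle[of w] less.prems(4)[of w] by linarith
        show "degree ?E2 w \<le> N" if w: "w \<in> ?A X" for w
        proof (cases "w \<in> A")
          case True
          then show ?thesis using dle[of w] less.prems(5)[OF True] by linarith
        next
          case False
          then have "degree ?E2 w < degree E w"
            using w X less.prems(1) by (intro degree_removed_neighbour) (auto simp: nbrs_def)
          then show ?thesis using less.prems(4)[of w] by linarith
        qed
      qed (use less.prems(1,2) in auto)
    qed (use less.prems(1,3) s phi p u in auto)
    finally show ?thesis .
  qed
qed

text \<open>The starting vertex may have one edge more than a seed is allowed. Its additional factor
  \<open>1 - p + p * \<phi>\<close> is at least \<open>\<phi>\<close>, which explains the
  square.\<close>

lemma percolate_component_pgf:
  fixes s \<phi> p :: real
  assumes s: "0 \<le> s" "s \<le> 1" and phi: "0 \<le> \<phi>" "\<phi> \<le> 1" and p: "0 \<le> p" "p \<le> 1"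
    and sub: "\<phi> \<le> s * (1 - p + p * \<phi>) ^ N"
    and E: "finite E" "E \<subseteq> nsets UNIV 2" "\<And>u. degree E u \<le> Suc N"
  shows "\<phi>\<^sup>2 \<le> expec (percolate p E) (\<lambda>Y. s ^ card (reach Y {v}))"
proof -
  let ?E2 = "{e \<in> E. v \<notin> e}"
  have q: "0 \<le> 1 - p + p * \<phi>" "1 - p + p * \<phi> \<le> 1" "\<phi> \<le> 1 - p + p * \<phi>"
    using p phi mult_left_le[of \<phi> p] mult_nonneg_nonneg[of "1 - p" "1 - \<phi>"] mult_nonneg_nonneg[of p \<phi>]
    by (auto simp: algebra_simps)
  have "\<phi>\<^sup>2 \<le> (s * (1 - p + p * \<phi>) ^ N) * (1 - p + p * \<phi>)"
    unfolding power2_eq_square using sub q phi by (intro mult_mono) auto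
  also have "\<dots> = s * (1 - p + p * \<phi>) ^ Suc N" by (simp only: power_Suc2 mult.assoc)
  also have "\<dots> \<le> s * (1 - p + p * \<phi>) ^ degree E v"
    by (rule mult_left_mono[OF power_decreasing[OF E(3)[of v] q(1,2)] s(1)])
  also have "\<dots> = s * \<phi> ^ (card {v} - 1) * (1 - p + p * \<phi>) ^ degree E v" by simp
  also have "\<dots> \<le> expec (percolate p E) (\<lambda>Y. s ^ card (reach Y {v}))"
  proof (rule percolate_reach_step)
    show "finite e" if "e \<in> E" for e using that E(2) by (auto simp: nsets_def)
    fix X assume X: "X \<subseteq> {e \<in> E. v \<in> e}"
    then have fX: "finite X" using E(1) finite_subset[OF X] by auto
    have dle: "degree ?E2 w \<le> degree E w" for w
      unfolding degree_def using E(1) by (intro card_mono) auto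
    show "\<phi> ^ card ({v} - {v} \<union> nbrs X v)
        \<le> expec (percolate p ?E2) (\<lambda>Y. s ^ card (reach Y ({v} - {v} \<union> nbrs X v)))"
    proof (rule percolate_reach_pgf[OF s phi p sub])
      show "finite ({v} - {v} \<union> nbrs X v)" using finite_nbrs[OF fX] by simp
      show "degree ?E2 w \<le> Suc N" for w using dle[of w] E(3)[of w] by linarith
      show "degree ?E2 w \<le> N" if w: "w \<in> {v} - {v} \<union> nbrs X v" for w
      proof -
        have "degree ?E2 w < degree E w"
          using w X E(1) by (intro degree_removed_neighbour) (auto simp: nbrs_def)
        then show ?thesis using E(3)[of w] by linarith
      qed
    qed (use E in auto)
  qed (use E s phi p in auto)
  finally show ?thesis .
qed

section \<open>The subsolution near criticality\<close>

lemma ln_one_minus_bounds: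
  fixes x :: real
  assumes "0 \<le> x" "x \<le> 1/2"
  shows "- x - x\<^sup>2 / 2 - x ^ 3 \<le> ln (1 - x)" "ln (1 - x) \<le> - x - x\<^sup>2 / 2"
proof -
  have "(\<lambda>x. ln (1 - x) + x + x\<^sup>2 / 2 + x ^ 3) 0 \<le> (\<lambda>x. ln (1 - x) + x + x\<^sup>2 / 2 + x ^ 3) x"
  proof (rule DERIV_nonneg_imp_nondecreasing[OF assms(1)])
    fix y :: real assume y: "0 \<le> y" "y \<le> x"
    then have y1: "y \<le> 1/2" using assms by simp
    have "((\<lambda>x. ln (1 - x) + x + x\<^sup>2 / 2 + x ^ 3) has_real_derivative
        (- 1 / (1 - y) + 1 + y + 3 * y\<^sup>2)) (at y)"
      using y1 by (auto intro!: derivative_eq_intros simp: field_simps)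
    moreover have "- 1 / (1 - y) + 1 + y + 3 * y\<^sup>2 = y\<^sup>2 * (2 - 3 * y) / (1 - y)"
      using y1 by (simp add: field_simps power2_eq_square)
    ultimately show "\<exists>d. ((\<lambda>x. ln (1 - x) + x + x\<^sup>2 / 2 + x ^ 3) has_real_derivative d) (at y) \<and> 0 \<le> d"
      using y1 by auto
  qed
  then show "- x - x\<^sup>2 / 2 - x ^ 3 \<le> ln (1 - x)" by simp
  have "(\<lambda>x. ln (1 - x) + x + x\<^sup>2 / 2) 0 \<ge> (\<lambda>x. ln (1 - x) + x + x\<^sup>2 / 2) x"
  proof (rule DERIV_nonpos_imp_nonincreasing[OF assms(1)])
    fix y :: real assume y: "0 \<le> y" "y \<le> x"
    then have y1: "y \<le> 1/2" using assms by simp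
    have "((\<lambda>x. ln (1 - x) + x + x\<^sup>2 / 2) has_real_derivative (- 1 / (1 - y) + 1 + y)) (at y)"
      using y1 by (auto intro!: derivative_eq_intros simp: field_simps)
    moreover have "- 1 / (1 - y) + 1 + y = - (y\<^sup>2 / (1 - y))"
      using y1 by (simp add: field_simps power2_eq_square)
    ultimately show "\<exists>d. ((\<lambda>x. ln (1 - x) + x + x\<^sup>2 / 2) has_real_derivative d) (at y) \<and> d \<le> 0"
      using y1 by auto
  qed
  then show "ln (1 - x) \<le> - x - x\<^sup>2 / 2" by simp
qed

text \<open>Logarithms are compared to second order. The first-order terms agree up to
  \<open>\<bar>lam\<bar> * t * \<eta>\<close>. The left side falls by a further
  \<open>\<eta>\<^sup>2 / 2\<close>, whereas \<open>2 <= N\<close> keeps the higher-order decrease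
  on the right below \<open>4/10 * \<eta>\<^sup>2\<close>. The tenth in between has to pay for
  \<open>t\<^sup>2\<close> and for the drift, which dictates the coefficients 10 and 20 in
  \<open>\<eta>\<close>.\<close>

lemma pgf_subsolution:
  fixes t lam \<eta> p :: real
  assumes t: "0 < t" and lt: "\<bar>lam\<bar> * t \<le> 1/10" and eta: "\<eta> = (10 * \<bar>lam\<bar> + 20) * t" "\<eta> \<le> 1/4"
    and N: "2 \<le> N" and p: "p = (1 + lam * t) / real N"
  shows "1 - \<eta> \<le> exp (- t\<^sup>2) * (1 - p + p * (1 - \<eta>)) ^ N"
proof -
  define e where "e = lam * t"
  have e: "\<bar>e\<bar> \<le> 1/10" using lt t by (simp add: e_def abs_mult)
  have eta0: "0 < \<eta>" using t by (simp add: eta)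
  have p0: "0 < p" using e N by (simp add: p e_def[symmetric])
  have Np: "real N * p = 1 + e" using N by (simp add: p e_def)
  have p1: "p \<le> 11/20"
  proof -
    have "p \<le> (11/10) / 2" unfolding p e_def[symmetric] using e N by (intro frac_le) auto
    then show ?thesis by simp
  qed
  define x where "x = p * \<eta>"
  have x0: "0 < x" "x \<le> 1/2" using p0 eta0 mult_mono[OF p1 eta(2)] by (auto simp: x_def)
  have b1: "- x - x\<^sup>2 / 2 - x ^ 3 \<le> ln (1 - x)"
    using x0 by (intro ln_one_minus_bounds) auto
  have b2: "ln (1 - \<eta>) \<le> - \<eta> - \<eta>\<^sup>2 / 2"
    using eta0 eta by (intro ln_one_minus_bounds) auto
  have Nx: "real N * x = (1 + e) * \<eta>" using Np by (simp add: x_def)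
  have "p * \<eta> \<le> 11/20 * \<eta>" using p1 eta0 by (intro mult_right_mono) auto
  then have x1: "x \<le> 11/20 * \<eta>" by (simp add: x_def)
  have e1: "1 + e \<le> 11/10" "0 < 1 + e" using e by linarith+
  have e2: "\<bar>e\<bar> * \<eta> = \<bar>lam\<bar> * t * \<eta>" using t by (simp add: e_def abs_mult)
  have Nx1: "0 \<le> real N * x" "real N * x \<le> 11/10 * \<eta>"
    unfolding Nx using e1 eta0 by (auto intro!: mult_right_mono)
  have h2: "real N * x * x \<le> (11/10 * \<eta>) * (11/20 * \<eta>)"
    by (rule mult_mono[OF Nx1(2) x1]) (use eta0 x0 in auto)
  have h3: "(real N * x * x) * x \<le> ((11/10 * \<eta>) * (11/20 * \<eta>)) * (11/80)"
    by (rule mult_mono[OF h2]) (use x1 x0 eta(2) eta0 in auto)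
  have "real N * ln (1 - x) \<ge> real N * (- x - x\<^sup>2 / 2 - x ^ 3)"
    using b1 by (intro mult_left_mono) auto
  then have "real N * ln (1 - x) \<ge> - (real N * x) - (real N * x * x) / 2 - (real N * x * x) * x"
    by (simp add: algebra_simps power2_eq_square power3_eq_cube)
  then have "real N * ln (1 - x) \<ge> - \<eta> - \<bar>e\<bar> * \<eta> - 4/10 * (\<eta> * \<eta>)"
  proof -
    have "(1 + e) * \<eta> \<le> \<eta> + \<bar>e\<bar> * \<eta>"
      using eta0 by (simp add: distrib_right mult_right_mono)
    moreover have "((11/10 * \<eta>) * (11/20 * \<eta>)) / 2 + ((11/10 * \<eta>) * (11/20 * \<eta>)) * (11/80) \<le> 4/10 * (\<eta> * \<eta>)"
      using zero_le_square[of \<eta>] by simp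
    ultimately show ?thesis using h2 h3 Nx \<open>real N * ln (1 - x) \<ge> - (real N * x) - _ / 2 - _\<close> by linarith
  qed
  moreover have "t\<^sup>2 + \<bar>e\<bar> * \<eta> \<le> 1/10 * (\<eta> * \<eta>)"
  proof -
    have "1/10 * (\<eta> * \<eta>) = (\<bar>lam\<bar> * t) * \<eta> + 2 * t * \<eta>" unfolding eta by (simp add: algebra_simps)
    moreover have "t * t \<le> 2 * t * \<eta>"
      using t mult_left_mono[of t "2 * \<eta>" t] unfolding eta by (simp add: algebra_simps)
    ultimately show ?thesis using e2 unfolding power2_eq_square by linarith
  qed
  ultimately have "ln (1 - \<eta>) \<le> - t\<^sup>2 + real N * ln (1 - x)"
    using b2 by (simp add: power2_eq_square)
  then have "exp (ln (1 - \<eta>)) \<le> exp (- t\<^sup>2 + real N * ln (1 - x))" by simp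
  also have "\<dots> = exp (- t\<^sup>2) * (1 - x) ^ N"
    using x0 by (subst exp_add) (simp add: exp_of_nat_mult)
  finally show ?thesis using eta x0 by (simp add: x_def algebra_simps)
qed

text \<open>Markov's inequality for \<open>1 - s ^ card (reach D {v})\<close>: on the event this is
  at least 1/2 because \<open>s ^ k <= exp (- 1)\<close>, and its mean is at most
  \<open>1 - (1 - \<eta>)\<^sup>2 <= 2 * \<eta>\<close>.\<close>

lemma component_tail:
  fixes t lam p :: real
  assumes E: "E \<in> regular_graphs n d" and d: "3 \<le> d"
    and t: "0 < t" "\<bar>lam\<bar> * t \<le> 1/10" "(10 * \<bar>lam\<bar> + 20) * t \<le> 1/4"
    and p: "p = (1 + lam * t) / (real d - 1)" and k: "1 \<le> real k * t\<^sup>2"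
  shows "measure_pmf.prob (percolate p E) {D. k \<le> card (reach D {v})} \<le> 4 * (10 * \<bar>lam\<bar> + 20) * t"
proof -
  define \<eta> where "\<eta> = (10 * \<bar>lam\<bar> + 20) * t"
  define s where "s = exp (- t\<^sup>2)"
  have eta: "0 \<le> \<eta>" "\<eta> \<le> 1/4" using t by (auto simp: \<eta>_def)
  have s: "0 \<le> s" "s \<le> 1" by (auto simp: s_def)
  have lt: "\<bar>lam * t\<bar> \<le> 1/10" using t by (simp add: abs_mult)
  have "(1 + lam * t) / (real d - 1) \<le> (11/10) / 2" using lt d by (intro frac_le) auto
  then have p01: "0 \<le> p" "p \<le> 1" using lt d by (auto simp: p)
  have fE: "finite E" using E by (rule finite_regular_graph)
  have sub: "E \<subseteq> nsets (vertices n) 2" using E by (simp add: regular_graphs_def)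
  have deg: "degree E u \<le> Suc (d - 1)" for u
  proof (cases "u \<in> vertices n")
    case True
    then show ?thesis using E by (simp add: regular_graphs_def)
  next
    case False
    then have "{e \<in> E. u \<in> e} = {}" using sub by (auto simp: nsets_def)
    then show ?thesis by (simp only: degree_def card.empty)
  qed
  have "1 - \<eta> \<le> s * (1 - p + p * (1 - \<eta>)) ^ (d - 1)"
    unfolding s_def using t d p by (intro pgf_subsolution[where lam=lam]) (auto simp: \<eta>_def of_nat_diff)
  then have "(1 - \<eta>)\<^sup>2 \<le> expec (percolate p E) (\<lambda>Y. s ^ card (reach Y {v}))"
    using eta s p01 fE sub deg by (intro percolate_component_pgf[where N="d - 1"]) (auto simp: nsets_def)
  moreover have "(1 - \<eta>)\<^sup>2 \<ge> 1 - 2 * \<eta>" by (simp add: power2_eq_square algebra_simps)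
  ultimately have le: "expec (percolate p E) (\<lambda>Y. 2 * (1 - s ^ card (reach Y {v}))) \<le> 4 * \<eta>"
    using fE by (simp add: expec_diff finite_set_percolate)
  have "s ^ k = exp (- (real k * t\<^sup>2))" by (simp add: s_def exp_of_nat_mult[symmetric])
  also have "\<dots> \<le> exp (- 1)" using k by simp
  also have "\<dots> \<le> 1/2" using exp_ge_add_one_self[of 1] by (simp add: exp_minus field_simps)
  finally have sk: "s ^ k \<le> 1/2" .
  have "measure_pmf.prob (percolate p E) {D. k \<le> card (reach D {v})}
      \<le> expec (percolate p E) (\<lambda>Y. 2 * (1 - s ^ card (reach Y {v})))"
  proof (rule prob_le_expec)
    show "finite (set_pmf (percolate p E))" using fE by (rule finite_set_percolate)
    show "0 \<le> 2 * (1 - s ^ card (reach x {v}))" for x using s by (simp add: power_le_one)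
    show "1 \<le> 2 * (1 - s ^ card (reach x {v}))" if "x \<in> {D. k \<le> card (reach D {v})}" for x
    proof -
      have "s ^ card (reach x {v}) \<le> s ^ k" using that s by (intro power_decreasing) auto
      then show ?thesis using sk by simp
    qed
  qed
  also note le
  finally show ?thesis unfolding \<eta>_def by (simp only: mult.assoc)
qed

section \<open>Components and the upper tail of \<open>L1\<close>\<close>

lemma component_subset: "component V D v \<subseteq> V"
  by (auto simp: component_def)

lemma component_eq:
  assumes "w \<in> component V D v"
  shows "component V D w = component V D v"
proof -
  have "sym ((adjacency D)\<^sup>*)"
    by (intro sym_rtrancl) (auto simp: sym_def adjacency_def insert_commute)
  then show ?thesis using assms by (auto simp: component_def dest: symD intro: rtrancl_trans)
qed

lemma card_le_L1:
  assumes "finite V" "v \<in> V"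
  shows "card (component V D v) \<le> L1 V D"
  using assms by (auto simp: L1_def components_def)

lemma L1_attained:
  assumes "finite V" "V \<noteq> {}"
  obtains v where "v \<in> V" "L1 V D = card (component V D v)"
proof -
  have "L1 V D \<in> card ` components V D"
    unfolding L1_def using assms by (intro Max_in) (auto simp: components_def)
  then show ?thesis using that by (auto simp: components_def)
qed

text \<open>A component with more than \<open>a\<close> vertices contributes all of them to the
  number of vertices in large components, so Markov's inequality for this number gains a division by
  \<open>a\<close> over the union bound.\<close>

lemma L1_upper_tail:
  fixes t lam p a :: real
  assumes E: "E \<in> regular_graphs n d" and d: "3 \<le> d" and n: "1 \<le> n"
    and t: "0 < t" "\<bar>lam\<bar> * t \<le> 1/10" "(10 * \<bar>lam\<bar> + 20) * t \<le> 1/4"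
    and p: "p = (1 + lam * t) / (real d - 1)" and a: "0 < a" "1 \<le> a * t\<^sup>2"
  shows "measure_pmf.prob (percolate p E) {D. a < real (L1 (vertices n) D)}
    \<le> real n * (4 * (10 * \<bar>lam\<bar> + 20) * t) / a"
proof -
  let ?V = "vertices n"
  define k where "k = nat \<lceil>a\<rceil>"
  have k: "1 \<le> real k * t\<^sup>2" 
    using a mult_right_mono[OF real_nat_ceiling_ge[of a], of "t\<^sup>2"] by (simp add: k_def)
  have fE: "finite E" using E by (rule finite_regular_graph)
  have fV: "finite ?V" and V: "?V \<noteq> {}" and cV: "card ?V = n" using n by (auto simp: vertices_def)
  have "measure_pmf.prob (percolate p E) {D. a < real (L1 ?V D)}
      \<le> expec (percolate p E) (\<lambda>D. (\<Sum>v\<in>?V. indicator {D. k \<le> card (reach D {v})} D) / a)"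
  proof (rule prob_le_expec)
    show "finite (set_pmf (percolate p E))" using fE by (rule finite_set_percolate)
    show "0 \<le> (\<Sum>v\<in>?V. indicator {D. k \<le> card (reach D {v})} D) / a" for D :: "nat set set"
      using a by (simp add: sum_nonneg)
    fix D assume Din: "D \<in> set_pmf (percolate p E)" and "D \<in> {D. a < real (L1 ?V D)}"
    then have aL: "a < real (L1 ?V D)" by simp
    have DE: "D \<subseteq> E" using Din set_percolate[OF fE] by blast
    obtain v where v: "v \<in> ?V" "L1 ?V D = card (component ?V D v)" using L1_attained[OF fV V] .
    let ?C = "component ?V D v"
    have kL: "k \<le> card ?C" using aL v unfolding k_def by linarith
    have big: "k \<le> card (reach D {w})" if "w \<in> ?C" for w
    proof -
      have "?C \<subseteq> reach D {w}"
        using component_eq[OF that] by (auto simp: component_def reach_def)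
      moreover have "finite (\<Union>D)" using DE fE E by (auto simp: regular_graphs_def nsets_def intro: finite_subset)
      then have "finite (reach D {w})" using finite_subset[OF reach_subset_Un[of D "{w}"]] by auto
      ultimately show ?thesis using kL card_mono[of "reach D {w}" ?C] by linarith
    qed
    have "a \<le> real (card ?C)" using aL v by simp
    also have "\<dots> = (\<Sum>w\<in>?C. 1)" by simp
    also have "\<dots> \<le> (\<Sum>w\<in>?C. indicator {D. k \<le> card (reach D {w})} D)"
      using big by (intro sum_mono) auto
    also have "\<dots> \<le> (\<Sum>w\<in>?V. indicator {D. k \<le> card (reach D {w})} D)"
      using fV component_subset[of ?V D v] by (intro sum_mono2) auto
    finally show "1 \<le> (\<Sum>v\<in>?V. indicator {D. k \<le> card (reach D {v})} D) / a" using a by simp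
  qed
  also have "\<dots> = (\<Sum>v\<in>?V. measure_pmf.prob (percolate p E) {D. k \<le> card (reach D {v})}) / a"
    using fE by (simp add: expec_sum finite_set_percolate)
  also have "\<dots> \<le> (\<Sum>v\<in>?V. 4 * (10 * \<bar>lam\<bar> + 20) * t) / a"
    using a by (intro divide_right_mono sum_mono component_tail[OF E d t p k]) auto
  finally show ?thesis by (simp add: cV)
qed

section \<open>The exploration process\<close>

definition active :: "nat set \<Rightarrow> nat set set \<Rightarrow> nat set" where
  "active P D = \<Union>D - P"

text \<open>A state \<open>(P, D)\<close> consists of the processed vertices and the open edges found so far. When no
  vertex is active, restarting at a vertex with the fewest processed neighbours keeps the loss at
  restarts small; this choice only depends on edges incident to \<open>P\<close>.\<close>

definition next_vertex :: "nat set \<Rightarrow> nat set set \<Rightarrow> nat set \<Rightarrow> nat set set \<Rightarrow> nat" where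
  "next_vertex V E P D =
     (if active P D \<noteq> {} then Min (active P D)
      else arg_min_on (\<lambda>u. card (nbrs E u \<inter> P)) (V - P))"

text \<open>Undiscovered neighbours come first, so that coin \<open>j\<close> belongs to one of them exactly if \<open>j\<close> is
  less than their number.\<close>

definition test_order :: "nat set set \<Rightarrow> nat set \<Rightarrow> nat set set \<Rightarrow> nat \<Rightarrow> nat list" where
  "test_order E P D u = sorted_list_of_set (nbrs E u - (P \<union> \<Union>D)) @ sorted_list_of_set (nbrs E u \<inter> active P D)"

text \<open>Coins past the end of the list open nothing. The walk may still read them, and
  \<open>loss\<close> makes up for the difference.\<close>

definition opened :: "nat \<Rightarrow> nat list \<Rightarrow> (nat \<Rightarrow> bool) \<Rightarrow> nat set set" where
  "opened u xs r = (\<lambda>j. {u, xs ! j}) ` {j. j < length xs \<and> r j}"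

definition explore_step ::
  "nat set \<Rightarrow> nat set set \<Rightarrow> nat set \<times> nat set set \<Rightarrow> (nat \<Rightarrow> bool) \<Rightarrow> nat set \<times> nat set set" where
  "explore_step V E s r =
     (let P = fst s; D = snd s; u = next_vertex V E P D
      in (insert u P, D \<union> opened u (test_order E P D u) r))"

definition explore :: "nat set \<Rightarrow> nat set set \<Rightarrow> (nat \<Rightarrow> bool) list \<Rightarrow> nat set \<times> nat set set" where
  "explore V E rs = foldl (explore_step V E) ({}, {}) rs"

lemma explore_Nil [simp]: "explore V E [] = ({}, {})"
  by (simp add: explore_def)

lemma explore_snoc: "explore V E (rs @ [r]) = explore_step V E (explore V E rs) r"
  by (simp add: explore_def)

lemma nbrs_inc: "nbrs E u \<inter> P = nbrs (inc E P) u \<inter> P"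
  by (auto simp: nbrs_def inc_def)

lemma nbrs_inc_in: "u \<in> P \<Longrightarrow> nbrs E u = nbrs (inc E P) u"
  by (auto simp: nbrs_def inc_def)

lemma inc_eq_mono: "inc E' P = inc E P \<Longrightarrow> Q \<subseteq> P \<Longrightarrow> inc E' Q = inc E Q"
  unfolding inc_def by blast

lemma next_vertex_local: "inc E' P = inc E P \<Longrightarrow> next_vertex V E' P D = next_vertex V E P D"
  unfolding next_vertex_def by (metis nbrs_inc)

text \<open>Everything so far was decided by edges at processed vertices, so a graph with the same
  edges there has the same history. The graphs sharing a history can thus be described through
  \<open>inc\<close> alone.\<close>

lemma explore_local:
  assumes "inc E' (fst (explore V E rs)) = inc E (fst (explore V E rs))"
  shows "explore V E' rs = explore V E rs"
  using assms
proof (induction rs rule: rev_induct)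
  case (snoc r rs)
  define P D u where "P = fst (explore V E rs)" and "D = snd (explore V E rs)" and "u = next_vertex V E P D"
  have i: "inc E' (insert u P) = inc E (insert u P)"
    using snoc.prems by (simp add: explore_snoc explore_step_def Let_def P_def D_def u_def)
  then have iP: "inc E' P = inc E P" by (rule inc_eq_mono) auto
  have "explore V E' rs = explore V E rs" using iP by (intro snoc.IH) (simp add: P_def)
  moreover have "nbrs E' u = nbrs E u" using nbrs_inc_in[of u "insert u P" E] nbrs_inc_in[of u "insert u P" E'] i by simp
  then have "test_order E' P D u = test_order E P D u" by (simp add: test_order_def)
  ultimately show ?case
    using next_vertex_local[OF iP, of V D]
    by (simp add: explore_snoc explore_step_def Let_def P_def D_def u_def)
qed simp

locale regular_graph =
  fixes V :: "nat set" and E :: "nat set set" and d :: nat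
  assumes finV: "finite V" and subE: "E \<subseteq> nsets V 2" and reg: "\<And>v. v \<in> V \<Longrightarrow> card (nbrs E v) = d"
begin

lemma finE: "finite E"
  using subE finV finite_imp_finite_nsets finite_subset by blast

lemma fin_nbrs: "finite (nbrs E u)"
  by (rule finite_nbrs[OF finE])

lemma nbrs_V: "nbrs E u \<subseteq> V"
  by (rule nbrs_subset[OF subE])

definition valid :: "nat set \<times> nat set set \<Rightarrow> bool" where
  "valid s \<longleftrightarrow> fst s \<subseteq> V \<and> snd s \<subseteq> inc E (fst s)"

lemma valid_D_subset: "valid (P, D) \<Longrightarrow> D \<subseteq> E"
  by (auto simp: valid_def inc_def)

lemma valid_Union: "valid (P, D) \<Longrightarrow> \<Union>D \<subseteq> V"
  using subE valid_D_subset by (fastforce simp: nsets_def)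

lemma valid_finite: 
  assumes "valid (P, D)"
  shows "finite P" "finite D" "finite (\<Union>D)" "finite (active P D)"
  using assms finV finE valid_D_subset[OF assms] valid_Union[OF assms]
  by (auto simp: valid_def active_def intro: finite_subset)

lemma next_vertex_in:
  assumes "valid (P, D)" "card P < card V"
  shows "next_vertex V E P D \<in> V - P"
proof (cases "active P D = {}")
  case True
  have "V - P \<noteq> {}" using assms finV by (metis Diff_eq_empty_iff card_mono linorder_not_less valid_finite(1))
  then show ?thesis
    using True finV arg_min_if_finite(1)[of "V - P"] by (simp add: next_vertex_def)
next
  case False
  then have "Min (active P D) \<in> active P D" using valid_finite[OF assms(1)] by (intro Min_in)
  then show ?thesis using False valid_Union[OF assms(1)] by (auto simp: next_vertex_def active_def)
qed

lemma next_vertex_active: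
  assumes "valid (P, D)" "active P D \<noteq> {}"
  shows "next_vertex V E P D \<in> active P D"
  using assms valid_finite[OF assms(1)] Min_in by (simp add: next_vertex_def)

lemma set_test_order: "valid (P, D) \<Longrightarrow> set (test_order E P D u) = nbrs E u - P"
  using fin_nbrs[of u] by (auto simp: test_order_def active_def)

lemma distinct_test_order: "distinct (test_order E P D u)"
  by (auto simp: test_order_def active_def fin_nbrs)

lemma length_test_order: "length (test_order E P D u) = card (nbrs E u - P)"
proof -
  have "nbrs E u - P = (nbrs E u - (P \<union> \<Union>D)) \<union> (nbrs E u \<inter> active P D)" by (auto simp: active_def)
  also have "card \<dots> = card (nbrs E u - (P \<union> \<Union>D)) + card (nbrs E u \<inter> active P D)"
    using fin_nbrs by (intro card_Un_disjoint) (auto simp: active_def)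
  finally show ?thesis by (simp add: test_order_def)
qed

lemma opened_subset: "u \<notin> P \<Longrightarrow> valid (P, D) \<Longrightarrow> opened u (test_order E P D u) r \<subseteq> {e \<in> E. u \<in> e \<and> e \<inter> P = {}}"
proof
  fix e assume u: "u \<notin> P" "valid (P, D)" and "e \<in> opened u (test_order E P D u) r"
  then obtain j where j: "e = {u, test_order E P D u ! j}" "j < length (test_order E P D u)"
    by (auto simp: opened_def)
  then have "test_order E P D u ! j \<in> nbrs E u - P" using set_test_order[OF u(2), of u] nth_mem by blast
  then show "e \<in> {e \<in> E. u \<in> e \<and> e \<inter> P = {}}" using j u by (auto simp: nbrs_def)
qed

lemma valid_step:
  assumes "valid (P, D)" "card P < card V"
  shows "valid (explore_step V E (P, D) r)"
proof -
  let ?u = "next_vertex V E P D"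
  have u: "?u \<in> V - P" by (rule next_vertex_in[OF assms])
  then have "opened ?u (test_order E P D ?u) r \<subseteq> inc E (insert ?u P)"
    using opened_subset[OF _ assms(1), of ?u r] by (auto simp: inc_def)
  then show ?thesis using assms u by (auto simp: valid_def explore_step_def inc_def Let_def)
qed

lemma valid_explore:
  assumes "length rs \<le> card V"
  shows "valid (explore V E rs) \<and> card (fst (explore V E rs)) = length rs"
  using assms
proof (induction rs rule: rev_induct)
  case Nil
  then show ?case by (simp add: valid_def inc_def)
next
  case (snoc r rs)
  obtain P D where s: "explore V E rs = (P, D)" by (cases "explore V E rs")
  have v: "valid (P, D)" "card P = length rs" using snoc s by auto
  have lt: "card P < card V" using v snoc.prems by simp
  have "next_vertex V E P D \<notin> P" using next_vertex_in[OF v(1) lt] by simp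
  then show ?case
    using valid_step[OF v(1) lt, of r] v valid_finite[OF v(1)]
    by (simp add: explore_snoc s explore_step_def Let_def)
qed

definition fresh :: "nat set \<Rightarrow> nat set set \<Rightarrow> nat set" where
  "fresh P D = nbrs E (next_vertex V E P D) - (P \<union> \<Union>D)"

definition new_vertices :: "nat set \<Rightarrow> nat set set \<Rightarrow> (nat \<Rightarrow> bool) \<Rightarrow> nat set" where
  "new_vertices P D r = (\<lambda>j. sorted_list_of_set (fresh P D) ! j) ` {j. j < card (fresh P D) \<and> r j}"

lemma finite_fresh: "finite (fresh P D)"
  by (simp add: fresh_def fin_nbrs)

lemma nth_fresh:
  assumes "j < card (fresh P D)"
  shows "test_order E P D (next_vertex V E P D) ! j = sorted_list_of_set (fresh P D) ! j"
  using assms by (simp add: test_order_def fresh_def nth_append)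

lemma new_vertices_subset: "new_vertices P D r \<subseteq> fresh P D"
proof -
  have "sorted_list_of_set (fresh P D) ! j \<in> fresh P D" if "j < card (fresh P D)" for j
    using nth_mem[of j "sorted_list_of_set (fresh P D)"] that finite_fresh[of P D] by simp
  then show ?thesis by (auto simp: new_vertices_def)
qed

lemma inj_nth_fresh: "inj_on (\<lambda>j. sorted_list_of_set (fresh P D) ! j) {j. j < card (fresh P D)}"
  by (auto simp: inj_on_def nth_eq_iff_index_eq)

lemma card_new_vertices: "card (new_vertices P D r) = card {j. j < card (fresh P D) \<and> r j}"
  unfolding new_vertices_def by (intro card_image inj_on_subset[OF inj_nth_fresh]) auto

lemma sum_new_vertices:
  "(\<Sum>w\<in>new_vertices P D r. f w) = (\<Sum>j<card (fresh P D). of_bool (r j) * (f (sorted_list_of_set (fresh P D) ! j) :: real))"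
proof -
  have "(\<Sum>w\<in>new_vertices P D r. f w) = (\<Sum>j | j < card (fresh P D) \<and> r j. f (sorted_list_of_set (fresh P D) ! j))"
    unfolding new_vertices_def by (subst sum.reindex) (auto intro!: inj_on_subset[OF inj_nth_fresh])
  also have "\<dots> = (\<Sum>j<card (fresh P D). of_bool (r j) * f (sorted_list_of_set (fresh P D) ! j))"
    by (intro sum.mono_neutral_cong_left) auto
  finally show ?thesis .
qed

lemma sum_nth_fresh: "(\<Sum>j<card (fresh P D). f (sorted_list_of_set (fresh P D) ! j)) = (\<Sum>w\<in>fresh P D. f w)"
  by (rule sum.reindex_bij_betw[OF bij_betw_nth]) (auto simp: finite_fresh)

text \<open>By the test order, coins from \<open>card (fresh P D)\<close> on concern vertices that
  are already active, so an edge opened there adds no vertex.\<close>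

lemma active_step:
  assumes "valid (P, D)" "card P < card V"
  shows "active (fst (explore_step V E (P, D) r)) (snd (explore_step V E (P, D) r))
    = (active P D - {next_vertex V E P D}) \<union> new_vertices P D r"
proof -
  let ?u = "next_vertex V E P D" and ?xs = "test_order E P D (next_vertex V E P D)"
  have u: "?u \<in> V - P" by (rule next_vertex_in[OF assms])
  have un: "?u \<notin> nbrs E ?u" by (rule not_self_nbrs[OF subE])
  have xs: "?xs ! j \<in> nbrs E ?u - P" if "j < length ?xs" for j
    using that set_test_order[OF assms(1), of ?u] nth_mem by blast
  have xsu: "?u \<noteq> ?xs ! j" if "j < length ?xs" for j
    using xs[OF that] un by auto
  have late: "?xs ! j \<in> active P D" if "j < length ?xs" "\<not> j < card (fresh P D)" for j
  proof -
    have "?xs ! j = sorted_list_of_set (nbrs E ?u \<inter> active P D) ! (j - card (fresh P D))"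
      using that by (simp add: test_order_def fresh_def nth_append)
    also have "\<dots> \<in> set (sorted_list_of_set (nbrs E ?u \<inter> active P D))"
      using that by (intro nth_mem) (auto simp: test_order_def fresh_def)
    finally show ?thesis using fin_nbrs by simp
  qed
  have lenle: "card (fresh P D) \<le> length ?xs" by (simp add: test_order_def fresh_def)
  have "active (insert ?u P) (D \<union> opened ?u ?xs r)
      = (active P D - {?u}) \<union> (\<lambda>j. ?xs ! j) ` {j. j < length ?xs \<and> r j}"
    using xs xsu by (auto simp: active_def opened_def)
  also have "\<dots> = (active P D - {?u}) \<union> new_vertices P D r"
  proof (intro equalityI subsetI)
    fix w assume "w \<in> (active P D - {?u}) \<union> (\<lambda>j. ?xs ! j) ` {j. j < length ?xs \<and> r j}"
    then consider "w \<in> active P D - {?u}" | j where "w = ?xs ! j" "j < length ?xs" "r j" by auto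
    then show "w \<in> (active P D - {?u}) \<union> new_vertices P D r"
    proof cases
      case (2 j)
      show ?thesis
      proof (cases "j < card (fresh P D)")
        case True
        then show ?thesis using 2 nth_fresh[OF True] by (auto simp: new_vertices_def)
      next
        case False
        then show ?thesis using late[OF 2(2)] xs[OF 2(2)] un 2(1) by auto
      qed
    qed simp
  next
    fix w assume "w \<in> (active P D - {?u}) \<union> new_vertices P D r"
    then show "w \<in> (active P D - {?u}) \<union> (\<lambda>j. ?xs ! j) ` {j. j < length ?xs \<and> r j}"
    proof (cases "w \<in> new_vertices P D r")
      case True
      then obtain j where j: "j < card (fresh P D)" "r j" "w = ?xs ! j"
        using nth_fresh by (auto simp: new_vertices_def)
      then show ?thesis using lenle by auto
    qed simp
  qed
  finally show ?thesis by (simp add: explore_step_def Let_def)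
qed

text \<open>The heads that the walk counts although their coins belong to no undiscovered vertex.
  The upper end \<open>d - 1\<close> matches the walk; a restart vertex with \<open>d\<close> fresh
  neighbours has loss 0.\<close>

definition loss :: "nat set \<times> nat set set \<Rightarrow> (nat \<Rightarrow> bool) \<Rightarrow> nat" where
  "loss s r = card {j. card (fresh (fst s) (snd s)) \<le> j \<and> j < d - 1 \<and> r j}"

definition total_loss :: "(nat \<Rightarrow> bool) list \<Rightarrow> nat" where
  "total_loss rs = (\<Sum>i<length rs. loss (explore V E (take i rs)) (rs ! i))"

lemma total_loss_Nil [simp]: "total_loss [] = 0"
  by (simp add: total_loss_def)

lemma total_loss_snoc: "total_loss (rs @ [r]) = total_loss rs + loss (explore V E rs) r"
  by (simp add: total_loss_def nth_append)

lemma total_loss_mono: "total_loss rs \<le> total_loss (rs @ ys)"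
  by (induction ys rule: rev_induct) (simp_all add: total_loss_snoc flip: append_assoc)

end

definition increment :: "nat \<Rightarrow> (nat \<Rightarrow> bool) \<Rightarrow> int" where
  "increment N r = int (card {j. j < N \<and> r j}) - 1"

definition walk :: "nat \<Rightarrow> (nat \<Rightarrow> bool) list \<Rightarrow> int" where
  "walk N rs = (\<Sum>r\<leftarrow>rs. increment N r)"

lemma walk_Nil [simp]: "walk N [] = 0"
  by (simp add: walk_def)

lemma walk_append: "walk N (rs @ ys) = walk N rs + walk N ys"
  by (simp add: walk_def)

lemma walk_single: "walk N [r] = increment N r"
  by (simp add: walk_def)

context regular_graph
begin

definition num_active :: "(nat \<Rightarrow> bool) list \<Rightarrow> nat" where
  "num_active rs = card (active (fst (explore V E rs)) (snd (explore V E rs)))"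

lemma card_active_step:
  assumes "valid (P, D)" "card P < card V"
  shows "card ((active P D - {next_vertex V E P D}) \<union> new_vertices P D r)
    = card (active P D - {next_vertex V E P D}) + card {j. j < card (fresh P D) \<and> r j}"
  unfolding card_new_vertices[symmetric]
  using valid_finite[OF assms(1)] new_vertices_subset[of P D r] finite_fresh[of P D]
  by (intro card_Un_disjoint) (auto simp: fresh_def active_def intro: finite_subset)

text \<open>At a restart no active vertex is used up, so the \<open>- 1\<close> of
  \<open>increment\<close> is mere slack there; truncated subtraction in the cardinality bound
  treats both cases at once.\<close>

lemma num_active_step:
  assumes "length rs < card V"
  shows "int (num_active (rs @ [r])) \<ge> int (num_active rs) + increment (d - 1) r - int (loss (explore V E rs) r)"
proof -
  obtain P D where s: "explore V E rs = (P, D)" by (cases "explore V E rs")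
  have v: "valid (P, D)" "card P < card V" using valid_explore[of rs] assms s by auto
  let ?u = "next_vertex V E P D"
  have eq: "num_active (rs @ [r]) = card (active P D - {?u}) + card {j. j < card (fresh P D) \<and> r j}"
    unfolding num_active_def explore_snoc s active_step[OF v] card_active_step[OF v] ..
  have "card {j. j < d - 1 \<and> r j} \<le> card ({j. j < card (fresh P D) \<and> r j} \<union> {j. card (fresh P D) \<le> j \<and> j < d - 1 \<and> r j})"
    by (intro card_mono) auto
  also have "\<dots> \<le> card {j. j < card (fresh P D) \<and> r j} + card {j. card (fresh P D) \<le> j \<and> j < d - 1 \<and> r j}"
    by (rule card_Un_le)
  finally have "card {j. j < d - 1 \<and> r j} \<le> card {j. j < card (fresh P D) \<and> r j} + loss (explore V E rs) r"
    by (simp add: loss_def s)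
  moreover have "card (active P D) - 1 \<le> card (active P D - {?u})" by (simp add: card_Diff_singleton_if)
  ultimately show ?thesis using eq by (simp add: num_active_def s increment_def)
qed

lemma num_active_ge:
  assumes "length rs + length ys \<le> card V"
  shows "int (num_active (rs @ ys)) \<ge> int (num_active rs) + walk (d - 1) ys - (int (total_loss (rs @ ys)) - int (total_loss rs))"
  using assms
proof (induction ys rule: rev_induct)
  case (snoc y ys)
  have "int (num_active ((rs @ ys) @ [y])) \<ge> int (num_active (rs @ ys)) + increment (d - 1) y - int (loss (explore V E (rs @ ys)) y)"
    using snoc.prems by (intro num_active_step) simp
  then show ?case using snoc total_loss_snoc[of "rs @ ys" y] by (simp add: walk_append walk_single)
qed simp

text \<open>Every active vertex stems from some head. This crude bound later controls how many edges
  the current vertex sends to active vertices.\<close>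

lemma num_active_le:
  assumes "length rs \<le> card V"
  shows "num_active rs \<le> (\<Sum>r\<leftarrow>rs. card {j. j < d \<and> r j})"
  using assms
proof (induction rs rule: rev_induct)
  case Nil
  then show ?case by (simp add: num_active_def active_def)
next
  case (snoc r rs)
  obtain P D where s: "explore V E rs = (P, D)" by (cases "explore V E rs")
  have v: "valid (P, D)" "card P < card V" using valid_explore[of rs] snoc.prems s by auto
  let ?u = "next_vertex V E P D"
  have eq: "num_active (rs @ [r]) = card (active P D - {?u}) + card {j. j < card (fresh P D) \<and> r j}"
    unfolding num_active_def explore_snoc s active_step[OF v] card_active_step[OF v] ..
  have "card (fresh P D) \<le> d"
    using card_mono[OF fin_nbrs, of "fresh P D" ?u] reg[of ?u] next_vertex_in[OF v] by (auto simp: fresh_def)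
  then have "card {j. j < card (fresh P D) \<and> r j} \<le> card {j. j < d \<and> r j}"
    by (intro card_mono) auto
  moreover have "card (active P D - {?u}) \<le> card (active P D)"
    using valid_finite[OF v(1)] by (intro card_mono) auto
  ultimately show ?case using snoc eq by (simp add: num_active_def s)
qed

section \<open>Connectivity of the vertices met during an excursion\<close>

definition linked :: "nat set \<Rightarrow> nat set set \<Rightarrow> bool" where
  "linked X D \<longleftrightarrow> (\<forall>x\<in>X. \<forall>y\<in>X. (x, y) \<in> (adjacency D)\<^sup>*)"

lemma linked_hub:
  assumes "\<And>x. x \<in> X \<Longrightarrow> (u, x) \<in> (adjacency D)\<^sup>*"
  shows "linked X D"
proof -
  have "sym ((adjacency D)\<^sup>*)"
    by (intro sym_rtrancl) (auto simp: sym_def adjacency_def insert_commute)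
  then show ?thesis unfolding linked_def using assms by (meson rtrancl_trans symD)
qed

text \<open>Here \<open>X\<close> stands for the vertices processed during the current run. The next
  vertex has to be active, since a restart vertex is not joined to what came before.\<close>

lemma linked_step:
  assumes v: "valid (P, D)" "card P < card V" and X: "linked (X \<union> active P D) D"
    and u: "next_vertex V E P D \<in> active P D"
    and s': "explore_step V E (P, D) r = (P', D')"
  shows "linked (insert (next_vertex V E P D) X \<union> active P' D') D'"
proof (rule linked_hub[where u="next_vertex V E P D"])
  let ?u = "next_vertex V E P D"
  have DD: "D \<subseteq> D'" using s' by (auto simp: explore_step_def Let_def)
  then have mono: "(adjacency D)\<^sup>* \<subseteq> (adjacency D')\<^sup>*" by (intro rtrancl_mono) (auto simp: adjacency_def)
  fix x assume "x \<in> insert ?u X \<union> active P' D'"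
  then consider "x = ?u" | "x \<in> X \<union> active P D" | "x \<in> new_vertices P D r"
    using active_step[OF v, of r] s' by auto
  then show "(?u, x) \<in> (adjacency D')\<^sup>*"
  proof cases
    case 2
    then show ?thesis using X u mono by (auto simp: linked_def)
  next
    case 3
    then obtain j where j: "j < card (fresh P D)" "r j" "x = test_order E P D ?u ! j"
      using nth_fresh by (auto simp: new_vertices_def)
    have "{?u, x} \<in> opened ?u (test_order E P D ?u) r"
      using j by (auto simp: opened_def test_order_def fresh_def)
    then show ?thesis using s' by (auto simp: explore_step_def Let_def adjacency_def)
  qed simp
qed

lemma linked_active:
  assumes "length rs \<le> card V"
  shows "linked (active (fst (explore V E rs)) (snd (explore V E rs))) (snd (explore V E rs))"
  using assms
proof (induction rs rule: rev_induct)
  case Nil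
  then show ?case by (simp add: linked_def active_def)
next
  case (snoc r rs)
  obtain P D where s: "explore V E rs = (P, D)" by (cases "explore V E rs")
  obtain P' D' where s': "explore_step V E (P, D) r = (P', D')" by (cases "explore_step V E (P, D) r")
  have v: "valid (P, D)" "card P < card V" using valid_explore[of rs] snoc.prems s by auto
  let ?u = "next_vertex V E P D"
  show ?case
  proof (cases "active P D = {}")
    case False
    have "linked (insert ?u {} \<union> active P' D') D'"
      using snoc s by (intro linked_step[OF v _ next_vertex_active[OF v(1) False] s']) auto
    then show ?thesis by (simp add: explore_snoc s s' linked_def)
  next
    case True
    have "linked (active P' D') D'"
    proof (rule linked_hub[where u="?u"])
      fix x assume "x \<in> active P' D'"
      then have "x \<in> new_vertices P D r" using active_step[OF v, of r] s' True by auto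
      then obtain j where j: "j < card (fresh P D)" "r j" "x = test_order E P D ?u ! j"
        using nth_fresh by (auto simp: new_vertices_def)
      have "{?u, x} \<in> opened ?u (test_order E P D ?u) r"
        using j by (auto simp: opened_def test_order_def fresh_def)
      then show "(?u, x) \<in> (adjacency D')\<^sup>*" using s' by (auto simp: explore_step_def Let_def adjacency_def)
    qed
    then show ?thesis by (simp add: explore_snoc s s')
  qed
qed

text \<open>The run may start in the middle of an excursion: the vertices active at that time
  already lie in one component, and those processed earlier are left out of the count.\<close>

lemma linked_run:
  assumes "length rs + length ys \<le> card V" "\<And>t. t < length ys \<Longrightarrow> 0 < num_active (rs @ take t ys)"
  shows "linked ((fst (explore V E (rs @ ys)) - fst (explore V E rs)) \<union>
      active (fst (explore V E (rs @ ys))) (snd (explore V E (rs @ ys)))) (snd (explore V E (rs @ ys)))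
    \<and> fst (explore V E rs) \<subseteq> fst (explore V E (rs @ ys))"
  using assms
proof (induction ys rule: rev_induct)
  case Nil
  then show ?case using linked_active[of rs] by simp
next
  case (snoc y ys)
  let ?P0 = "fst (explore V E rs)"
  obtain P D where s: "explore V E (rs @ ys) = (P, D)" by (cases "explore V E (rs @ ys)")
  obtain P' D' where s': "explore_step V E (P, D) y = (P', D')" by (cases "explore_step V E (P, D) y")
  have v: "valid (P, D)" "card P < card V" using valid_explore[of "rs @ ys"] snoc.prems s by auto
  let ?u = "next_vertex V E P D"
  have "0 < num_active (rs @ take t ys)" if "t < length ys" for t
    using snoc.prems(2)[of t] that by simp
  then have IH: "linked ((P - ?P0) \<union> active P D) D" "?P0 \<subseteq> P"
    using snoc.IH snoc.prems(1) s by auto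
  have "0 < num_active (rs @ ys)" using snoc.prems(2)[of "length ys"] by simp
  then have "active P D \<noteq> {}" by (auto simp: num_active_def s)
  then have "linked (insert ?u (P - ?P0) \<union> active P' D') D'"
    by (intro linked_step[OF v IH(1) next_vertex_active[OF v(1)] s'])
  moreover have "P' = insert ?u P" using s' by (auto simp: explore_step_def Let_def)
  ultimately show ?case
    using IH(2) by (auto simp: explore_snoc s s' linked_def simp flip: append_assoc)
qed

lemma long_excursion_L1:
  assumes len: "length rs + length ys \<le> card V" and pos: "\<And>t. t < length ys \<Longrightarrow> 0 < num_active (rs @ take t ys)"
    and D: "snd (explore V E (rs @ ys)) \<subseteq> D'"
  shows "length ys \<le> L1 V D'"
proof (cases "ys = []")
  case False
  obtain P0 D0 where s0: "explore V E rs = (P0, D0)" by (cases "explore V E rs")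
  obtain P D where s: "explore V E (rs @ ys) = (P, D)" by (cases "explore V E (rs @ ys)")
  have v0: "valid (P0, D0)" "card P0 = length rs" using valid_explore[of rs] len s0 by auto
  have v: "valid (P, D)" "card P = length rs + length ys" using valid_explore[of "rs @ ys"] len s by auto
  have l: "linked ((P - P0) \<union> active P D) D" "P0 \<subseteq> P" using linked_run[OF len pos] s s0 by auto
  have c: "card (P - P0) = length ys"
    using card_Diff_subset[of P0 P] valid_finite[OF v0(1)] v0 v l by simp
  then obtain x where x: "x \<in> P - P0" using False by (metis card.empty length_0_conv ex_in_conv)
  have PV: "P \<subseteq> V" using v by (simp add: valid_def)
  have mono: "(adjacency D)\<^sup>* \<subseteq> (adjacency D')\<^sup>*" using D s by (intro rtrancl_mono) (auto simp: adjacency_def)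
  have "P - P0 \<subseteq> component V D' x"
    using l x PV mono by (auto simp: component_def linked_def)
  then have "length ys \<le> card (component V D' x)"
    unfolding c[symmetric] using finV component_subset[of V D' x] by (intro card_mono) (auto intro: finite_subset)
  also have "\<dots> \<le> L1 V D'" using card_le_L1[OF finV] x PV by blast
  finally show ?thesis .
qed simp

end

section \<open>Expected loss\<close>

text \<open>There are \<open>d\<close> coins although the walk reads \<open>d - 1\<close>, because a
  restart vertex can have all of its \<open>d\<close> edges untested.\<close>

definition row :: "nat \<Rightarrow> real \<Rightarrow> (nat \<Rightarrow> bool) pmf" where
  "row d p = Pi_pmf {..<d} False (\<lambda>_. bernoulli_pmf p)"

definition rows :: "nat \<Rightarrow> nat \<Rightarrow> real \<Rightarrow> (nat \<Rightarrow> bool) list pmf" where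
  "rows m d p = replicate_pmf m (row d p)"

lemma finite_set_row [simp]: "finite (set_pmf (row d p))"
  by (simp add: row_def finite_set_Pi_bool)

lemma finite_set_rows [simp]: "finite (set_pmf (rows m d p))"
  unfolding rows_def set_replicate_pmf
  using finite_lists_length_eq[OF finite_set_row[of d p], of m] by (simp add: lists_eq_set Collect_conj_eq Int_commute)

lemma length_rows: "rs \<in> set_pmf (rows m d p) \<Longrightarrow> length rs = m"
  by (simp add: rows_def set_replicate_pmf)

lemma rows_0 [simp]: "rows 0 d p = return_pmf []"
  by (simp add: rows_def)

lemma rows_add:
  "rows (m + k) d p = bind_pmf (rows m d p) (\<lambda>xs. bind_pmf (rows k d p) (\<lambda>ys. return_pmf (xs @ ys)))"
  by (simp add: rows_def replicate_pmf_distrib)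

lemma rows_snoc:
  "rows (Suc m) d p = bind_pmf (rows m d p) (\<lambda>rs. map_pmf (\<lambda>r. rs @ [r]) (row d p))"
proof -
  have "rows 1 d p = map_pmf (\<lambda>x. [x]) (row d p)" unfolding rows_def by (rule replicate_pmf_1)
  then show ?thesis using rows_add[of m 1 d p] by (simp add: bind_map_pmf) (simp add: map_pmf_def)
qed

lemma expec_rows_add:
  "expec (rows (m + k) d p) f = expec (rows m d p) (\<lambda>xs. expec (rows k d p) (\<lambda>ys. f (xs @ ys)))"
  by (simp add: rows_add expec_bind)

lemma expec_rows_snoc:
  "expec (rows (Suc m) d p) f = expec (rows m d p) (\<lambda>rs. expec (row d p) (\<lambda>r. f (rs @ [r])))"
  by (simp add: rows_snoc expec_bind)

lemma expec_row_coin: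
  assumes "0 \<le> p" "p \<le> 1" "j < d"
  shows "expec (row d p) (\<lambda>r. of_bool (r j)) = p"
proof -
  have "expec (row d p) (\<lambda>r. of_bool (r j)) = expec (map_pmf (\<lambda>r. r j) (row d p)) of_bool" by simp
  also have "\<dots> = p"
    using assms by (simp add: row_def Pi_pmf_component expec_bernoulli del: integral_map_pmf)
  finally show ?thesis .
qed

lemma expec_row_linear:
  assumes "0 \<le> p" "p \<le> 1" "J \<subseteq> {..<d}"
  shows "expec (row d p) (\<lambda>r. \<Sum>j\<in>J. of_bool (r j) * c j) = p * (\<Sum>j\<in>J. c j)"
proof -
  have "expec (row d p) (\<lambda>r. \<Sum>j\<in>J. of_bool (r j) * c j) = (\<Sum>j\<in>J. expec (row d p) (\<lambda>r. of_bool (r j) * c j))"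
    by (rule expec_sum) simp
  also have "\<dots> = (\<Sum>j\<in>J. p * c j)"
    using assms by (intro sum.cong) (auto simp: expec_row_coin subset_iff)
  finally show ?thesis by (simp add: sum_distrib_left)
qed

lemma sum_of_bool_card:
  "finite A \<Longrightarrow> (\<Sum>x\<in>A. of_bool (Q x)) = of_nat (card {x \<in> A. Q x})"
  by (simp only: sum_of_bool_eq Int_def mem_Collect_eq)

lemma card_coins:
  fixes a b :: nat
  shows "real (card {j. a \<le> j \<and> j < b \<and> r j}) = (\<Sum>j\<in>{a..<b}. of_bool (r j) * 1)"
proof -
  have "{j. a \<le> j \<and> j < b \<and> r j} = {j \<in> {a..<b}. r j}" by auto
  then show ?thesis by (simp only: mult_1_right sum_of_bool_card finite_atLeastLessThan)
qed

lemma expec_card_coins: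
  assumes "0 \<le> p" "p \<le> 1" "b \<le> d"
  shows "expec (row d p) (\<lambda>r. real (card {j. a \<le> j \<and> j < b \<and> r j})) = p * real (b - a)"
  unfolding card_coins using assms by (subst expec_row_linear) auto

section \<open>Percolation generated by the exploration, and the potential\<close>

context regular_graph
begin

text \<open>The test order lists each untested edge at \<open>u\<close> once, so relabelling by
  position turns the edge coins into an initial segment of the row.\<close>

lemma percolate_star:
  assumes u: "u \<notin> P" "u \<in> V" and v: "valid (P, D)"
  shows "percolate p {e \<in> E. u \<in> e \<and> e \<inter> P = {}} = map_pmf (opened u (test_order E P D u)) (row d p)"
proof -
  let ?X = "{e \<in> E. u \<in> e \<and> e \<inter> P = {}}" and ?xs = "test_order E P D u"
  define k where "k = length ?xs"
  define f where "f j = {u, ?xs ! j}" for j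
  have kd: "k \<le> d" 
    unfolding k_def length_test_order reg[OF u(2), symmetric] by (intro card_mono fin_nbrs) auto
  have inj: "inj_on f {..<k}"
  proof (rule inj_onI)
    fix i j assume ij: "i \<in> {..<k}" "j \<in> {..<k}" "f i = f j"
    then have "?xs ! i = ?xs ! j" by (auto simp: f_def doubleton_eq_iff)
    then show "i = j" using ij distinct_test_order[of P D u] by (simp add: k_def nth_eq_iff_index_eq)
  qed
  have im: "f ` {..<k} = ?X"
  proof -
    have "(\<lambda>j. ?xs ! j) ` {..<k} = set ?xs" by (auto simp: k_def set_conv_nth)
    moreover have "f ` {..<k} = (\<lambda>w. {u, w}) ` ((\<lambda>j. ?xs ! j) ` {..<k})" by (simp add: f_def image_image)
    ultimately have "f ` {..<k} = (\<lambda>w. {u, w}) ` set ?xs" by (simp only:)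
    also have "\<dots> = (\<lambda>w. {u, w}) ` (nbrs E u - P)" by (simp add: set_test_order[OF v])
    also have "\<dots> = {e \<in> {e \<in> E. u \<in> e}. e \<inter> P = {}}"
      unfolding star_eq_image_nbrs[OF subE] using u by auto
    finally show ?thesis by auto
  qed
  \<comment> \<open>Anything outside \<open>?X\<close> gets the index \<open>k\<close>, just beyond
    the truncated row, whose default \<open>False\<close> matches the default of the edge
    coins.\<close>
  define h where "h e = (if e \<in> ?X then the_inv_into {..<k} f e else k)" for e
  have hf: "h (f j) = j" if "j < k" for j
    using that im inj by (auto simp: h_def the_inv_into_f_f)
  have bij: "bij_betw h ?X {..<k}"
    unfolding im[symmetric] using hf by (intro bij_betw_byWitness[where f'=f]) auto
  have op: "opened u ?xs r = {e \<in> ?X. h e < k \<and> r (h e)}" for r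
    unfolding im[symmetric] using hf by (auto simp: opened_def f_def k_def)
  have "percolate p ?X = map_pmf (\<lambda>keep. {e \<in> ?X. keep e}) (map_pmf (\<lambda>g. g \<circ> h) (Pi_pmf {..<k} False (\<lambda>_. bernoulli_pmf p)))"
    unfolding percolate_def using finE bij
    by (subst Pi_pmf_bij_betw[of ?X h "{..<k}"]) (auto simp: h_def)
  also have "Pi_pmf {..<k} False (\<lambda>_. bernoulli_pmf p) = map_pmf (\<lambda>f x. if x \<in> {..<k} then f x else False) (row d p)"
    unfolding row_def using kd by (intro Pi_pmf_subset) auto
  also have "map_pmf (\<lambda>keep. {e \<in> ?X. keep e}) (map_pmf (\<lambda>g. g \<circ> h) \<dots>) = map_pmf (opened u ?xs) (row d p)"
    unfolding op by (auto simp: map_pmf_comp o_def intro!: map_pmf_cong)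
  finally show ?thesis .
qed

text \<open>Deferred decisions: the steps of the exploration only settle edges at processed
  vertices, so the remaining edges can be percolated independently afterwards. Whatever the
  exploration finds therefore transfers to the percolated graph.\<close>

lemma percolate_explore:
  assumes "m \<le> card V"
  shows "percolate p E = bind_pmf (rows m d p) (\<lambda>rs.
    map_pmf (\<lambda>Y. snd (explore V E rs) \<union> Y) (percolate p {e \<in> E. e \<inter> fst (explore V E rs) = {}}))"
  using assms
proof (induction m)
  case 0
  have "(\<union>) {} = (\<lambda>Y :: nat set set. Y)" by auto
  then show ?case by (simp add: bind_return_pmf)
next
  case (Suc m)
  have "map_pmf (\<lambda>Y. snd (explore V E rs) \<union> Y) (percolate p {e \<in> E. e \<inter> fst (explore V E rs) = {}})
    = bind_pmf (row d p) (\<lambda>r. map_pmf (\<lambda>Y. snd (explore V E (rs @ [r])) \<union> Y)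
        (percolate p {e \<in> E. e \<inter> fst (explore V E (rs @ [r])) = {}}))"
    if "rs \<in> set_pmf (rows m d p)" for rs
  proof -
    obtain P D where s: "explore V E rs = (P, D)" by (cases "explore V E rs")
    have v: "valid (P, D)" "card P < card V"
      using valid_explore[of rs] Suc.prems s length_rows[OF that] by auto
    let ?u = "next_vertex V E P D"
    have u: "?u \<notin> P" "?u \<in> V" using next_vertex_in[OF v] by auto
    define X Y where "X = {e \<in> E. ?u \<in> e \<and> e \<inter> P = {}}" and "Y = {e \<in> E. e \<inter> insert ?u P = {}}"
    have D': "snd (explore V E (rs @ [r])) = D \<union> opened ?u (test_order E P D ?u) r" for r
      by (simp add: explore_snoc s explore_step_def Let_def)
    have Y': "{e \<in> E. e \<inter> fst (explore V E (rs @ [r])) = {}} = Y" for r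
      by (simp add: explore_snoc s explore_step_def Let_def Y_def)
    have "{e \<in> E. e \<inter> P = {}} = X \<union> Y" by (auto simp: X_def Y_def)
    moreover have "percolate p (X \<union> Y) = bind_pmf (percolate p X) (\<lambda>X. bind_pmf (percolate p Y) (\<lambda>Y. return_pmf (X \<union> Y)))"
      using finE by (intro percolate_union) (auto simp: X_def Y_def)
    moreover have "percolate p X = map_pmf (opened ?u (test_order E P D ?u)) (row d p)"
      unfolding X_def by (rule percolate_star[OF u v(1)])
    ultimately have "percolate p {e \<in> E. e \<inter> P = {}} =
        bind_pmf (row d p) (\<lambda>r. bind_pmf (percolate p Y) (\<lambda>Z. return_pmf (opened ?u (test_order E P D ?u) r \<union> Z)))"
      by (simp only: bind_map_pmf)
    then show ?thesis unfolding D' Y' s fst_conv snd_conv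
      by (simp only: map_bind_pmf map_pmf_def bind_assoc_pmf bind_return_pmf Un_assoc)
  qed
  then have "percolate p E = bind_pmf (rows m d p) (\<lambda>rs. bind_pmf (row d p) (\<lambda>r. map_pmf (\<lambda>Y. snd (explore V E (rs @ [r])) \<union> Y)
        (percolate p {e \<in> E. e \<inter> fst (explore V E (rs @ [r])) = {}})))"
    using Suc by (subst Suc.IH) (auto intro!: bind_pmf_cong)
  then show ?case by (simp add: rows_snoc bind_assoc_pmf bind_map_pmf)
qed

text \<open>An edge between a processed and an undiscovered vertex only causes a loss once the latter is
  discovered and processed. The potential records this debt of the active vertices in advance.\<close>

definition potential :: "nat set \<Rightarrow> nat set set \<Rightarrow> real" where
  "potential P D = (\<Sum>w\<in>active P D. real (card (nbrs E w \<inter> P)) - 1)"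

text \<open>Measured in units of \<open>p\<close>. An edge from the current vertex to an active one
  counts twice, as an expected loss now and as new debt of its other end. A fresh vertex is
  discovered with probability \<open>p\<close> and then brings its processed neighbours as debt. The
  last term pays for a restart.\<close>

definition step_cost :: "real \<Rightarrow> nat set \<Rightarrow> nat set set \<Rightarrow> real" where
  "step_cost p P D = 2 * real (card (nbrs E (next_vertex V E P D) \<inter> active P D))
     + p * (\<Sum>w\<in>fresh P D. real (card (nbrs E w \<inter> P))) + 2 * real d * real (card P) / real (card V)"

text \<open>The witness is the edge through which \<open>w\<close> was discovered. It is the one for
  which the walk uses \<open>d - 1\<close> in place of \<open>d\<close>, and it makes the summands
  of \<open>potential\<close> nonnegative.\<close>

lemma active_has_neighbour:
  assumes "valid (P, D)" "w \<in> active P D"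
  shows "1 \<le> card (nbrs E w \<inter> P)"
proof -
  obtain e where e: "e \<in> D" "w \<in> e" using assms(2) by (auto simp: active_def)
  then have "e \<in> E" "e \<inter> P \<noteq> {}" using assms(1) by (auto simp: valid_def inc_def)
  moreover obtain x y where "e = {x, y}" using \<open>e \<in> E\<close> subE by (meson nsets2_E subsetD)
  ultimately have "nbrs E w \<inter> P \<noteq> {}" using e(2) assms(2) by (auto simp: nbrs_def active_def insert_commute)
  then show ?thesis using fin_nbrs[of w] by (simp add: Suc_le_eq card_gt_0_iff)
qed

lemma potential_nonneg: "valid (P, D) \<Longrightarrow> 0 \<le> potential P D"
  unfolding potential_def using active_has_neighbour by (intro sum_nonneg) fastforce

lemma sum_nbrs_le:
  assumes "P \<subseteq> V"
  shows "(\<Sum>w\<in>V - P. card (nbrs E w \<inter> P)) \<le> d * card P"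
proof -
  have fP: "finite P" using assms finV finite_subset by blast
  have "(\<Sum>w\<in>V - P. card (nbrs E w \<inter> P)) = (\<Sum>w\<in>V - P. \<Sum>z\<in>P. of_bool (z \<in> nbrs E w))"
    using fP by (intro sum.cong) (auto simp: sum_of_bool_card intro!: arg_cong[where f=card])
  also have "\<dots> = (\<Sum>z\<in>P. \<Sum>w\<in>V - P. of_bool (w \<in> nbrs E z))"
    by (subst sum.swap) (simp add: nbrs_sym[of _ E])
  also have "\<dots> \<le> (\<Sum>z\<in>P. d)"
  proof (rule sum_mono)
    fix z assume z: "z \<in> P"
    have "(\<Sum>w\<in>V - P. of_bool (w \<in> nbrs E z)) = card (nbrs E z \<inter> (V - P))"
      using finV by (auto simp: sum_of_bool_card intro!: arg_cong[where f=card])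
    also have "\<dots> \<le> card (nbrs E z)" by (intro card_mono fin_nbrs) auto
    finally show "(\<Sum>w\<in>V - P. of_bool (w \<in> nbrs E z)) \<le> d" using z assms reg by auto
  qed
  finally show ?thesis by (simp add: mult.commute)
qed

text \<open>The minimum is at most the average: at most \<open>d * card P\<close> edges leave
  \<open>P\<close>, and at least half of the vertices are unprocessed.\<close>

lemma root_few_processed_neighbours:
  assumes v: "valid (P, D)" "active P D = {}" and half: "2 * card P \<le> card V" "0 < card V"
  shows "real (card (nbrs E (next_vertex V E P D) \<inter> P)) \<le> 2 * real d * real (card P) / real (card V)"
proof -
  let ?u = "next_vertex V E P D"
  have PV: "P \<subseteq> V" using v by (simp add: valid_def)
  have lt: "card P < card V" using half by linarith
  have ne: "V - P \<noteq> {}" using next_vertex_in[OF v(1) lt] by blast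
  have min: "card (nbrs E ?u \<inter> P) \<le> card (nbrs E w \<inter> P)" if "w \<in> V - P" for w
    using arg_min_least[OF _ ne, of w "\<lambda>u. card (nbrs E u \<inter> P)"] that finV v(2) by (simp add: next_vertex_def)
  have "card (V - P) * card (nbrs E ?u \<inter> P) \<le> (\<Sum>w\<in>V - P. card (nbrs E w \<inter> P))"
    using sum_mono[of "V - P" "\<lambda>_. card (nbrs E ?u \<inter> P)"] min by simp
  also have "\<dots> \<le> d * card P" by (rule sum_nbrs_le[OF PV])
  finally have "card (V - P) * card (nbrs E ?u \<inter> P) \<le> d * card P" .
  moreover have "card V \<le> 2 * card (V - P)" using half PV finV by (simp add: card_Diff_subset finite_subset)
  then have "card V * card (nbrs E ?u \<inter> P) \<le> 2 * card (V - P) * card (nbrs E ?u \<inter> P)" by (rule mult_le_mono1)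
  ultimately have "card V * card (nbrs E ?u \<inter> P) \<le> 2 * (d * card P)" by linarith
  then have "real (card V * card (nbrs E ?u \<inter> P)) \<le> real (2 * (d * card P))" by (simp only: of_nat_le_iff)
  then show ?thesis using half(2) by (simp add: field_simps)
qed

text \<open>For a new vertex the edge to the current one cancels the \<open>- 1\<close>, leaving its
  earlier processed neighbours. A vertex that stays active gains one unit exactly if it is adjacent
  to the current vertex.\<close>

lemma potential_step:
  assumes v: "valid (P, D)" "card P < card V" and s': "explore_step V E (P, D) r = (P', D')"
  shows "potential P' D' = (potential P D - (if active P D = {} then 0 else real (card (nbrs E (next_vertex V E P D) \<inter> P)) - 1))
    + real (card (nbrs E (next_vertex V E P D) \<inter> active P D)) + (\<Sum>w\<in>new_vertices P D r. real (card (nbrs E w \<inter> P)))"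
proof -
  let ?u = "next_vertex V E P D" and ?A = "active P D"
  have u: "?u \<in> V - P" by (rule next_vertex_in[OF v])
  have P': "P' = insert ?u P" using s' by (auto simp: explore_step_def Let_def)
  have A': "active P' D' = (?A - {?u}) \<union> new_vertices P D r" using active_step[OF v, of r] s' by simp
  have fA: "finite ?A" by (rule valid_finite[OF v(1)])
  have fN: "finite (new_vertices P D r)" using finite_subset[OF new_vertices_subset finite_fresh] .
  have disj: "(?A - {?u}) \<inter> new_vertices P D r = {}"
    using new_vertices_subset[of P D r] by (auto simp: fresh_def active_def)
  have c: "card (nbrs E w \<inter> P') = card (nbrs E w \<inter> P) + of_bool (?u \<in> nbrs E w)" for w
    using u fin_nbrs[of w] by (auto simp: P' card_insert_if)
  have uu: "?u \<notin> nbrs E ?u" by (rule not_self_nbrs[OF subE])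
  have "potential P' D' = (\<Sum>w\<in>?A - {?u}. real (card (nbrs E w \<inter> P')) - 1) + (\<Sum>w\<in>new_vertices P D r. real (card (nbrs E w \<inter> P')) - 1)"
    unfolding potential_def A' using fA fN disj by (intro sum.union_disjoint) auto
  also have "(\<Sum>w\<in>new_vertices P D r. real (card (nbrs E w \<inter> P')) - 1) = (\<Sum>w\<in>new_vertices P D r. real (card (nbrs E w \<inter> P)))"
  proof (rule sum.cong)
    fix w assume "w \<in> new_vertices P D r"
    then have "?u \<in> nbrs E w" using new_vertices_subset[of P D r] nbrs_sym[of w E ?u] by (auto simp: fresh_def)
    then show "real (card (nbrs E w \<inter> P')) - 1 = real (card (nbrs E w \<inter> P))" by (simp add: c)
  qed simp
  also have "(\<Sum>w\<in>?A - {?u}. real (card (nbrs E w \<inter> P')) - 1)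
      = (\<Sum>w\<in>?A - {?u}. real (card (nbrs E w \<inter> P)) - 1) + (\<Sum>w\<in>?A - {?u}. of_bool (?u \<in> nbrs E w))"
  proof -
    have "real (card (nbrs E w \<inter> P')) - 1 = (real (card (nbrs E w \<inter> P)) - 1) + of_bool (?u \<in> nbrs E w)" for w
      unfolding c by simp
    then show ?thesis by (simp only: sum.distrib)
  qed
  also have "(\<Sum>w\<in>?A - {?u}. of_bool (?u \<in> nbrs E w)) = real (card (nbrs E ?u \<inter> ?A))"
  proof -
    have "nbrs E ?u \<inter> ?A = {w \<in> ?A - {?u}. ?u \<in> nbrs E w}" using uu by (auto simp: nbrs_def insert_commute)
    then show ?thesis using fA by (simp only: sum_of_bool_card finite_Diff)
  qed
  also have "(\<Sum>w\<in>?A - {?u}. real (card (nbrs E w \<inter> P)) - 1)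
      = potential P D - (if ?A = {} then 0 else real (card (nbrs E ?u \<inter> P)) - 1)"
    using next_vertex_active[OF v(1)] fA by (simp add: potential_def sum_diff1)
  finally show ?thesis .
qed

text \<open>For an active vertex the expected loss due to its processed neighbours equals
  \<open>p\<close> times the debt released from the potential. At a restart no debt was recorded, so
  the choice of the restart vertex has to bound that loss directly.\<close>

lemma expec_loss_step:
  assumes v: "valid (P, D)" and half: "2 * card P \<le> card V" "0 < card V" and p: "0 \<le> p" "p \<le> 1"
  shows "expec (row d p) (\<lambda>r. real (loss (P, D) r) + p * potential (fst (explore_step V E (P, D) r)) (snd (explore_step V E (P, D) r)))
    \<le> p * potential P D + p * step_cost p P D"
proof -
  let ?u = "next_vertex V E P D" and ?A = "active P D"
  have lt: "card P < card V" using half by linarith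
  have u: "?u \<in> V - P" by (rule next_vertex_in[OF v lt])
  let ?k = "real (card (nbrs E ?u \<inter> P))" and ?a = "real (card (nbrs E ?u \<inter> ?A))"
  define R where "R = (if ?A = {} then 0 else ?k - 1)"
  have dsum: "d = card (fresh P D) + card (nbrs E ?u \<inter> ?A) + card (nbrs E ?u \<inter> P)"
  proof -
    have "nbrs E ?u = (fresh P D \<union> (nbrs E ?u \<inter> ?A)) \<union> (nbrs E ?u \<inter> P)" by (auto simp: fresh_def active_def)
    then have "card (nbrs E ?u) = card ((fresh P D \<union> (nbrs E ?u \<inter> ?A)) \<union> (nbrs E ?u \<inter> P))" by simp
    also have "\<dots> = card (fresh P D \<union> (nbrs E ?u \<inter> ?A)) + card (nbrs E ?u \<inter> P)"
      using fin_nbrs by (intro card_Un_disjoint) (auto simp: fresh_def active_def)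
    also have "card (fresh P D \<union> (nbrs E ?u \<inter> ?A)) = card (fresh P D) + card (nbrs E ?u \<inter> ?A)"
      using fin_nbrs by (intro card_Un_disjoint) (auto simp: fresh_def active_def)
    finally show ?thesis using reg u by simp
  qed
  let ?F = "\<Sum>w\<in>fresh P D. real (card (nbrs E w \<inter> P))"
  have e1: "expec (row d p) (\<lambda>r. real (loss (P, D) r)) = p * real (d - 1 - card (fresh P D))"
    unfolding loss_def using p by (simp add: expec_card_coins)
  have e2: "expec (row d p) (\<lambda>r. \<Sum>w\<in>new_vertices P D r. real (card (nbrs E w \<inter> P))) = p * ?F"
    unfolding sum_new_vertices using p dsum sum_nth_fresh[of "\<lambda>w. real (card (nbrs E w \<inter> P))" P D]
    by (subst expec_row_linear) auto
  have "expec (row d p) (\<lambda>r. real (loss (P, D) r) + p * potential (fst (explore_step V E (P, D) r)) (snd (explore_step V E (P, D) r)))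
    = expec (row d p) (\<lambda>r. real (loss (P, D) r) + p * ((potential P D - R + ?a) + (\<Sum>w\<in>new_vertices P D r. real (card (nbrs E w \<inter> P)))))"
    unfolding R_def by (intro expec_cong, subst potential_step[OF v lt]) auto
  also have "\<dots> = p * real (d - 1 - card (fresh P D)) + p * ((potential P D - R + ?a) + p * ?F)"
    by (simp add: expec_add e1 e2)
  also have "\<dots> \<le> p * (potential P D + step_cost p P D)"
  proof -
    have "real (d - 1 - card (fresh P D)) + (potential P D - R + ?a) + p * ?F \<le> potential P D + step_cost p P D"
    proof (cases "?A = {}")
      case True
      have "real (d - 1 - card (fresh P D)) \<le> ?k" using dsum True by auto
      then show ?thesis using root_few_processed_neighbours[OF v True half] True
        by (simp add: R_def step_cost_def)
    next
      case False
      then have "1 \<le> card (nbrs E ?u \<inter> P)"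
        using active_has_neighbour[OF v] next_vertex_active[OF v] by blast
      then have "real (d - 1 - card (fresh P D)) = ?a + ?k - 1" using dsum by auto
      then show ?thesis using False by (simp add: R_def step_cost_def)
    qed
    then have "p * (real (d - 1 - card (fresh P D)) + (potential P D - R + ?a) + p * ?F) \<le> p * (potential P D + step_cost p P D)"
      using p by (intro mult_left_mono)
    then show ?thesis by (simp only: distrib_left add.assoc)
  qed
  finally show ?thesis by (simp add: distrib_left)
qed

lemma expec_total_loss_potential:
  assumes "2 * m \<le> card V" "0 < card V" and p: "0 \<le> p" "p \<le> 1"
  shows "expec (rows m d p) (\<lambda>rs. real (total_loss rs) + p * potential (fst (explore V E rs)) (snd (explore V E rs)))
    \<le> (\<Sum>i<m. expec (rows i d p) (\<lambda>rs. p * step_cost p (fst (explore V E rs)) (snd (explore V E rs))))"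
  using assms(1)
proof (induction m)
  case 0
  then show ?case by (simp add: potential_def active_def)
next
  case (Suc m)
  let ?P = "\<lambda>rs. fst (explore V E rs)" and ?D = "\<lambda>rs. snd (explore V E rs)"
  have "expec (rows (Suc m) d p) (\<lambda>rs. real (total_loss rs) + p * potential (?P rs) (?D rs))
      = expec (rows m d p) (\<lambda>rs. real (total_loss rs) + expec (row d p) (\<lambda>r. real (loss (explore V E rs) r)
          + p * potential (fst (explore_step V E (explore V E rs) r)) (snd (explore_step V E (explore V E rs) r))))"
    unfolding expec_rows_snoc total_loss_snoc explore_snoc
    by (intro expec_cong) (simp add: expec_add)
  also have "\<dots> \<le> expec (rows m d p) (\<lambda>rs. real (total_loss rs) + (p * potential (?P rs) (?D rs) + p * step_cost p (?P rs) (?D rs)))"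
  proof (intro expec_mono add_left_mono)
    fix rs assume "rs \<in> set_pmf (rows m d p)"
    then have "length rs = m" by (rule length_rows)
    then have v: "valid (?P rs, ?D rs)" "card (?P rs) = m" using valid_explore[of rs] Suc.prems by auto
    show "expec (row d p) (\<lambda>r. real (loss (explore V E rs) r)
          + p * potential (fst (explore_step V E (explore V E rs) r)) (snd (explore_step V E (explore V E rs) r)))
        \<le> p * potential (?P rs) (?D rs) + p * step_cost p (?P rs) (?D rs)"
      using expec_loss_step[OF v(1) _ assms(2) p] v(2) Suc.prems by simp
  qed simp
  also have "\<dots> = expec (rows m d p) (\<lambda>rs. real (total_loss rs) + p * potential (?P rs) (?D rs))
      + expec (rows m d p) (\<lambda>rs. p * step_cost p (?P rs) (?D rs))"
    by (subst expec_add[symmetric]) (simp_all add: add.assoc)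
  also have "\<dots> \<le> (\<Sum>i<Suc m. expec (rows i d p) (\<lambda>rs. p * step_cost p (?P rs) (?D rs)))"
    using Suc by simp
  finally show ?case .
qed

lemma expec_total_loss:
  assumes "2 * m \<le> card V" "0 < card V" and p: "0 \<le> p" "p \<le> 1"
  shows "expec (rows m d p) (\<lambda>rs. real (total_loss rs))
    \<le> (\<Sum>i<m. expec (rows i d p) (\<lambda>rs. p * step_cost p (fst (explore V E rs)) (snd (explore V E rs))))"
proof -
  have "expec (rows m d p) (\<lambda>rs. real (total_loss rs))
      \<le> expec (rows m d p) (\<lambda>rs. real (total_loss rs) + p * potential (fst (explore V E rs)) (snd (explore V E rs)))"
  proof (rule expec_mono)
    fix rs assume "rs \<in> set_pmf (rows m d p)"
    then have "length rs = m" by (rule length_rows)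
    then have "valid (explore V E rs)" using valid_explore[of rs] assms by auto
    then show "real (total_loss rs) \<le> real (total_loss rs) + p * potential (fst (explore V E rs)) (snd (explore V E rs))"
      using potential_nonneg p by simp
  qed simp
  then show ?thesis using expec_total_loss_potential[OF assms] by linarith
qed

text \<open>The weights depend only on the history and multiply indicators of unrevealed pairs,
  which is the form in which switching applies.\<close>

lemma step_cost_eq:
  assumes "valid (P, D)" "card P < card V"
  shows "step_cost p P D = (\<Sum>w\<in>V - P. (if w \<in> \<Union>D then 2 else p * real (card (nbrs E w \<inter> P))) * of_bool ({next_vertex V E P D, w} \<in> E))
    + 2 * real d * real (card P) / real (card V)"
proof -
  let ?u = "next_vertex V E P D"
  have "(\<Sum>w\<in>V - P. (if w \<in> \<Union>D then 2 else p * real (card (nbrs E w \<inter> P))) * of_bool ({?u, w} \<in> E))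
     = (\<Sum>w\<in>nbrs E ?u - P. if w \<in> \<Union>D then 2 else p * real (card (nbrs E w \<inter> P)))"
    using finV nbrs_V[of ?u] by (intro sum.mono_neutral_cong_right) (auto simp: nbrs_def)
  also have "\<dots> = (\<Sum>w\<in>nbrs E ?u \<inter> active P D. 2) + (\<Sum>w\<in>fresh P D. p * real (card (nbrs E w \<inter> P)))"
  proof -
    have "(nbrs E ?u - P) \<inter> \<Union>D = nbrs E ?u \<inter> active P D" "(nbrs E ?u - P) \<inter> - \<Union>D = fresh P D"
      by (auto simp: active_def fresh_def)
    then show ?thesis using fin_nbrs[of ?u] by (simp only: sum.If_cases finite_Diff Collect_mem_eq)
  qed
  finally show ?thesis by (simp add: step_cost_def sum_distrib_left)
qed

end

lemma regular_graph_regular_graphs: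
  assumes "G \<in> regular_graphs n d"
  shows "regular_graph (vertices n) G d"
  using assms card_nbrs_regular[OF assms] by unfold_locales (auto simp: regular_graphs_def vertices_def)

text \<open>On the class of graphs with a common exploration history, the edges avoiding the processed
  vertices remain uniformly distributed, so the switching bound applies to each class.\<close>

lemma sum_edge_weight_le:
  fixes h :: "nat set set \<Rightarrow> nat \<Rightarrow> real" and n :: nat and rs :: "(nat \<Rightarrow> bool) list"
  defines "P \<equiv> \<lambda>G. fst (explore (vertices n) G rs)"
  assumes i: "8 * length rs \<le> n" "16 \<le> n"
    and h0: "\<And>G w. 0 \<le> h G w"
    and loc: "\<And>G G'. explore (vertices n) G' rs = explore (vertices n) G rs \<Longrightarrow>
      inc G' (P G) = inc G (P G) \<Longrightarrow> h G' = h G \<and> u G' = u G"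
    and u: "\<And>G. G \<in> regular_graphs n d \<Longrightarrow> u G \<in> vertices n - P G"
  shows "(\<Sum>G\<in>regular_graphs n d. \<Sum>w\<in>vertices n - P G. h G w * of_bool ({u G, w} \<in> G))
    \<le> (16 * real d / real n) * (\<Sum>G\<in>regular_graphs n d. \<Sum>w\<in>vertices n - P G. h G w)"
proof -
  let ?R = "regular_graphs n d" and ?V = "vertices n"
  have fR: "finite ?R" by (rule finite_regular_graphs)
  define \<kappa> where "\<kappa> G = (explore ?V G rs, inc G (P G))" for G
  have "(\<Sum>G | G \<in> ?R \<and> \<kappa> G = k. \<Sum>w\<in>?V - P G. h G w * of_bool ({u G, w} \<in> G))
      \<le> (16 * real d / real n) * (\<Sum>G | G \<in> ?R \<and> \<kappa> G = k. \<Sum>w\<in>?V - P G. h G w)"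
    if k: "k \<in> \<kappa> ` ?R" for k
  proof -
    obtain G0 where G0: "G0 \<in> ?R" "k = \<kappa> G0" using k by auto
    interpret regular_graph ?V G0 d by (rule regular_graph_regular_graphs[OF G0(1)])
    define P0 F where "P0 = P G0" and "F = inc G0 P0"
    let ?K = "{G \<in> ?R. inc G P0 = F}"
    have cV: "card ?V = n" by (simp add: vertices_def)
    have v: "P0 \<subseteq> ?V" "card P0 = length rs"
      using valid_explore[of rs] i cV by (auto simp: P0_def P_def valid_def)
    have same_explore: "explore ?V G rs = explore ?V G0 rs" if "inc G P0 = F" for G
      using that unfolding P0_def F_def P_def by (rule explore_local)
    have PG: "P G = P0" if "inc G P0 = F" for G
      using same_explore[OF that] unfolding P0_def P_def by simp
    \<comment> \<open>The processed set varies with the graph, but agreement with \<open>F\<close>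
      on \<open>P0\<close> already forces the whole history. Each class is thus a set to which the
      switching count applies.\<close>
    have "\<kappa> G = k \<longleftrightarrow> inc G P0 = F" for G
    proof
      assume "\<kappa> G = k"
      then have "explore ?V G rs = explore ?V G0 rs" "inc G (P G) = inc G0 (P G0)"
        unfolding G0(2) \<kappa>_def by simp_all
      then show "inc G P0 = F" unfolding F_def P0_def P_def by simp
    next
      assume F: "inc G P0 = F"
      then show "\<kappa> G = k"
        using same_explore[OF F] PG[OF F] unfolding G0(2) \<kappa>_def by (simp add: F_def P0_def)
    qed
    then have K: "{G. G \<in> ?R \<and> \<kappa> G = k} = ?K" by simp
    have same: "P G = P0 \<and> h G = h G0 \<and> u G = u G0" if "G \<in> ?K" for G
    proof -
      have F: "inc G P0 = F" using that by simp
      have "h G = h G0 \<and> u G = u G0"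
        by (rule loc[OF same_explore[OF F]]) (use F in \<open>simp add: F_def P0_def\<close>)
      then show ?thesis using PG[OF F] by simp
    qed
    have u0: "u G0 \<in> ?V" "u G0 \<notin> P0" using u[OF G0(1)] by (auto simp: P0_def)
    have "(\<Sum>G\<in>?K. \<Sum>w\<in>?V - P G. h G w * of_bool ({u G, w} \<in> G))
        = (\<Sum>G\<in>?K. \<Sum>w\<in>?V - P0. h G0 w * of_bool ({u G0, w} \<in> G))"
      using same by (intro sum.cong) auto
    also have "\<dots> = (\<Sum>w\<in>?V - P0. h G0 w * real (card {G \<in> ?R. inc G P0 = F \<and> {u G0, w} \<in> G}))"
    proof (subst sum.swap, rule sum.cong)
      fix w
      have "{G \<in> ?R. inc G P0 = F \<and> {u G0, w} \<in> G} = {G \<in> ?K. {u G0, w} \<in> G}" by auto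
      moreover have "(\<Sum>G\<in>?K. of_bool ({u G0, w} \<in> G)) = real (card {G \<in> ?K. {u G0, w} \<in> G})"
        by (rule sum_of_bool_card) (simp add: fR)
      ultimately show "(\<Sum>G\<in>?K. h G0 w * of_bool ({u G0, w} \<in> G)) = h G0 w * real (card {G \<in> ?R. inc G P0 = F \<and> {u G0, w} \<in> G})"
        by (simp only: sum_distrib_left[symmetric])
    qed simp
    also have "\<dots> \<le> (\<Sum>w\<in>?V - P0. h G0 w * ((16 * real d / real n) * real (card ?K)))"
    proof (intro sum_mono mult_left_mono h0)
      fix w assume w: "w \<in> ?V - P0"
      have "n * card {G \<in> ?R. inc G P0 = F \<and> {u G0, w} \<in> G} \<le> 16 * d * card ?K"
        using v u0 w i by (intro card_regular_graphs_edge) auto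
      then have "real (n * card {G \<in> ?R. inc G P0 = F \<and> {u G0, w} \<in> G}) \<le> real (16 * d * card ?K)"
        by (simp only: of_nat_le_iff)
      then show "real (card {G \<in> ?R. inc G P0 = F \<and> {u G0, w} \<in> G}) \<le> (16 * real d / real n) * real (card ?K)"
        using i by (simp add: field_simps)
    qed
    also have "\<dots> = (16 * real d / real n) * (\<Sum>G\<in>?K. \<Sum>w\<in>?V - P0. h G0 w)"
      by (subst sum_distrib_right[symmetric]) (simp add: mult_ac)
    also have "(\<Sum>G\<in>?K. \<Sum>w\<in>?V - P0. h G0 w) = (\<Sum>G\<in>?K. \<Sum>w\<in>?V - P G. h G w)"
      using same by (intro sum.cong) auto
    finally show ?thesis unfolding K .
  qed
  then have "(\<Sum>k\<in>\<kappa> ` ?R. \<Sum>G | G \<in> ?R \<and> \<kappa> G = k. \<Sum>w\<in>?V - P G. h G w * of_bool ({u G, w} \<in> G))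
      \<le> (\<Sum>k\<in>\<kappa> ` ?R. (16 * real d / real n) * (\<Sum>G | G \<in> ?R \<and> \<kappa> G = k. \<Sum>w\<in>?V - P G. h G w))"
    by (rule sum_mono)
  then show ?thesis
    unfolding sum.image_gen[OF fR, of _ \<kappa>, symmetric] sum_distrib_left[symmetric] .
qed

text \<open>The weights add up to at most twice the number of active vertices, hence twice the
  number of heads, plus \<open>p\<close> times the number of edges leaving the processed set.
  Switching supplies the factor \<open>16 * d / n\<close>.\<close>

lemma sum_step_cost_le:
  assumes i: "8 * length rs \<le> n" "16 \<le> n" and p: "0 \<le> p"
  shows "(\<Sum>G\<in>regular_graphs n d. regular_graph.step_cost (vertices n) G d p
        (fst (explore (vertices n) G rs)) (snd (explore (vertices n) G rs)))
    \<le> real (card (regular_graphs n d)) * ((16 * real d / real n) *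
        (2 * real (\<Sum>r\<leftarrow>rs. card {j. j < d \<and> r j}) + p * (real d * real (length rs)))
        + 2 * real d * real (length rs) / real n)"
proof -
  let ?R = "regular_graphs n d" and ?V = "vertices n"
  let ?P = "\<lambda>G. fst (explore ?V G rs)" and ?D = "\<lambda>G. snd (explore ?V G rs)"
  let ?u = "\<lambda>G. next_vertex ?V G (?P G) (?D G)"
  let ?h = "\<lambda>G w. if w \<in> \<Union>(?D G) then 2 else p * real (card (nbrs G w \<inter> ?P G))"
  let ?S = "real (\<Sum>r\<leftarrow>rs. card {j. j < d \<and> r j})"
  have cV: "card ?V = n" by (simp add: vertices_def)
  have v: "regular_graph.valid ?V G (?P G, ?D G)" "card (?P G) = length rs" "card (?P G) < card ?V"
    if "G \<in> ?R" for G
    using regular_graph.valid_explore[OF regular_graph_regular_graphs[OF that], of rs] i cV by auto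
  have "(\<Sum>G\<in>?R. regular_graph.step_cost ?V G d p (?P G) (?D G))
      = (\<Sum>G\<in>?R. (\<Sum>w\<in>?V - ?P G. ?h G w * of_bool ({?u G, w} \<in> G)) + 2 * real d * real (length rs) / real n)"
    by (intro sum.cong refl) (simp add: regular_graph.step_cost_eq[OF regular_graph_regular_graphs v(1,3)] v(2) cV)
  also have "\<dots> = (\<Sum>G\<in>?R. \<Sum>w\<in>?V - ?P G. ?h G w * of_bool ({?u G, w} \<in> G)) + real (card ?R) * (2 * real d * real (length rs) / real n)"
    by (simp add: sum.distrib)
  finally have 1: "(\<Sum>G\<in>?R. regular_graph.step_cost ?V G d p (?P G) (?D G)) = \<dots>" .
  have 2: "(\<Sum>G\<in>?R. \<Sum>w\<in>?V - ?P G. ?h G w * of_bool ({?u G, w} \<in> G))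
      \<le> (16 * real d / real n) * (\<Sum>G\<in>?R. \<Sum>w\<in>?V - ?P G. ?h G w)"
  proof (rule sum_edge_weight_le[OF i])
    show "?u G \<in> ?V - ?P G" if "G \<in> ?R" for G
      by (rule regular_graph.next_vertex_in[OF regular_graph_regular_graphs[OF that] v(1,3)[OF that]])
    fix G G' assume *: "explore ?V G' rs = explore ?V G rs" "inc G' (?P G) = inc G (?P G)"
    have "card (nbrs G' w \<inter> ?P G) = card (nbrs G w \<inter> ?P G)" for w
      using nbrs_inc[of G' w "?P G"] nbrs_inc[of G w "?P G"] *(2) by simp
    then show "?h G' = ?h G \<and> ?u G' = ?u G" using * next_vertex_local[OF *(2)] by (simp add: fun_eq_iff)
  qed (use p in auto)
  have 3: "(\<Sum>G\<in>?R. \<Sum>w\<in>?V - ?P G. ?h G w) \<le> (\<Sum>G\<in>?R. 2 * ?S + p * (real d * real (length rs)))"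
  proof (rule sum_mono)
    fix G assume G: "G \<in> ?R"
    interpret regular_graph ?V G d by (rule regular_graph_regular_graphs[OF G])
    note vG = v[OF G]
    have PV: "?P G \<subseteq> ?V" using vG by (simp add: valid_def)
    have fV: "finite (?V - ?P G)" using finV by simp
    have "(\<Sum>w\<in>?V - ?P G. ?h G w) \<le> (\<Sum>w\<in>?V - ?P G. 2 * of_bool (w \<in> \<Union>(?D G)) + p * real (card (nbrs G w \<inter> ?P G)))"
      using p by (intro sum_mono) auto
    also have "\<dots> = 2 * real (card (active (?P G) (?D G))) + p * real (\<Sum>w\<in>?V - ?P G. card (nbrs G w \<inter> ?P G))"
    proof -
      have "active (?P G) (?D G) = {w \<in> ?V - ?P G. w \<in> \<Union>(?D G)}"
        using valid_Union[OF vG(1)] by (auto simp: active_def)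
      then have "(\<Sum>w\<in>?V - ?P G. of_bool (w \<in> \<Union>(?D G))) = real (card (active (?P G) (?D G)))"
        using fV by (simp only: sum_of_bool_card)
      then show ?thesis by (simp only: sum.distrib sum_distrib_left[symmetric] of_nat_sum)
    qed
    also have "\<dots> \<le> 2 * ?S + p * (real d * real (length rs))"
    proof (intro add_mono mult_left_mono p)
      show "real (card (active (?P G) (?D G))) \<le> ?S"
        using num_active_le[of rs] i cV by (simp add: num_active_def)
      have "(\<Sum>w\<in>?V - ?P G. card (nbrs G w \<inter> ?P G)) \<le> d * length rs"
        using sum_nbrs_le[OF PV] vG(2) by simp
      then show "real (\<Sum>w\<in>?V - ?P G. card (nbrs G w \<inter> ?P G)) \<le> real d * real (length rs)"
        by (metis of_nat_le_iff of_nat_mult)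
    qed simp
    finally show "(\<Sum>w\<in>?V - ?P G. ?h G w) \<le> 2 * ?S + p * (real d * real (length rs))" .
  qed
  have "(\<Sum>G\<in>?R. 2 * ?S + p * (real d * real (length rs)))
      = real (card ?R) * (2 * ?S + p * (real d * real (length rs)))" by simp
  then have "(16 * real d / real n) * (\<Sum>G\<in>?R. \<Sum>w\<in>?V - ?P G. ?h G w)
      \<le> (16 * real d / real n) * (real (card ?R) * (2 * ?S + p * (real d * real (length rs))))"
    using 3 by (intro mult_left_mono) auto
  with 1 2 have "(\<Sum>G\<in>?R. regular_graph.step_cost ?V G d p (?P G) (?D G))
      \<le> (16 * real d / real n) * (real (card ?R) * (2 * ?S + p * (real d * real (length rs))))
        + real (card ?R) * (2 * real d * real (length rs) / real n)" by linarith
  also have "\<dots> = real (card ?R) * ((16 * real d / real n) * (2 * ?S + p * (real d * real (length rs)))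
        + 2 * real d * real (length rs) / real n)"
    by (simp only: distrib_left mult.left_commute[of _ "real (card ?R)"])
  finally show ?thesis .
qed

lemma expec_total_coins:
  assumes "0 \<le> p" "p \<le> 1"
  shows "expec (rows i d p) (\<lambda>rs. real (\<Sum>r\<leftarrow>rs. card {j. j < d \<and> r j})) = real i * (p * real d)"
proof (induction i)
  case (Suc i)
  have "expec (row d p) (\<lambda>r. real (card {j. j < d \<and> r j})) = p * real d"
    using expec_card_coins[OF assms, of d d 0] by simp
  then show ?case using Suc by (simp add: expec_rows_snoc expec_add algebra_simps)
qed simp

lemma sum_expec_total_loss:
  assumes m: "8 * m \<le> n" "16 \<le> n" and p: "0 \<le> p" "p \<le> 1" "p * real d \<le> 2"
  shows "(\<Sum>G\<in>regular_graphs n d. expec (rows m d p) (\<lambda>rs. real (regular_graph.total_loss (vertices n) G d rs)))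
    \<le> real (card (regular_graphs n d)) * (98 * (real m)\<^sup>2 / real n)"
proof -
  let ?R = "regular_graphs n d" and ?V = "vertices n"
  let ?c = "\<lambda>G rs. regular_graph.step_cost ?V G d p (fst (explore ?V G rs)) (snd (explore ?V G rs))"
  have cV: "card ?V = n" by (simp add: vertices_def)
  have "(\<Sum>G\<in>?R. expec (rows m d p) (\<lambda>rs. real (regular_graph.total_loss ?V G d rs)))
      \<le> (\<Sum>G\<in>?R. \<Sum>i<m. expec (rows i d p) (\<lambda>rs. p * ?c G rs))"
    using m p cV by (intro sum_mono regular_graph.expec_total_loss regular_graph_regular_graphs) auto
  \<comment> \<open>The law of the coins is the same for every graph, so the graphs can be summed
    first with the coins fixed.\<close>
  also have "\<dots> = (\<Sum>i<m. expec (rows i d p) (\<lambda>rs. p * (\<Sum>G\<in>?R. ?c G rs)))"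
    by (subst sum.swap) (simp add: expec_sum sum_distrib_left)
  also have "\<dots> \<le> (\<Sum>i<m. real (card ?R) * (196 * real i / real n))"
  proof (rule sum_mono)
    fix i assume i: "i \<in> {..<m}"
    let ?S = "\<lambda>rs. real (\<Sum>r\<leftarrow>rs. card {j. j < d \<and> r j})"
    have "expec (rows i d p) (\<lambda>rs. p * (\<Sum>G\<in>?R. ?c G rs))
        \<le> expec (rows i d p) (\<lambda>rs. p * (real (card ?R) * ((16 * real d / real n) *
            (2 * ?S rs + p * (real d * real i)) + 2 * real d * real i / real n)))"
    proof (intro expec_mono mult_left_mono p)
      fix rs assume "rs \<in> set_pmf (rows i d p)"
      then have "length rs = i" by (rule length_rows)
      then show "(\<Sum>G\<in>?R. ?c G rs) \<le> real (card ?R) * ((16 * real d / real n) *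
            (2 * ?S rs + p * (real d * real i)) + 2 * real d * real i / real n)"
        using sum_step_cost_le[of rs n p d] m i p by simp
    qed simp
    also have "\<dots> = p * (real (card ?R) * ((16 * real d / real n) *
            (2 * (real i * (p * real d)) + p * (real d * real i)) + 2 * real d * real i / real n))"
      using expec_total_coins[OF p(1,2), of i d] by (simp add: expec_add)
    \<comment> \<open>The 48 is three times the switching constant 16. With
      \<open>p * d <= 2\<close> the last product is at most 196, and summing over the steps turns
      this into \<open>98 * m\<^sup>2\<close>.\<close>
    also have "\<dots> = real (card ?R) * (real i / real n * ((p * real d) * (48 * (p * real d) + 2)))"
      by (simp add: algebra_simps add_divide_distrib)
    also have "\<dots> \<le> real (card ?R) * (real i / real n * (2 * (48 * 2 + 2)))"
      using p by (intro mult_left_mono mult_mono add_mono) auto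
    finally show "expec (rows i d p) (\<lambda>rs. p * (\<Sum>G\<in>?R. ?c G rs)) \<le> real (card ?R) * (196 * real i / real n)"
      by (simp add: mult.commute[of 196])
  qed
  also have "\<dots> = real (card ?R) * (196 * (\<Sum>i<m. real i) / real n)"
    by (simp add: sum_distrib_left sum_divide_distrib)
  also have "\<dots> \<le> real (card ?R) * (98 * (real m)\<^sup>2 / real n)"
  proof -
    have "2 * (\<Sum>i<m. real i) \<le> (real m)\<^sup>2"
      by (induction m) (auto simp: power2_eq_square algebra_simps)
    then show ?thesis by (intro mult_left_mono divide_right_mono) auto
  qed
  finally show ?thesis .
qed

section \<open>The random walk\<close>

lemma expec_rows_Cons:
  "expec (rows (Suc m) d p) f = expec (row d p) (\<lambda>r. expec (rows m d p) (\<lambda>rs. f (r # rs)))"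
proof -
  have "rows (Suc m) d p = bind_pmf (row d p) (\<lambda>r. bind_pmf (rows m d p) (\<lambda>rs. return_pmf (r # rs)))"
    by (simp add: rows_def)
  then show ?thesis by (simp add: expec_bind)
qed

definition mgf :: "nat \<Rightarrow> real \<Rightarrow> real \<Rightarrow> real" where
  "mgf N p x = exp (- x) * (1 + p * (exp x - 1)) ^ N"

lemma expec_exp_increment:
  assumes "N \<le> d" "0 \<le> p" "p \<le> 1"
  shows "expec (row d p) (\<lambda>r. exp (x * real_of_int (increment N r))) = mgf N p x"
proof -
  let ?f = "\<lambda>j b. if j < N \<and> b then exp x else (1::real)"
  have "exp (x * real_of_int (increment N r)) = exp (- x) * (\<Prod>j<d. ?f j (r j))" for r
  proof -
    have "{..<d} \<inter> {j. j < N \<and> r j} = {j. j < N \<and> r j}" using assms(1) by auto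
    then have "(\<Prod>j<d. ?f j (r j)) = exp x ^ card {j. j < N \<and> r j}"
      by (simp add: prod.If_cases)
    then show ?thesis
      by (simp add: increment_def exp_of_nat_mult[symmetric] mult_exp_exp algebra_simps)
  qed
  then have "expec (row d p) (\<lambda>r. exp (x * real_of_int (increment N r))) = exp (- x) * expec (row d p) (\<lambda>r. \<Prod>j<d. ?f j (r j))"
    by simp
  also have "expec (row d p) (\<lambda>r. \<Prod>j<d. ?f j (r j)) = (\<Prod>j<d. expec (bernoulli_pmf p) (?f j))"
    unfolding row_def by (intro expectation_prod_Pi_pmf integrable_measure_pmf_finite) auto
  also have "\<dots> = (\<Prod>j<d. if j < N then 1 + p * (exp x - 1) else 1)"
    using assms by (intro prod.cong) (auto simp: expec_bernoulli algebra_simps)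
  also have "\<dots> = (1 + p * (exp x - 1)) ^ N"
  proof -
    have "{..<d} \<inter> {j. j < N} = {..<N}" using assms(1) by auto
    then show ?thesis by (simp add: prod.If_cases)
  qed
  finally show ?thesis by (simp add: mgf_def)
qed

lemma walk_Cons: "walk N (r # rs) = increment N r + walk N rs"
  by (simp add: walk_def)

lemma expec_exp_walk:
  assumes "N \<le> d" "0 \<le> p" "p \<le> 1"
  shows "expec (rows m d p) (\<lambda>rs. exp (x * real_of_int (walk N rs))) = mgf N p x ^ m"
proof (induction m)
  case (Suc m)
  have "expec (rows (Suc m) d p) (\<lambda>rs. exp (x * real_of_int (walk N rs)))
      = expec (row d p) (\<lambda>r. exp (x * real_of_int (increment N r)) * expec (rows m d p) (\<lambda>rs. exp (x * real_of_int (walk N rs))))"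
    unfolding expec_rows_Cons walk_Cons by (simp add: distrib_left exp_add)
  then show ?case using Suc expec_exp_increment[OF assms] by simp
qed simp

text \<open>A maximal inequality for an exponential supermartingale, proved by conditioning on the
  first row. The assumption \<open>1 <= \<psi>\<close> covers the case in which the barrier has
  already been reached.\<close>

lemma prob_walk_hits_le:
  assumes N: "N \<le> d" and p: "0 \<le> p" "p \<le> 1" and x: "0 \<le> x" and psi: "mgf N p (- x) \<le> \<psi>" "1 \<le> \<psi>"
  shows "measure_pmf.prob (rows m d p) {rs. \<exists>t\<le>m. real_of_int (walk N (take t rs)) \<le> - a} \<le> exp (- x * a) * \<psi> ^ m"
proof (induction m arbitrary: a)
  case 0
  show ?case
  proof (cases "0 \<le> - a")
    case True
    then have "1 \<le> exp (- x * a)" using x by (simp add: mult_nonneg_nonpos)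
    then show ?thesis using measure_pmf.prob_le_1 order_trans by fastforce
  qed (simp add: measure_return)
next
  case (Suc m)
  show ?case
  proof (cases "a \<le> 0")
    case True
    then have "1 \<le> exp (- x * a)" using x by (simp add: mult_nonneg_nonpos)
    moreover have "1 \<le> \<psi> ^ Suc m" using psi(2) by (rule one_le_power)
    ultimately have "1 \<le> exp (- x * a) * \<psi> ^ Suc m" using mult_mono[of 1 "exp (- x * a)" 1 "\<psi> ^ Suc m"] by simp
    then show ?thesis using measure_pmf.prob_le_1 order_trans by blast
  next
    case False
    let ?H = "\<lambda>m a. {rs. \<exists>t\<le>m. real_of_int (walk N (take t rs)) \<le> - a}"
    have step: "r # rs \<in> ?H (Suc m) a \<Longrightarrow> rs \<in> ?H m (a + real_of_int (increment N r))" for r rs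
    proof -
      assume "r # rs \<in> ?H (Suc m) a"
      then obtain t where t: "t \<le> Suc m" "real_of_int (walk N (take t (r # rs))) \<le> - a" by blast
      show ?thesis
      proof (cases t)
        case 0
        then show ?thesis using t False by simp
      next
        case (Suc t')
        then have "real_of_int (walk N (take t' rs)) \<le> - (a + real_of_int (increment N r))" "t' \<le> m"
          using t by (simp_all add: walk_Cons)
        then show ?thesis by blast
      qed
    qed
    have "measure_pmf.prob (rows (Suc m) d p) (?H (Suc m) a)
        = expec (row d p) (\<lambda>r. expec (rows m d p) (\<lambda>rs. indicator (?H (Suc m) a) (r # rs)))"
      unfolding prob_eq_expec expec_rows_Cons ..
    also have "\<dots> \<le> expec (row d p) (\<lambda>r. expec (rows m d p) (indicator (?H m (a + real_of_int (increment N r)))))"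
      using step by (intro expec_mono) (auto simp: indicator_def)
    also have "\<dots> = expec (row d p) (\<lambda>r. measure_pmf.prob (rows m d p) (?H m (a + real_of_int (increment N r))))"
      by simp
    also have "\<dots> \<le> expec (row d p) (\<lambda>r. exp (- x * (a + real_of_int (increment N r))) * \<psi> ^ m)"
      by (intro expec_mono Suc.IH) simp
    also have "\<dots> = expec (row d p) (\<lambda>r. exp (- x * real_of_int (increment N r)) * (exp (- x * a) * \<psi> ^ m))"
      by (intro expec_cong) (simp only: distrib_left exp_add mult_ac)
    also have "\<dots> = mgf N p (- x) * (exp (- x * a) * \<psi> ^ m)"
      using expec_exp_increment[OF N p, of "- x"] by simp
    also have "\<dots> \<le> \<psi> * (exp (- x * a) * \<psi> ^ m)"
      using psi by (intro mult_right_mono) auto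
    finally show ?thesis by (simp add: mult_ac)
  qed
qed

section \<open>Exponential moments of a near-critical step\<close>

lemma exp_le_quadratic:
  fixes x :: real
  assumes "\<bar>x\<bar> \<le> 1"
  shows "exp x \<le> 1 + x + x\<^sup>2"
proof (cases "0 \<le> x")
  case True
  then show ?thesis using assms exp_bound by auto
next
  case False
  have "1 - x \<le> exp (- x)" using exp_ge_add_one_self[of "- x"] by simp
  then have "exp x * (1 - x) \<le> 1"
    using mult_left_mono[of "1 - x" "exp (- x)" "exp x"] by (simp add: mult_exp_exp)
  also have "1 \<le> (1 + x + x\<^sup>2) * (1 - x)"
  proof -
    have "(1 + x + x\<^sup>2) * (1 - x) = 1 - x ^ 3" by (simp add: algebra_simps power2_eq_square power3_eq_cube)
    moreover have "x ^ 3 \<le> 0" using False by (simp add: power_le_zero_eq)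
    ultimately show ?thesis by simp
  qed
  finally show ?thesis using False by (simp add: mult_le_cancel_right)
qed

lemma mgf_le:
  assumes N: "1 \<le> N" and p: "p = (1 + e) / real N" "0 \<le> p" "p \<le> 1" and e: "\<bar>e\<bar> \<le> 1" and x: "\<bar>x\<bar> \<le> 1"
  shows "mgf N p x \<le> exp (\<bar>e\<bar> * \<bar>x\<bar> + 2 * x\<^sup>2)"
proof -
  let ?y = "p * (exp x - 1)"
  have Np: "real N * p = 1 + e" using N p by simp
  have "0 \<le> 1 - p + p * exp x" using p(2,3) by (intro add_nonneg_nonneg mult_nonneg_nonneg) auto
  then have "0 \<le> 1 + ?y" by (simp add: algebra_simps)
  then have "(1 + ?y) ^ N \<le> exp ?y ^ N" by (intro power_mono exp_ge_add_one_self)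
  also have "\<dots> = exp (real N * ?y)" by (simp add: exp_of_nat_mult)
  also have "real N * ?y = (1 + e) * (exp x - 1)" using Np by (simp add: mult.assoc[symmetric])
  finally have "mgf N p x \<le> exp (- x) * exp ((1 + e) * (exp x - 1))"
    unfolding mgf_def by (intro mult_left_mono) auto
  also have "\<dots> = exp (- x + (1 + e) * (exp x - 1))" by (simp add: mult_exp_exp)
  also have "\<dots> \<le> exp (\<bar>e\<bar> * \<bar>x\<bar> + 2 * x\<^sup>2)"
  proof -
    have "(1 + e) * (exp x - 1) \<le> (1 + e) * (x + x\<^sup>2)"
      using exp_le_quadratic[OF x] e by (intro mult_left_mono) auto
    also have "\<dots> = x + e * x + (1 + e) * x\<^sup>2" by (simp add: algebra_simps)
    also have "\<dots> \<le> x + \<bar>e\<bar> * \<bar>x\<bar> + 2 * x\<^sup>2"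
      using e abs_ge_self[of "e * x"] by (intro add_mono mult_right_mono) (auto simp: abs_mult)
    finally show ?thesis by simp
  qed
  finally show ?thesis .
qed

lemma ln_one_plus_ge:
  fixes y :: real
  assumes "0 \<le> y"
  shows "y - y\<^sup>2 / 2 \<le> ln (1 + y)"
proof -
  have "(\<lambda>y. ln (1 + y) - y + y\<^sup>2 / 2) 0 \<le> (\<lambda>y. ln (1 + y) - y + y\<^sup>2 / 2) y"
  proof (rule DERIV_nonneg_imp_nondecreasing[OF assms])
    fix z :: real assume z: "0 \<le> z" "z \<le> y"
    have "((\<lambda>y. ln (1 + y) - y + y\<^sup>2 / 2) has_real_derivative (1 / (1 + z) - 1 + z)) (at z)"
      using z by (auto intro!: derivative_eq_intros simp: field_simps)
    moreover have "1 / (1 + z) - 1 + z = z\<^sup>2 / (1 + z)"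
      using z by (simp add: field_simps power2_eq_square)
    ultimately show "\<exists>D. ((\<lambda>y. ln (1 + y) - y + y\<^sup>2 / 2) has_real_derivative D) (at z) \<and> 0 \<le> D"
      using z by auto
  qed
  then show ?thesis by simp
qed

lemma near_critical:
  fixes p e :: real
  assumes "2 \<le> N" "p = (1 + e) / real N" "\<bar>e\<bar> \<le> 1/10"
  shows "0 \<le> p" "p \<le> 11/20"
proof -
  have "(1 + e) / real N \<le> (11/10) / 2" using assms by (intro frac_le) auto
  then show "p \<le> 11/20" using assms(2) by simp
  show "0 \<le> p" unfolding assms(2) using assms(3) by simp
qed

text \<open>The exponential gives \<open>x\<^sup>2 / 2\<close>, and concavity of the logarithm takes
  away \<open>p * z\<^sup>2 / 2\<close>. Since \<open>2 <= N\<close> forces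
  \<open>p <= 11/20\<close>, this is at most \<open>1331/4000 * x\<^sup>2\<close>, just under a
  third, and \<open>x\<^sup>2 / 6\<close> is left.\<close>

lemma mgf_ge:
  assumes N: "2 \<le> N" and p: "p = (1 + e) / real N" and e: "\<bar>e\<bar> \<le> 1/10" and x: "0 \<le> x" "x \<le> 1/10"
  shows "exp (x\<^sup>2 / 6 - 2 * \<bar>e\<bar> * x) \<le> mgf N p x"
proof -
  define z where "z = exp x - 1"
  let ?y = "p * z"
  have Np: "real N * p = 1 + e" using N p by simp
  note p0 = near_critical(1)[OF N p e] and p1 = near_critical(2)[OF N p e]
  have z_ge: "x + x\<^sup>2 / 2 \<le> z" using exp_lower_Taylor_quadratic[OF x(1)] by (simp add: z_def)
  have "x\<^sup>2 \<le> 1/10 * x" using mult_right_mono[OF x(2,1)] by (simp add: power2_eq_square)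
  then have z_le: "z \<le> 11/10 * x" using exp_le_quadratic[of x] x by (simp add: z_def)
  have z0: "0 \<le> z" using x by (simp add: z_def)
  define w where "w = z - p * z\<^sup>2 / 2"
  have "p * z\<^sup>2 \<le> 11/20 * (11/10 * x)\<^sup>2"
    using p0 p1 z0 z_le by (intro mult_mono power_mono) auto
  then have "p * z\<^sup>2 \<le> 1331/2000 * x\<^sup>2" by (simp add: power_mult_distrib power_divide)
  then have w_ge: "x + x\<^sup>2 / 6 \<le> w" using z_ge zero_le_power2[of x] unfolding w_def by linarith
  have "0 \<le> p * z\<^sup>2" using p0 by simp
  then have w_le: "w \<le> 2 * x" using z_le x unfolding w_def by linarith
  have w0: "0 \<le> w" using w_ge x(1) zero_le_power2[of x] by linarith
  have "- \<bar>e\<bar> * (2 * x) \<le> - \<bar>e\<bar> * w" using w_le by (intro mult_left_mono_neg) auto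
  also have "\<dots> \<le> e * w" using w0 by (intro mult_right_mono) auto
  finally have ew: "- (2 * \<bar>e\<bar> * x) \<le> e * w" by (simp add: mult_ac)
  have "exp (x\<^sup>2 / 6 - 2 * \<bar>e\<bar> * x) \<le> exp (- x + (1 + e) * w)"
    using w_ge ew by (simp add: distrib_right)
  also have "(1 + e) * w = real N * (?y - ?y\<^sup>2 / 2)"
    unfolding Np[symmetric] w_def by (simp add: power2_eq_square algebra_simps)
  also have "exp (- x + real N * (?y - ?y\<^sup>2 / 2)) \<le> exp (- x + real N * ln (1 + ?y))"
    using ln_one_plus_ge[of ?y] p0 z0 by (simp add: mult_left_mono)
  also have "\<dots> = mgf N p x"
  proof -
    have "0 < 1 + ?y" using p0 z0 by (simp add: add_pos_nonneg)
    then have "exp (ln (1 + ?y)) = 1 + ?y" by (rule exp_ln)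
    then show ?thesis by (simp only: exp_add exp_of_nat_mult mgf_def z_def)
  qed
  finally show ?thesis .
qed

text \<open>The quadratic \<open>b y - b\<^sup>2 y\<^sup>2 / 4\<close> with \<open>y = f x - t\<close> is at most \<open>1\<close>, and at most \<open>0\<close> where \<open>f x \<le> t\<close>.\<close>

lemma prob_ge_second_moment:
  assumes fin: "finite (set_pmf M)" and f0: "\<And>x. 0 \<le> f x" and t: "0 \<le> t"
    and m1: "0 \<le> m1" "m1 + t \<le> expec M f" and m2: "0 < m2" "expec M (\<lambda>x. (f x)\<^sup>2) + t\<^sup>2 \<le> m2"
  shows "m1\<^sup>2 / m2 \<le> measure_pmf.prob M {x. t \<le> f x}"
proof -
  \<comment> \<open>The maximiser of \<open>b * m1 - b\<^sup>2 / 4 * m2\<close>.\<close>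
  define b where "b = 2 * m1 / m2"
  have b0: "0 \<le> b" using m1 m2 by (simp add: b_def)
  have pt: "b * (f x - t) - b\<^sup>2 / 4 * ((f x)\<^sup>2 + t\<^sup>2) \<le> indicator {x. t \<le> f x} x" for x
  proof -
    have "(f x - t)\<^sup>2 \<le> (f x)\<^sup>2 + t\<^sup>2" using f0[of x] t by (simp add: power2_eq_square algebra_simps)
    then have "b\<^sup>2 / 4 * (f x - t)\<^sup>2 \<le> b\<^sup>2 / 4 * ((f x)\<^sup>2 + t\<^sup>2)" by (intro mult_left_mono) auto
    moreover have "z - z\<^sup>2 / 4 \<le> 1" for z :: real
      using zero_le_power2[of "1 - z / 2"] by (simp add: power2_eq_square algebra_simps)
    from this[of "b * (f x - t)"] have "b * (f x - t) - b\<^sup>2 / 4 * (f x - t)\<^sup>2 \<le> 1"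
      by (simp add: power_mult_distrib)
    moreover have "0 \<le> b\<^sup>2 / 4 * ((f x)\<^sup>2 + t\<^sup>2)" by simp
    moreover have "f x < t \<Longrightarrow> b * (f x - t) \<le> 0" using b0 by (simp add: mult_nonneg_nonpos)
    ultimately have "b * (f x - t) - b\<^sup>2 / 4 * ((f x)\<^sup>2 + t\<^sup>2) \<le> 1"
      "f x < t \<Longrightarrow> b * (f x - t) - b\<^sup>2 / 4 * ((f x)\<^sup>2 + t\<^sup>2) \<le> 0" by linarith+
    then show ?thesis by (cases "t \<le> f x") (simp_all only: indicator_simps mem_Collect_eq not_le not_False_eq_True)
  qed
  have "m1\<^sup>2 / m2 = b * m1 - b\<^sup>2 / 4 * m2"
    using m2(1) by (simp add: b_def power2_eq_square field_simps)
  also have "\<dots> \<le> b * (expec M f - t) - b\<^sup>2 / 4 * (expec M (\<lambda>x. (f x)\<^sup>2) + t\<^sup>2)"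
    using m1 m2 b0 by (intro diff_mono mult_left_mono) auto
  also have "\<dots> = expec M (\<lambda>x. b * (f x - t) - b\<^sup>2 / 4 * ((f x)\<^sup>2 + t\<^sup>2))"
    using fin by (simp add: expec_diff expec_add)
  also have "\<dots> \<le> measure_pmf.prob M {x. t \<le> f x}"
    unfolding prob_eq_expec using pt by (intro expec_mono fin)
  finally show ?thesis .
qed

section \<open>Rises and drops of the walk at scale \<open>sqrt L\<close>\<close>

lemma inverse_sqrt_facts:
  fixes s l :: real
  assumes "10 \<le> s" "s * s = l"
  shows "0 < 1 / s" "1 / s \<le> 1/10" "l * (1 / s) = s" "l * (1 / s)\<^sup>2 = 1" "(1 / s) * s = 1"
  using assms by (auto simp: power2_eq_square)

text \<open>The ratio \<open>m1\<^sup>2 / m2\<close> of the second-moment bound for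
  \<open>m1 = exp 5\<close> and \<open>m2 = exp 385 + exp 10\<close>, an absolute constant.\<close>

definition rise_prob :: real where
  "rise_prob = exp 10 / (exp 385 + exp 10)"

lemma rise_prob_pos: "0 < rise_prob" "rise_prob \<le> 1"
  by (auto simp: rise_prob_def add_pos_pos)

text \<open>The second-moment bound is applied to the exponential of \<open>x\<close> times the
  walk, whose moments are exact powers of \<open>mgf\<close>. With \<open>x = 1 / sqrt L\<close> and
  \<open>48 * L\<close> steps, the factor 1/6 in \<open>mgf_ge\<close> gives an exponent 8 before
  drift, so the mean is at least \<open>exp 6\<close>. That is at least twice the threshold
  \<open>exp 5\<close>, which means height \<open>5 * sqrt L\<close>. The second moment has exponent
  384 plus a drift below 1.\<close>

lemma prob_walk_rises:
  assumes N: "2 \<le> N" "N \<le> d" and p: "p = (1 + e) / real N" and L: "100 \<le> L" and e: "\<bar>e\<bar> * sqrt (real L) \<le> 1/100"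
  shows "rise_prob \<le> measure_pmf.prob (rows (48 * L) d p) {rs. 5 * sqrt (real L) \<le> real_of_int (walk N rs)}"
proof -
  let ?s = "sqrt (real L)"
  have s: "10 \<le> ?s" using L by (intro real_le_rsqrt) auto
  have ss: "?s * ?s = real L" by simp
  have e1: "\<bar>e\<bar> \<le> 1/10" using e mult_left_mono[OF s, of "\<bar>e\<bar>"] by simp
  have p01: "0 \<le> p" "p \<le> 1" using near_critical[OF N(1) p e1] by auto
  define x where "x = 1 / ?s"
  note x = inverse_sqrt_facts(1,2)[OF s ss, folded x_def]
  note xL = inverse_sqrt_facts(3,4)[OF s ss, folded x_def]
  let ?f = "\<lambda>rs. exp (x * real_of_int (walk N rs))"
  have "exp (real (48 * L) * (x\<^sup>2 / 6 - 2 * \<bar>e\<bar> * x)) \<le> mgf N p x ^ (48 * L)"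
    unfolding exp_of_nat_mult using N p e1 x by (intro power_mono mgf_ge) auto
  moreover have "real (48 * L) * (x\<^sup>2 / 6 - 2 * \<bar>e\<bar> * x) = 8 * (real L * x\<^sup>2) - 96 * (\<bar>e\<bar> * (real L * x))"
    by (simp add: algebra_simps)
  ultimately have "exp (8 - 96 * (\<bar>e\<bar> * ?s)) \<le> mgf N p x ^ (48 * L)" using xL by simp
  moreover have "exp 6 \<le> exp (8 - 96 * (\<bar>e\<bar> * ?s))" using e by simp
  moreover have "exp 5 + exp 5 \<le> (exp 6 :: real)"
  proof -
    have "exp 5 * 2 \<le> exp 5 * (exp 1 :: real)" using exp_ge_add_one_self[of 1] by (intro mult_left_mono) auto
    then show ?thesis by (simp add: mult_exp_exp)
  qed
  ultimately have m1: "exp 5 + exp 5 \<le> expec (rows (48 * L) d p) ?f"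
    unfolding expec_exp_walk[OF N(2) p01] by linarith
  have "mgf N p (2 * x) ^ (48 * L) \<le> exp (\<bar>e\<bar> * \<bar>2 * x\<bar> + 2 * (2 * x)\<^sup>2) ^ (48 * L)"
    using N p p01 e1 x by (intro power_mono mgf_le) (auto simp: mgf_def intro!: mult_nonneg_nonneg zero_le_power add_nonneg_nonneg)
  also have "\<dots> = exp (real (48 * L) * (\<bar>e\<bar> * \<bar>2 * x\<bar> + 2 * (2 * x)\<^sup>2))" by (simp only: exp_of_nat_mult)
  also have "real (48 * L) * (\<bar>e\<bar> * \<bar>2 * x\<bar> + 2 * (2 * x)\<^sup>2) = 96 * (\<bar>e\<bar> * (real L * x)) + 384 * (real L * x\<^sup>2)"
    using x by (simp add: algebra_simps power2_eq_square)
  also have "exp \<dots> \<le> exp 385" using e xL by simp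
  finally have m2: "mgf N p (2 * x) ^ (48 * L) \<le> exp 385" .
  have sq: "(?f rs)\<^sup>2 = exp (2 * x * real_of_int (walk N rs))" for rs
    by (simp add: power2_eq_square mult_exp_exp)
  have "(exp 5)\<^sup>2 / (exp 385 + exp 10) \<le> measure_pmf.prob (rows (48 * L) d p) {rs. exp 5 \<le> ?f rs}"
  proof (rule prob_ge_second_moment)
    show "expec (rows (48 * L) d p) (\<lambda>rs. (?f rs)\<^sup>2) + (exp 5)\<^sup>2 \<le> exp 385 + exp 10"
      unfolding sq using expec_exp_walk[OF N(2) p01, of "48 * L" "2 * x"] m2
      by (simp add: power2_eq_square mult_exp_exp)
  qed (use m1 in \<open>auto simp: add_pos_pos\<close>)
  moreover have "(exp 5)\<^sup>2 = (exp 10 :: real)" by (simp add: power2_eq_square mult_exp_exp)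
  moreover have "exp 5 \<le> ?f rs \<longleftrightarrow> 5 * ?s \<le> real_of_int (walk N rs)" for rs
    using L by (simp add: x_def pos_le_divide_eq mult.commute)
  ultimately show ?thesis by (simp only: rise_prob_def)
qed

text \<open>The maximal inequality with \<open>x = 1 / sqrt L\<close> has exponent
  \<open>- 4 + 2\<close> plus a drift of at most 1/100, hence at most \<open>- 1\<close>.\<close>

lemma prob_walk_drops:
  assumes N: "2 \<le> N" "N \<le> d" and p: "p = (1 + e) / real N" and L: "100 \<le> L" and e: "\<bar>e\<bar> * sqrt (real L) \<le> 1/100"
  shows "measure_pmf.prob (rows L d p) {rs. \<exists>t\<le>L. real_of_int (walk N (take t rs)) \<le> - (4 * sqrt (real L))} \<le> 1/2"
proof -
  let ?s = "sqrt (real L)"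
  have s: "10 \<le> ?s" using L by (intro real_le_rsqrt) auto
  have ss: "?s * ?s = real L" by simp
  have e1: "\<bar>e\<bar> \<le> 1/10" using e mult_left_mono[OF s, of "\<bar>e\<bar>"] by simp
  have p01: "0 \<le> p" "p \<le> 1" using near_critical[OF N(1) p e1] by auto
  define x where "x = 1 / ?s"
  note x = inverse_sqrt_facts(1,2)[OF s ss, folded x_def]
  note xL = inverse_sqrt_facts(3-5)[OF s ss, folded x_def]
  have "measure_pmf.prob (rows L d p) {rs. \<exists>t\<le>L. real_of_int (walk N (take t rs)) \<le> - (4 * ?s)}
      \<le> exp (- x * (4 * ?s)) * exp (\<bar>e\<bar> * \<bar>x\<bar> + 2 * x\<^sup>2) ^ L"
  proof (rule prob_walk_hits_le[OF N(2) p01])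
    show "mgf N p (- x) \<le> exp (\<bar>e\<bar> * \<bar>x\<bar> + 2 * x\<^sup>2)"
      using mgf_le[OF _ p p01, of "- x"] N e1 x by simp
  qed (use x in auto)
  also have "\<dots> = exp (- x * (4 * ?s) + real L * (\<bar>e\<bar> * \<bar>x\<bar> + 2 * x\<^sup>2))"
    by (simp only: exp_of_nat_mult exp_add)
  also have "- x * (4 * ?s) + real L * (\<bar>e\<bar> * \<bar>x\<bar> + 2 * x\<^sup>2) = - 4 * (x * ?s) + \<bar>e\<bar> * (real L * x) + 2 * (real L * x\<^sup>2)"
    using x by (simp add: algebra_simps)
  also have "exp \<dots> \<le> exp (- 1)" unfolding xL using e by simp
  also have "\<dots> \<le> 1/2" using exp_ge_add_one_self[of 1] by (simp add: exp_minus field_simps)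
  finally show ?thesis .
qed

definition good_block :: "nat \<Rightarrow> nat \<Rightarrow> (nat \<Rightarrow> bool) list \<Rightarrow> bool" where
  "good_block N L rs \<longleftrightarrow> 5 * sqrt (real L) \<le> real_of_int (walk N (take (48 * L) rs)) \<and>
     (\<forall>t\<le>L. - (4 * sqrt (real L)) < real_of_int (walk N (take t (drop (48 * L) rs))))"

lemma prob_good_block:
  assumes N: "2 \<le> N" "N \<le> d" and p: "p = (1 + e) / real N" and L: "100 \<le> L" and e: "\<bar>e\<bar> * sqrt (real L) \<le> 1/100"
  shows "measure_pmf.prob (rows (49 * L) d p) {rs. \<not> good_block N L rs} \<le> 1 - rise_prob / 2"
proof -
  let ?A = "{xs. 5 * sqrt (real L) \<le> real_of_int (walk N xs)}"
  let ?B = "{rs. \<exists>t\<le>L. real_of_int (walk N (take t rs)) \<le> - (4 * sqrt (real L))}"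
  let ?pA = "measure_pmf.prob (rows (48 * L) d p) ?A" and ?pB = "measure_pmf.prob (rows L d p) ?B"
  have "measure_pmf.prob (rows (49 * L) d p) {rs. \<not> good_block N L rs}
      = expec (rows (48 * L) d p) (\<lambda>xs. expec (rows L d p) (\<lambda>ys. indicator {rs. \<not> good_block N L rs} (xs @ ys)))"
  proof -
    have "49 * L = 48 * L + L" by simp
    then show ?thesis by (simp only: prob_eq_expec expec_rows_add)
  qed
  also have "\<dots> = expec (rows (48 * L) d p) (\<lambda>xs. expec (rows L d p) (\<lambda>ys. 1 - indicator ?A xs * (1 - indicator ?B ys)))"
  proof (intro expec_cong)
    fix xs ys assume "xs \<in> set_pmf (rows (48 * L) d p)"
    then have "length xs = 48 * L" by (rule length_rows)
    then have "good_block N L (xs @ ys) \<longleftrightarrow> xs \<in> ?A \<and> ys \<notin> ?B"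
      unfolding good_block_def by auto
    then show "indicator {rs. \<not> good_block N L rs} (xs @ ys) = (1 - indicator ?A xs * (1 - indicator ?B ys) :: real)"
      by (simp add: indicator_def)
  qed
  also have "\<dots> = 1 - ?pA * (1 - ?pB)"
    by (simp add: expec_diff)
  also have "\<dots> \<le> 1 - rise_prob / 2"
    using mult_mono[OF prob_walk_rises[OF assms], of "1/2" "1 - ?pB"] prob_walk_drops[OF assms] by simp
  finally show ?thesis .
qed

text \<open>Disjoint blocks use independent rows, and whether a block is good depends only on its
  own increments.\<close>

lemma prob_no_good_block:
  assumes N: "2 \<le> N" "N \<le> d" and p: "p = (1 + e) / real N" and L: "100 \<le> L" and e: "\<bar>e\<bar> * sqrt (real L) \<le> 1/100"
  shows "measure_pmf.prob (rows (M * (49 * L)) d p)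
    {rs. \<forall>i<M. \<not> good_block N L (take (49 * L) (drop (i * (49 * L)) rs))} \<le> (1 - rise_prob / 2) ^ M"
proof (induction M)
  case (Suc M)
  let ?q = "1 - rise_prob / 2" and ?B = "49 * L"
  let ?S = "\<lambda>M. {rs. \<forall>i<M. \<not> good_block N L (take ?B (drop (i * ?B) rs))}"
  have q: "0 \<le> ?q" using rise_prob_pos by simp
  have "indicator (?S (Suc M)) (xs @ ys) \<le> (indicator {rs. \<not> good_block N L rs} xs * indicator (?S M) ys :: real)"
    if "length xs = ?B" for xs ys
  proof -
    have "\<not> good_block N L xs" if "xs @ ys \<in> ?S (Suc M)"
      using that \<open>length xs = ?B\<close> by (auto dest!: spec[of _ 0])
    moreover have "ys \<in> ?S M" if "xs @ ys \<in> ?S (Suc M)"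
    proof clarify
      fix i assume i: "i < M" "good_block N L (take ?B (drop (i * ?B) ys))"
      have "drop (Suc i * ?B) (xs @ ys) = drop (i * ?B) ys" using \<open>length xs = ?B\<close> by simp
      moreover have "\<not> good_block N L (take ?B (drop (Suc i * ?B) (xs @ ys)))" using that i(1) by blast
      ultimately show False using i(2) by simp
    qed
    ultimately show ?thesis by (auto simp: indicator_def)
  qed
  then have "measure_pmf.prob (rows (?B + M * ?B) d p) (?S (Suc M))
      \<le> expec (rows ?B d p) (\<lambda>xs. expec (rows (M * ?B) d p) (\<lambda>ys. indicator {rs. \<not> good_block N L rs} xs * indicator (?S M) ys))"
    unfolding prob_eq_expec expec_rows_add by (intro expec_mono) (auto dest!: length_rows)
  also have "\<dots> = measure_pmf.prob (rows ?B d p) {rs. \<not> good_block N L rs} * measure_pmf.prob (rows (M * ?B) d p) (?S M)"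
    by simp
  also have "\<dots> \<le> ?q * ?q ^ M"
    using Suc prob_good_block[OF assms] q by (intro mult_mono) auto
  finally show ?case by simp
qed simp

section \<open>Existence of regular graphs\<close>

text \<open>The Cayley graph of the cyclic group of order \<open>n\<close> with connection set
  \<open>S\<close>.\<close>

lemma circulant_regular:
  fixes n :: nat and S :: "nat set"
  assumes S: "S \<subseteq> {1..<n}" and sym: "\<And>k. k \<in> S \<Longrightarrow> n - k \<in> S"
  shows "regular_graphs n (card S) \<noteq> {}"
proof -
  define f where "f u v = nat ((int u - int v) mod int n)" for u v
  define E where "E = {{u, v} | u v. u \<in> vertices n \<and> v \<in> vertices n \<and> u \<noteq> v \<and> f u v \<in> S}"
  have f_sym: "f v u \<in> S" if "f u v \<in> S" for u v
  proof -
    have n: "0 < int n" using that S by auto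
    have "(int u - int v) mod int n \<noteq> 0" using that S by (auto simp: f_def)
    then have "(int v - int u) mod int n = int n - (int u - int v) mod int n"
      using zmod_zminus1_eq_if[of "int u - int v" "int n"] by simp
    moreover have "0 \<le> (int u - int v) mod int n" "(int u - int v) mod int n < int n" using n by auto
    ultimately have "f v u = n - f u v" by (simp add: f_def nat_diff_distrib)
    then show ?thesis using sym[OF that] by simp
  qed
  have inj: "inj_on (f u) (vertices n)" for u
  proof (rule inj_onI)
    fix v w assume vw: "v \<in> vertices n" "w \<in> vertices n" "f u v = f u w"
    then have n: "0 < int n" by (auto simp: vertices_def)
    have "(int u - int v) mod int n = (int u - int w) mod int n"
      using vw(3) pos_mod_sign[OF n] unfolding f_def by (metis eq_nat_nat_iff)
    then have "int n dvd (int u - int v) - (int u - int w)" by (simp add: mod_eq_dvd_iff)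
    then have "int n dvd (int w - int v)" by simp
    moreover have "\<bar>int w - int v\<bar> < int n" using vw by (auto simp: vertices_def)
    ultimately have "int w - int v = 0" using zdvd_imp_le[of "int n" "\<bar>int w - int v\<bar>"] by (cases "int w = int v") auto
    then show "v = w" by simp
  qed
  have sub: "E \<subseteq> nsets (vertices n) 2" by (auto simp: E_def)
  have nb: "nbrs E u = {v \<in> vertices n. f u v \<in> S}" if u: "u \<in> vertices n" for u
  proof -
    have "f u u \<notin> S" using S by (auto simp: f_def)
    then show ?thesis using u f_sym by (auto simp: nbrs_def E_def doubleton_eq_iff)
  qed
  have "degree E u = card S" if u: "u \<in> vertices n" for u
  proof -
    have "f u ` vertices n \<subseteq> {..<n}"
      using u by (auto simp: f_def vertices_def nat_less_iff)
    moreover have "card (f u ` vertices n) = n" using inj by (simp add: card_image vertices_def)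
    ultimately have "f u ` vertices n = {..<n}" by (intro card_subset_eq) auto
    then have "f u ` {v \<in> vertices n. f u v \<in> S} = S" using S by (auto simp: image_iff subset_iff)
    then have "card {v \<in> vertices n. f u v \<in> S} = card S"
      using card_image[of "f u" "{v \<in> vertices n. f u v \<in> S}"] inj_on_subset[OF inj[of u]] by auto
    then show ?thesis by (simp only: degree_eq_card_nbrs[OF sub] nb[OF u])
  qed
  then show ?thesis using sub by (auto simp: regular_graphs_def)
qed

text \<open>Makes \<open>random_regular_graph\<close> the intended uniform law. The residues
  \<open>1..k\<close> and their negatives give an even degree. An odd degree forces \<open>n\<close>
  to be even, and the self-inverse residue \<open>n / 2\<close> supplies the remaining
  neighbour.\<close>

lemma regular_graphs_nonempty:
  assumes d: "d < n" and even: "even (n * d)"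
  shows "regular_graphs n d \<noteq> {}"
proof -
  define k where "k = d div 2"
  have k: "2 * k < n" using d by (simp add: k_def)
  define S where "S = {1..k} \<union> {n - k..<n}"
  have fS: "finite S" by (simp add: S_def)
  have cS: "card S = 2 * k" unfolding S_def using k by (subst card_Un_disjoint) auto
  show ?thesis
  proof (cases "even d")
    case True
    then have "card S = d" by (simp add: cS k_def)
    moreover have "regular_graphs n (card S) \<noteq> {}"
      using k by (intro circulant_regular) (auto simp: S_def)
    ultimately show ?thesis by simp
  next
    case False
    then have n: "even n" using even by simp
    then obtain h where h: "n = 2 * h" by blast
    have d': "d = 2 * k + 1" using False by (simp add: k_def)
    then have "k < h" using d h by simp
    then have "h \<notin> S" by (simp add: S_def h)
    then have "card (insert h S) = d" using fS cS d' by simp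
    moreover have "regular_graphs n (card (insert h S)) \<noteq> {}"
      using k \<open>k < h\<close> by (intro circulant_regular) (auto simp: S_def h)
    ultimately show ?thesis by simp
  qed
qed

section \<open>The two tails\<close>

lemma explore_mono: "snd (explore V E rs) \<subseteq> snd (explore V E (rs @ ys))"
proof (induction ys rule: rev_induct)
  case (snoc y ys)
  have "snd (explore V E (rs @ ys)) \<subseteq> snd (explore V E ((rs @ ys) @ [y]))"
    unfolding explore_snoc by (auto simp: explore_step_def Let_def)
  with snoc show ?case by (metis append_assoc order_trans)
qed simp

context regular_graph
begin

text \<open>A block works from any starting state, because the number of active vertices before it
  is at least 0. Rise, drop and loss balance as \<open>5 - 4 - 1 = 0\<close>, and strictness in the
  drop condition keeps some vertex active throughout the last \<open>L\<close> steps.\<close>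

lemma good_block_L1:
  assumes rs: "length rs = M * (49 * L)" "length rs \<le> card V" and i: "i < M"
    and good: "good_block (d - 1) L (take (49 * L) (drop (i * (49 * L)) rs))"
    and loss: "real (total_loss rs) \<le> sqrt (real L)" and D: "snd (explore V E rs) \<subseteq> D"
  shows "L \<le> L1 V D"
proof -
  let ?B = "49 * L"
  define pre b1 b2 post where "pre = take (i * ?B) rs" and "b1 = take (48 * L) (take ?B (drop (i * ?B) rs))"
    and "b2 = drop (48 * L) (take ?B (drop (i * ?B) rs))" and "post = drop ?B (drop (i * ?B) rs)"
  have split: "rs = pre @ b1 @ b2 @ post"
    unfolding pre_def b1_def b2_def post_def by (metis append_assoc append_take_drop_id)
  have "Suc i * ?B \<le> M * ?B" using i by (intro mult_le_mono1) simp
  then have len: "length b2 = L" using rs by (simp add: b2_def)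
  have lens: "length pre + length b1 + length b2 \<le> card V" using rs(2) split by (metis add.assoc le_add1 length_append order_trans)
  have pos: "0 < num_active ((pre @ b1) @ take t b2)" if t: "t < length b2" for t
  proof -
    have "int (num_active (pre @ (b1 @ take t b2))) \<ge> int (num_active pre) + walk (d - 1) (b1 @ take t b2)
        - (int (total_loss (pre @ (b1 @ take t b2))) - int (total_loss pre))"
      using lens t by (intro num_active_ge) simp
    moreover have "(pre @ (b1 @ take t b2)) @ (drop t b2 @ post) = rs"
      unfolding split by (metis append_assoc append_take_drop_id)
    then have "total_loss (pre @ (b1 @ take t b2)) \<le> total_loss rs" by (metis total_loss_mono)
    ultimately have "walk (d - 1) b1 + walk (d - 1) (take t b2) - int (total_loss rs) \<le> int (num_active ((pre @ b1) @ take t b2))"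
      by (simp add: walk_append)
    then have "real_of_int (walk (d - 1) b1) + real_of_int (walk (d - 1) (take t b2)) - real (total_loss rs)
        \<le> real (num_active ((pre @ b1) @ take t b2))" by linarith
    moreover have "5 * sqrt (real L) \<le> real_of_int (walk (d - 1) b1)"
      using good by (simp add: good_block_def b1_def)
    moreover have "- (4 * sqrt (real L)) < real_of_int (walk (d - 1) (take t b2))"
      using good t len by (simp add: good_block_def b2_def)
    ultimately have "0 < real (num_active ((pre @ b1) @ take t b2))" using loss by linarith
    then show ?thesis by simp
  qed
  have "snd (explore V E ((pre @ b1) @ b2)) \<subseteq> D"
    using explore_mono[of V E "(pre @ b1) @ b2" post] D split by simp
  then have "length b2 \<le> L1 V D"
    using lens by (intro long_excursion_L1[OF _ pos]) auto
  then show ?thesis by (simp add: len)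
qed

text \<open>Failure needs either no good block or a loss above \<open>sqrt L\<close>. Markov's
  inequality for the latter is built into a pointwise bound, so the expected loss remains visible
  for averaging over graphs.\<close>

lemma prob_small_L1:
  assumes "M * (49 * L) \<le> card V" "0 < L"
  shows "measure_pmf.prob (percolate p E) {D. L1 V D < L}
    \<le> measure_pmf.prob (rows (M * (49 * L)) d p)
        {rs. \<forall>i<M. \<not> good_block (d - 1) L (take (49 * L) (drop (i * (49 * L)) rs))}
      + expec (rows (M * (49 * L)) d p) (\<lambda>rs. real (total_loss rs)) / sqrt (real L)"
proof -
  let ?m = "M * (49 * L)"
  let ?bad = "{rs. \<forall>i<M. \<not> good_block (d - 1) L (take (49 * L) (drop (i * (49 * L)) rs))}"
  let ?g = "\<lambda>rs. indicator ?bad rs + real (total_loss rs) / sqrt (real L)"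
  have "measure_pmf.prob (percolate p E) {D. L1 V D < L}
      = expec (rows ?m d p) (\<lambda>rs. measure_pmf.prob (map_pmf (\<lambda>Y. snd (explore V E rs) \<union> Y)
          (percolate p {e \<in> E. e \<inter> fst (explore V E rs) = {}})) {D. L1 V D < L})"
    using finE by (subst percolate_explore[OF assms(1)], subst prob_bind) (auto simp: finite_set_percolate)
  also have "\<dots> \<le> expec (rows ?m d p) ?g"
  proof (rule expec_mono)
    fix rs assume "rs \<in> set_pmf (rows ?m d p)"
    then have len: "length rs = ?m" by (rule length_rows)
    let ?M = "map_pmf (\<lambda>Y. snd (explore V E rs) \<union> Y) (percolate p {e \<in> E. e \<inter> fst (explore V E rs) = {}})"
    show "measure_pmf.prob ?M {D. L1 V D < L} \<le> ?g rs"
    proof (cases "rs \<in> ?bad \<or> sqrt (real L) < real (total_loss rs)")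
      case True
      then have "1 \<le> ?g rs"
      proof
        assume "sqrt (real L) < real (total_loss rs)"
        then have "1 \<le> real (total_loss rs) / sqrt (real L)" using assms(2) by (simp add: pos_le_divide_eq)
        moreover have "(0::real) \<le> indicator ?bad rs" by simp
        ultimately show ?thesis by linarith
      qed simp
      then show ?thesis using measure_pmf.prob_le_1[of ?M "{D. L1 V D < L}"] by linarith
    next
      case False
      then obtain i where i: "i < M" "good_block (d - 1) L (take (49 * L) (drop (i * (49 * L)) rs))" by auto
      have "L \<le> L1 V D" if "D \<in> set_pmf ?M" for D
        using that False i len assms by (intro good_block_L1[where rs=rs and M=M and i=i]) auto
      then have "measure_pmf.prob ?M {D. L1 V D < L} \<le> measure_pmf.prob ?M {}"
        by (intro prob_mono_set_pmf) (auto simp: not_less[symmetric])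
      moreover have "0 \<le> ?g rs" by (intro add_nonneg_nonneg) auto
      ultimately show ?thesis by (simp only: measure_empty order_trans)
    qed
  qed simp
  also have "\<dots> = measure_pmf.prob (rows ?m d p) ?bad + expec (rows ?m d p) (\<lambda>rs. real (total_loss rs)) / sqrt (real L)"
    by (simp add: expec_add)
  finally show ?thesis .
qed

end

lemma sum_prob_small_L1:
  assumes m: "8 * (M * (49 * L)) \<le> n" "16 \<le> n" and d: "3 \<le> d" and L: "100 \<le> L"
    and p: "p = (1 + e) / (real d - 1)" and e: "\<bar>e\<bar> * sqrt (real L) \<le> 1/100"
  shows "(\<Sum>G\<in>regular_graphs n d. measure_pmf.prob (percolate p G) {D. L1 (vertices n) D < L})
    \<le> real (card (regular_graphs n d)) * ((1 - rise_prob / 2) ^ M + 98 * (real (M * (49 * L)))\<^sup>2 / real n / sqrt (real L))"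
proof -
  let ?R = "regular_graphs n d" and ?V = "vertices n" and ?m = "M * (49 * L)"
  have s: "10 \<le> sqrt (real L)" using L by (intro real_le_rsqrt) auto
  have e1: "\<bar>e\<bar> \<le> 1/10" using e mult_left_mono[OF s, of "\<bar>e\<bar>"] by simp
  have p': "p = (1 + e) / real (d - 1)" and N: "2 \<le> d - 1" using p d by (simp_all add: of_nat_diff)
  have p01: "0 \<le> p" "p \<le> 11/20" using near_critical[OF N p' e1] by auto
  have "p * real d = (1 + e) * (real d / (real d - 1))" using p by simp
  also have "\<dots> \<le> (11/10) * (3/2)" using e1 d by (intro mult_mono) (auto simp: field_simps)
  finally have pd: "p * real d \<le> 2" by simp
  have "(\<Sum>G\<in>?R. measure_pmf.prob (percolate p G) {D. L1 ?V D < L})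
      \<le> (\<Sum>G\<in>?R. (1 - rise_prob / 2) ^ M + expec (rows ?m d p) (\<lambda>rs. real (regular_graph.total_loss ?V G d rs)) / sqrt (real L))"
  proof (rule sum_mono)
    fix G assume G: "G \<in> ?R"
    interpret regular_graph ?V G d by (rule regular_graph_regular_graphs[OF G])
    have "measure_pmf.prob (percolate p G) {D. L1 ?V D < L}
        \<le> measure_pmf.prob (rows ?m d p) {rs. \<forall>i<M. \<not> good_block (d - 1) L (take (49 * L) (drop (i * (49 * L)) rs))}
          + expec (rows ?m d p) (\<lambda>rs. real (total_loss rs)) / sqrt (real L)"
      using m L by (intro prob_small_L1) (auto simp: vertices_def)
    moreover have "measure_pmf.prob (rows ?m d p) {rs. \<forall>i<M. \<not> good_block (d - 1) L (take (49 * L) (drop (i * (49 * L)) rs))}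
        \<le> (1 - rise_prob / 2) ^ M"
      by (rule prob_no_good_block[OF N _ p' L e]) simp
    ultimately show "measure_pmf.prob (percolate p G) {D. L1 ?V D < L}
        \<le> (1 - rise_prob / 2) ^ M + expec (rows ?m d p) (\<lambda>rs. real (total_loss rs)) / sqrt (real L)" by linarith
  qed
  also have "\<dots> = real (card ?R) * (1 - rise_prob / 2) ^ M
      + (\<Sum>G\<in>?R. expec (rows ?m d p) (\<lambda>rs. real (regular_graph.total_loss ?V G d rs))) / sqrt (real L)"
    by (simp add: sum.distrib sum_divide_distrib)
  also have "\<dots> \<le> real (card ?R) * (1 - rise_prob / 2) ^ M
      + (real (card ?R) * (98 * (real ?m)\<^sup>2 / real n)) / sqrt (real L)"
    using p01 pd m by (intro add_left_mono divide_right_mono sum_expec_total_loss) auto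
  finally show ?thesis by (simp add: distrib_left)
qed

lemma prob_percolated_regular_graph:
  assumes "regular_graphs n d \<noteq> {}"
  shows "measure_pmf.prob (percolated_regular_graph n d p) X
    = (\<Sum>G\<in>regular_graphs n d. measure_pmf.prob (percolate p G) X) / real (card (regular_graphs n d))"
  unfolding percolated_regular_graph_def random_regular_graph_def
  using assms finite_regular_graphs[of n d]
  by (subst prob_bind) (auto simp: integral_pmf_of_set intro!: finite_set_percolate dest: finite_regular_graph)

text \<open>Here \<open>s\<close> is \<open>sqrt A\<close> and \<open>x\<close> is the cube root of
  \<open>n\<close>. With \<open>L\<close> about \<open>(x / s)\<^sup>2\<close>, the loss term is of
  order \<open>M\<^sup>2 / s ^ 3\<close>, while the probability of no good block is exponentially
  small in \<open>M\<close>. Taking \<open>M\<close> about \<open>sqrt s\<close> makes the first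
  \<open>O(1 / s\<^sup>2)\<close> and the second smaller than any power of \<open>s\<close>.\<close>

lemma prob_L1_outside_window:
  fixes lam s x p :: real
  assumes ne: "regular_graphs n d \<noteq> {}" and d: "3 \<le> d" and n: "16 \<le> n" "real n = x ^ 3" and x: "0 < x"
    and p: "p = (1 + lam * (1 / x)) / (real d - 1)"
    and s: "1 \<le> s" "200 * \<bar>lam\<bar> \<le> s" and xs: "10 * s \<le> x" "10 * \<bar>lam\<bar> \<le> x" "40 * \<bar>lam\<bar> + 80 \<le> x" "1600 * s \<le> x"
  shows "measure_pmf.prob (percolated_regular_graph n d p)
      {G. real (L1 (vertices n) G) \<notin> {inverse (s\<^sup>2) * x\<^sup>2 .. s\<^sup>2 * x\<^sup>2}}
    \<le> exp (- (rise_prob / 2) * sqrt s) + 3764768 / s\<^sup>2 + (40 * \<bar>lam\<bar> + 80) / s\<^sup>2"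
proof -
  let ?R = "regular_graphs n d" and ?V = "vertices n"
  define L where "L = nat \<lceil>x\<^sup>2 / s\<^sup>2\<rceil>"
  define M where "M = nat \<lceil>sqrt s\<rceil>"
  have s0: "0 < s" using s by simp
  have c0: "0 < real (card ?R)" using ne finite_regular_graphs[of n d] by (simp add: card_gt_0_iff)
  have xs2: "100 \<le> x\<^sup>2 / s\<^sup>2"
  proof -
    have "(10 * s)\<^sup>2 \<le> x\<^sup>2" using xs(1) s0 by (intro power_mono) auto
    then show ?thesis using s0 by (simp add: power_mult_distrib pos_le_divide_eq)
  qed
  have L_ge: "x\<^sup>2 / s\<^sup>2 \<le> real L" unfolding L_def by (rule real_nat_ceiling_ge)
  have L100: "100 \<le> L" using xs2 L_ge by linarith
  have L_le: "real L \<le> 2 * (x\<^sup>2 / s\<^sup>2)" using xs2 unfolding L_def by linarith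
  have sqrtL: "sqrt (real L) \<le> 2 * (x / s)"
  proof (rule real_le_lsqrt)
    show "real L \<le> (2 * (x / s))\<^sup>2" using L_le xs2 by (simp add: power_mult_distrib power_divide)
  qed (use x s0 in auto)
  have M_le: "real M \<le> 2 * sqrt s" and M_ge: "sqrt s \<le> real M"
    using s(1) real_sqrt_ge_one[OF s(1)] unfolding M_def by linarith+
  have M2: "(real M)\<^sup>2 \<le> 4 * s"
  proof -
    have "(real M)\<^sup>2 \<le> (2 * sqrt s)\<^sup>2" using M_le by (intro power_mono) auto
    then show ?thesis using s0 by (simp add: power_mult_distrib)
  qed
  have "sqrt s \<le> s" using s(1) by (intro real_le_lsqrt) (auto simp: power2_eq_square)
  then have Ms: "real M \<le> 2 * s" using M_le by linarith
  \<comment> \<open>The 1568 is \<open>8 * 49 * 4\<close>, which the hypothesis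
    \<open>1600 * s <= x\<close> covers.\<close>
  have m: "8 * (M * (49 * L)) \<le> n"
  proof -
    have "real M * real L \<le> (2 * s) * (2 * (x\<^sup>2 / s\<^sup>2))" using Ms L_le s0 by (intro mult_mono) auto
    also have "\<dots> = 4 * (x\<^sup>2 / s)" using s0 by (simp add: power2_eq_square)
    also have "\<dots> \<le> 4 * (x\<^sup>2 / 1)" using s(1) by (intro mult_left_mono divide_left_mono) auto
    finally have "392 * (real M * real L) \<le> 1568 * x\<^sup>2" by linarith
    also have "\<dots> \<le> x * x\<^sup>2" using xs(4) s(1) by (intro mult_right_mono) auto
    also have "\<dots> = real n" unfolding n(2) by (simp add: power2_eq_square power3_eq_cube)
    finally have "real (8 * (M * (49 * L))) \<le> real n" by simp
    then show ?thesis by (simp only: of_nat_le_iff)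
  qed
  \<comment> \<open>The drift at scale \<open>sqrt L\<close> is at most
    \<open>2 * \<bar>lam\<bar> / s\<close>, so the block estimates need \<open>s\<close> large in
    terms of \<open>lam\<close>.\<close>
  have e: "\<bar>lam * (1 / x)\<bar> * sqrt (real L) \<le> 1/100"
  proof -
    have "\<bar>lam * (1 / x)\<bar> * sqrt (real L) \<le> \<bar>lam * (1 / x)\<bar> * (2 * (x / s))"
      using sqrtL by (intro mult_left_mono) auto
    also have "\<dots> = 2 * \<bar>lam\<bar> / s" using x s0 by (simp add: abs_mult)
    also have "\<dots> \<le> 1/100" using s(2) s0 by (simp add: pos_divide_le_eq)
    finally show ?thesis .
  qed
  \<comment> \<open>The constant 3764768 is \<open>98 * 49\<^sup>2 * 16\<close>, where 16 collects
    the factors 4, 2 and 2 from the bounds on \<open>M\<^sup>2\<close>, \<open>L\<close> and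
    \<open>sqrt L\<close>.\<close>
  have loss: "98 * (real (M * (49 * L)))\<^sup>2 / real n / sqrt (real L) \<le> 3764768 / s\<^sup>2"
  proof -
    have Ls: "real L = sqrt (real L) * sqrt (real L)" by simp
    have l0: "0 < sqrt (real L)" using L100 by simp
    have "98 * (real (M * (49 * L)))\<^sup>2 / real n / sqrt (real L)
        = 235298 * ((real M)\<^sup>2 * (real L * (real L / sqrt (real L)))) / x ^ 3"
      unfolding n(2) by (simp add: power2_eq_square mult_ac)
    also have "real L / sqrt (real L) = sqrt (real L)" by (rule real_div_sqrt) simp
    also have "235298 * ((real M)\<^sup>2 * (real L * sqrt (real L))) / x ^ 3
        \<le> 235298 * ((4 * s) * ((2 * (x\<^sup>2 / s\<^sup>2)) * (2 * (x / s)))) / x ^ 3"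
      using M2 L_le sqrtL x s0 by (intro divide_right_mono mult_left_mono mult_mono) auto
    also have "\<dots> = 3764768 / s\<^sup>2"
      using x s0 by (simp add: power2_eq_square power3_eq_cube)
    finally show ?thesis .
  qed
  have rise: "(1 - rise_prob / 2) ^ M \<le> exp (- (rise_prob / 2) * sqrt s)"
  proof -
    have "(1 - rise_prob / 2) ^ M \<le> exp (- (rise_prob / 2)) ^ M"
      using exp_ge_add_one_self[of "- (rise_prob / 2)"] rise_prob_pos by (intro power_mono) auto
    also have "\<dots> = exp (real M * - (rise_prob / 2))" by (simp only: exp_of_nat_mult)
    also have "\<dots> \<le> exp (- (rise_prob / 2) * sqrt s)"
      using mult_right_mono[OF M_ge, of rise_prob] rise_prob_pos by (simp add: mult.commute)
    finally show ?thesis .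
  qed
  have low: "(\<Sum>G\<in>?R. measure_pmf.prob (percolate p G) {D. L1 ?V D < L})
      \<le> real (card ?R) * (exp (- (rise_prob / 2) * sqrt s) + 3764768 / s\<^sup>2)"
  proof -
    have "(\<Sum>G\<in>?R. measure_pmf.prob (percolate p G) {D. L1 ?V D < L})
        \<le> real (card ?R) * ((1 - rise_prob / 2) ^ M + 98 * (real (M * (49 * L)))\<^sup>2 / real n / sqrt (real L))"
      by (rule sum_prob_small_L1[OF m n(1) d L100 p e])
    also have "\<dots> \<le> real (card ?R) * (exp (- (rise_prob / 2) * sqrt s) + 3764768 / s\<^sup>2)"
      using loss rise by (intro mult_left_mono add_mono) auto
    finally show ?thesis .
  qed
  have up: "measure_pmf.prob (percolate p G) {D. s\<^sup>2 * x\<^sup>2 < real (L1 ?V D)} \<le> (40 * \<bar>lam\<bar> + 80) / s\<^sup>2"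
    if G: "G \<in> ?R" for G
  proof -
    have "measure_pmf.prob (percolate p G) {D. s\<^sup>2 * x\<^sup>2 < real (L1 ?V D)}
        \<le> real n * (4 * (10 * \<bar>lam\<bar> + 20) * (1 / x)) / (s\<^sup>2 * x\<^sup>2)"
    proof (rule L1_upper_tail[OF G d _ _ _ _ p])
      show "1 \<le> n" using n by simp
      show "1 \<le> s\<^sup>2 * x\<^sup>2 * (1 / x)\<^sup>2" using s(1) x by (simp add: power_divide)
    qed (use x xs s0 in \<open>auto simp: field_simps\<close>)
    also have "\<dots> = (40 * \<bar>lam\<bar> + 80) / s\<^sup>2"
      using x s0 unfolding n(2) by (simp add: field_simps power2_eq_square power3_eq_cube)
    finally show ?thesis .
  qed
  let ?X = "{G. real (L1 ?V G) \<notin> {inverse (s\<^sup>2) * x\<^sup>2 .. s\<^sup>2 * x\<^sup>2}}"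
  have "(\<Sum>G\<in>?R. measure_pmf.prob (percolate p G) ?X)
      \<le> (\<Sum>G\<in>?R. measure_pmf.prob (percolate p G) {D. L1 ?V D < L} + (40 * \<bar>lam\<bar> + 80) / s\<^sup>2)"
  proof (rule sum_mono)
    fix G assume G: "G \<in> ?R"
    have "?X \<subseteq> {D. L1 ?V D < L} \<union> {D. s\<^sup>2 * x\<^sup>2 < real (L1 ?V D)}"
      using L_ge by (auto simp: field_simps not_le)
    then have "measure_pmf.prob (percolate p G) ?X
        \<le> measure_pmf.prob (percolate p G) ({D. L1 ?V D < L} \<union> {D. s\<^sup>2 * x\<^sup>2 < real (L1 ?V D)})"
      by (intro measure_pmf.finite_measure_mono) auto
    also have "\<dots> \<le> measure_pmf.prob (percolate p G) {D. L1 ?V D < L}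
        + measure_pmf.prob (percolate p G) {D. s\<^sup>2 * x\<^sup>2 < real (L1 ?V D)}"
      by (intro measure_Un_le) auto
    finally show "measure_pmf.prob (percolate p G) ?X
        \<le> measure_pmf.prob (percolate p G) {D. L1 ?V D < L} + (40 * \<bar>lam\<bar> + 80) / s\<^sup>2"
      using up[OF G] by linarith
  qed
  also have "\<dots> \<le> real (card ?R) * (exp (- (rise_prob / 2) * sqrt s) + 3764768 / s\<^sup>2 + (40 * \<bar>lam\<bar> + 80) / s\<^sup>2)"
    using low by (simp add: sum.distrib distrib_left)
  finally show ?thesis
    unfolding prob_percolated_regular_graph[OF ne] using c0 by (simp add: pos_divide_le_eq mult.commute)
qed

lemma cube_root_powr:
  fixes n :: real
  assumes "0 < n"
  defines "x \<equiv> n powr (1/3)"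
  shows "x ^ 3 = n" "n powr (-1/3) = 1 / x" "n powr (2/3) = x\<^sup>2"
proof -
  show "x ^ 3 = n" using assms by (simp add: x_def powr_power)
  show "n powr (2/3) = x\<^sup>2" using assms by (simp add: x_def powr_power)
  show "n powr (-1/3) = 1 / x" using assms by (simp add: x_def powr_minus_divide)
qed

theorem theorem1p1:
  fixes lam :: real
  shows "\<exists>A\<^sub>0::real. \<forall>A\<ge>A\<^sub>0. \<exists>n\<^sub>0::nat. \<forall>n\<ge>n\<^sub>0. \<forall>d::nat.
    3 \<le> d \<longrightarrow> d \<le> n - 1 \<longrightarrow> even (n * d) \<longrightarrow>
    (let p = (1 + lam * real n powr (-1/3)) / (real d - 1) in
      measure_pmf.prob (percolated_regular_graph n d p)
        {G. real (L1 (vertices n) G) \<notin> {inverse A * real n powr (2/3) .. A * real n powr (2/3)}}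
      \<le> 20 * A powr (-1/2))"
proof -
  define c where "c = rise_prob / 2"
  have c: "0 < c" using rise_prob_pos by (simp add: c_def)
  \<comment> \<open>The probability of no good block has to fall below \<open>1 / s\<close>; the
    stretched exponential does so beyond a threshold \<open>S\<close> that depends only on
    \<open>c\<close>.\<close>
  have "((\<lambda>s. s * exp (- c * sqrt s)) \<longlongrightarrow> 0) at_top" using c by real_asymp
  then have "\<forall>\<^sub>F s in at_top. s * exp (- c * sqrt s) < 1" by (rule order_tendstoD) simp
  then obtain S where S: "\<And>s. S \<le> s \<Longrightarrow> s * exp (- c * sqrt s) < 1"
    by (auto simp: eventually_at_top_linorder)
  \<comment> \<open>Chosen so that \<open>T <= s\<close> lets one factor \<open>s\<close> absorb
    both 3764768 and \<open>40 * \<bar>lam\<bar> + 80\<close>, besides ensuring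
    \<open>S <= s\<close> and \<open>200 * \<bar>lam\<bar> <= s\<close>.\<close>
  define T where "T = 3764768 + 200 * \<bar>lam\<bar> + \<bar>S\<bar>"
  show ?thesis
  proof (intro exI[of _ "T\<^sup>2"] allI impI)
    fix A :: real assume A: "T\<^sup>2 \<le> A"
    define s where "s = sqrt A"
    have "0 \<le> T" by (simp add: T_def)
    then have sT: "T \<le> s" using real_le_rsqrt[OF A] by (simp add: s_def)
    have A0: "0 < A" using A less_le_trans[of 0 "T\<^sup>2" A] by (simp add: T_def add_pos_nonneg)
    have s: "1 \<le> s" "3764768 \<le> s" "200 * \<bar>lam\<bar> \<le> s" "S \<le> s" "40 * \<bar>lam\<bar> + 80 \<le> s"
      using sT unfolding T_def by linarith+
    have s2: "A = s\<^sup>2" using A0 by (simp add: s_def)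
    have As: "A powr (-1/2) = 1 / s" using A0 by (simp add: s_def powr_minus_divide powr_half_sqrt)
    \<comment> \<open>Exceeds each of the four lower bounds on \<open>x\<close> that
      \<open>prob_L1_outside_window\<close> asks for.\<close>
    define X where "X = 1610 * s + 50 * \<bar>lam\<bar> + 80"
    show "\<exists>n\<^sub>0::nat. \<forall>n\<ge>n\<^sub>0. \<forall>d::nat.
      3 \<le> d \<longrightarrow> d \<le> n - 1 \<longrightarrow> even (n * d) \<longrightarrow>
      (let p = (1 + lam * real n powr (-1/3)) / (real d - 1) in
        measure_pmf.prob (percolated_regular_graph n d p)
          {G. real (L1 (vertices n) G) \<notin> {inverse A * real n powr (2/3) .. A * real n powr (2/3)}}
        \<le> 20 * A powr (-1/2))"
    proof (intro exI[of _ "nat \<lceil>X ^ 3\<rceil> + 16"] allI impI)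
      fix n d :: nat assume n: "nat \<lceil>X ^ 3\<rceil> + 16 \<le> n" and d: "3 \<le> d" "d \<le> n - 1" "even (n * d)"
      define x where "x = real n powr (1/3)"
      have n16: "16 \<le> n" "0 < real n" using n by auto
      note x3 = cube_root_powr[OF n16(2), folded x_def]
      have x0: "0 < x" using n16 by (simp add: x_def)
      have "X ^ 3 \<le> x ^ 3" unfolding x3 using n by linarith
      then have Xx: "X \<le> x" using x0 power_le_imp_le_base[of X 2 x] by (simp add: numeral_eq_Suc)
      have ne: "regular_graphs n d \<noteq> {}" using d n16 by (intro regular_graphs_nonempty) auto
      have "measure_pmf.prob (percolated_regular_graph n d ((1 + lam * (1 / x)) / (real d - 1)))
          {G. real (L1 (vertices n) G) \<notin> {inverse (s\<^sup>2) * x\<^sup>2 .. s\<^sup>2 * x\<^sup>2}}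
        \<le> exp (- c * sqrt s) + 3764768 / s\<^sup>2 + (40 * \<bar>lam\<bar> + 80) / s\<^sup>2"
        unfolding c_def
      proof (rule prob_L1_outside_window[OF ne d(1) n16(1) x3(1)[symmetric] x0 refl s(1,3)])
        show "10 * s \<le> x" "10 * \<bar>lam\<bar> \<le> x" "40 * \<bar>lam\<bar> + 80 \<le> x" "1600 * s \<le> x"
          using Xx s(1) unfolding X_def by linarith+
      qed
      \<comment> \<open>Three errors of at most \<open>1 / s = A powr (-1/2)\<close> each, well
        within the factor 20.\<close>
      also have "\<dots> \<le> 1 / s + 1 / s + 1 / s"
      proof (intro add_mono)
        show "exp (- c * sqrt s) \<le> 1 / s" using S[OF s(4)] s(1) by (simp add: pos_le_divide_eq mult.commute)
        show "3764768 / s\<^sup>2 \<le> 1 / s" "(40 * \<bar>lam\<bar> + 80) / s\<^sup>2 \<le> 1 / s"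
          using s by (simp_all add: power2_eq_square pos_divide_le_eq)
      qed
      also have "\<dots> \<le> 20 * A powr (-1/2)" unfolding As using s(1) divide_right_mono[of 3 20 s] by simp
      finally show "let p = (1 + lam * real n powr (-1/3)) / (real d - 1) in
        measure_pmf.prob (percolated_regular_graph n d p)
          {G. real (L1 (vertices n) G) \<notin> {inverse A * real n powr (2/3) .. A * real n powr (2/3)}}
        \<le> 20 * A powr (-1/2)"
        unfolding Let_def x3 s2 .
    qed
  qed
qed

end
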